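(* Let $1\le n<N$ be integers and let $\sigma=\{\sigma_i\}_{i=1}^N$ be a non-increasing sequence of non-negative numbers. For $1\le k<N$ and $1\le p\le\infty$ set $$r_{k,p}=\begin{cases}\sigma_1 & \text{if }1\le p\le2,\\ \left(\sum_{i=1}^k\sigma_i^{\frac{2p}{p-2}}\right)^{1/2-1/p} & \text{if }2<p<\infty,\\ \left(\sum_{i=1}^k\sigma_i^2\right)^{1/2} & \text{if }p=\infty.\end{cases}$$ For $p>1$ let $I_p$ be the set of all integers $1\le k<N$ satisfying $$\left(\sum_{j>k}\sigma_j^{p'}\right)^{1/p'}\ge\begin{cases}8\sqrt n\,\sigma_{k+1} & \text{if }1<p\le2,\\ 8\sqrt n\left(\sum_{j>k}\sigma_j^{\frac{2p}{p-2}}\right)^{1/2-1/p} & \text{if }2<p\le\infty,\end{cases}$$ where for $p=\infty$ the exponent $2p/(p-2)$ is understood as $2$. If $p>1$ and $I_p\ne\emptyset$, then with probability at least $1-2e^{-2n}$ one has $$\mathcal{R}_n(\mathcal{E}_p)\ge\max_{k\in I_p}\left(\frac{1}{r_{k,p}}+8\sqrt n\left(\sum_{j>k}\sigma_j^{p'}\right)^{-1/p'}\right)^{-1}\ge\frac12\max_{k\in I_p}\min\left\{r_{k,p},\ \frac{1}{8\sqrt n}\left(\sum_{j>k}\sigma_j^{p'}\right)^{1/p'}\right\}.$$ Moreover, there exist absolute positive constants $c$ and $C$ such that, setting $\eta_k:=\max_{i>k}\sigma_i\sqrt{\log(2(i-k))}$, for $p=1$ one has, with probability at least $1-2e^{-2n}$,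 $$\mathcal{R}_n(\mathcal{E}_1)\ge\max_k\left(\frac{1}{\sigma_1}+\frac{\sqrt n}{c\,\eta_k}\right)^{-1}\ge\frac12\max_k\min\left\{\sigma_1,\ \frac{c\,\eta_k}{\sqrt n}\right\},$$ where the maximum is taken over all $1\le k<N$ satisfying $\eta_k\ge C\sqrt n\,\sigma_{k+1}$ (provided at least one such $k$ exists).
   Context: $p'$ is the conjugate exponent, $1/p+1/p'=1$ ($p'=1$ for $p=\infty$). $\mathcal{E}_p=\{x\in\mathbb{R}^N:\sum_{i=1}^N(|x_i|/\sigma_i)^p\le1\}$, with $\max_{i\le N}|x_i|/\sigma_i\le1$ as defining condition for $p=\infty$ (if $\sigma_i=0$ the condition is understood as $x_i=0$; also $1/0=\infty$, $1/\infty=0$). Sums and maxima over $j>k$ or $i>k$ are over indices at most $N$. The $n$-th random radius is $\mathcal{R}_n(\mathcal{E}_p)=\max_{y\in E_n\cap\mathcal{E}_p}|y|$, where $|\cdot|$ is the Euclidean norm and $E_n$ is a random $n$-codimensional linear subspace of $\mathbb{R}^N$ distributed according to the normalized Haar measure on the Grassmannian; probability is with respect to $E_n$. *)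

theory Defs
  imports "HOL-Probability.Probability" "HOL-Library.Function_Algebras"
begin

text \<open>The absolute constants of the theorem are independent of the dimension, so the dimension
  has to be a term. Vectors of \<open>\<real>\<^sup>N\<close> are functions on the natural numbers which vanish outside of
  \<open>{1..N}\<close>; addition is the pointwise addition of \<^theory>\<open>HOL-Library.Function_Algebras\<close>.\<close>

definition fun_scale :: "real \<Rightarrow> (nat \<Rightarrow> real) \<Rightarrow> nat \<Rightarrow> real"
  where "fun_scale c x = (\<lambda>i. c * x i)"

interpretation fs: vector_space fun_scale
  by unfold_locales (auto simp: fun_scale_def fun_eq_iff algebra_simps)

definition eucl :: "nat \<Rightarrow> (nat \<Rightarrow> real) set"
  where "eucl N = {x. \<forall>i. i \<notin> {1..N} \<longrightarrow> x i = 0}"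

definition eucl_inner :: "nat \<Rightarrow> (nat \<Rightarrow> real) \<Rightarrow> (nat \<Rightarrow> real) \<Rightarrow> real"
  where "eucl_inner N x y = (\<Sum>i=1..N. x i * y i)"

abbreviation eucl_norm :: "nat \<Rightarrow> (nat \<Rightarrow> real) \<Rightarrow> real"
  where "eucl_norm N x \<equiv> L2_set x {1..N}"

definition grassmannian :: "nat \<Rightarrow> nat \<Rightarrow> (nat \<Rightarrow> real) set set"
  where "grassmannian N m = {E. fs.subspace E \<and> E \<subseteq> eucl N \<and> fs.dim E = m}"

definition orth_proj :: "nat \<Rightarrow> (nat \<Rightarrow> real) set \<Rightarrow> (nat \<Rightarrow> real) \<Rightarrow> nat \<Rightarrow> real"
  where "orth_proj N E x = (THE y. y \<in> E \<and> (\<forall>z\<in>E. eucl_inner N (x - y) z = 0))"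

text \<open>The distance of two subspaces is the operator norm of the difference of the orthogonal
  projections. It is set to \<open>0\<close> outside of the Grassmannian because \<^locale>\<open>Metric_space\<close> demands
  nonnegativity there as well.\<close>

definition grass_dist ::
    "nat \<Rightarrow> nat \<Rightarrow> (nat \<Rightarrow> real) set \<Rightarrow> (nat \<Rightarrow> real) set \<Rightarrow> real"
  where "grass_dist N m E F =
    (if E \<in> grassmannian N m \<and> F \<in> grassmannian N m
     then SUP x \<in> {x \<in> eucl N. eucl_norm N x \<le> 1}. eucl_norm N (orth_proj N E x - orth_proj N F x)
     else 0)"

definition grass_borel :: "nat \<Rightarrow> nat \<Rightarrow> (nat \<Rightarrow> real) set measure"
  where "grass_borel N m = sigma (grassmannian N m)
    {U. openin (Metric_space.mtopology (grassmannian N m) (grass_dist N m)) U}"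

text \<open>Every linear map on \<open>\<real>\<^sup>N\<close> extends to a linear map on the whole type;
  only the action on \<open>\<real>\<^sup>N\<close> (an arbitrary element of the orthogonal group) is relevant.\<close>

definition orthogonal_maps :: "nat \<Rightarrow> ((nat \<Rightarrow> real) \<Rightarrow> nat \<Rightarrow> real) set"
  where "orthogonal_maps N = {U. Vector_Spaces.linear fun_scale fun_scale U \<and>
    U ` eucl N \<subseteq> eucl N \<and> (\<forall>x\<in>eucl N. eucl_norm N (U x) = eucl_norm N x)}"

text \<open>The normalized Haar measure is the unique Borel probability measure which is invariant under
  the action of the orthogonal group.\<close>

definition is_haar_grassmannian :: "nat \<Rightarrow> nat \<Rightarrow> (nat \<Rightarrow> real) set measure \<Rightarrow> bool"
  where "is_haar_grassmannian N m \<mu> \<longleftrightarrow> prob_space \<mu> \<and>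
    space \<mu> = grassmannian N m \<and> sets \<mu> = sets (grass_borel N m) \<and>
    (\<forall>U\<in>orthogonal_maps N. \<forall>A\<in>sets \<mu>. emeasure \<mu> ((\<lambda>E. U ` E) ` A) = emeasure \<mu> A)"

text \<open>Where \<open>\<sigma> i = 0\<close> the quotient \<open>\<bar>x i\<bar> / \<sigma> i\<close> is \<open>0\<close> in HOL, hence the separate condition.\<close>

definition ellipsoid :: "nat \<Rightarrow> (nat \<Rightarrow> real) \<Rightarrow> ereal \<Rightarrow> (nat \<Rightarrow> real) set"
  where "ellipsoid N \<sigma> p = {x \<in> eucl N. (\<forall>i\<in>{1..N}. \<sigma> i = 0 \<longrightarrow> x i = 0) \<and>
    (if p = \<infinity> then (MAX i\<in>{1..N}. \<bar>x i\<bar> / \<sigma> i) \<le> 1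
     else (\<Sum>i=1..N. (\<bar>x i\<bar> / \<sigma> i) powr real_of_ereal p) \<le> 1)}"

text \<open>The supremum is a maximum: ellipsoids are compact and contain \<open>0\<close>, as does \<open>E\<close>.\<close>

definition random_radius ::
    "nat \<Rightarrow> (nat \<Rightarrow> real) \<Rightarrow> ereal \<Rightarrow> (nat \<Rightarrow> real) set \<Rightarrow> real"
  where "random_radius N \<sigma> p E = (SUP y \<in> E \<inter> ellipsoid N \<sigma> p. eucl_norm N y)"

text \<open>Only used for \<open>1 < p\<close>, where the conjugate exponent is finite.\<close>

definition conj_exp :: "ereal \<Rightarrow> real"
  where "conj_exp p = (if p = \<infinity> then 1 else real_of_ereal p / (real_of_ereal p - 1))"

lemma conj_exp: "1 < p \<Longrightarrow> 1 / p + 1 / ereal (conj_exp p) = 1"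
  by (cases p) (auto simp: conj_exp_def one_ereal_def field_simps)

text \<open>The exponent \<open>2p/(p-2)\<close>, for \<open>2 < p\<close>; it is the reciprocal of \<open>1/2 - 1/p\<close>.\<close>

definition mixed_exp :: "ereal \<Rightarrow> real"
  where "mixed_exp p = (if p = \<infinity> then 2 else 2 * real_of_ereal p / (real_of_ereal p - 2))"

lemma mixed_exp: "2 < p \<Longrightarrow> 1 / ereal (mixed_exp p) = 1 / 2 - 1 / p"
  by (cases p) (auto simp: mixed_exp_def one_ereal_def field_simps)

definition r_radius :: "(nat \<Rightarrow> real) \<Rightarrow> ereal \<Rightarrow> nat \<Rightarrow> real"
  where "r_radius \<sigma> p k =
    (if p \<le> 2 then \<sigma> 1
     else if p < \<infinity> then (\<Sum>i=1..k. \<sigma> i powr mixed_exp p) powr (1 / 2 - 1 / real_of_ereal p)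
     else (\<Sum>i=1..k. (\<sigma> i)\<^sup>2) powr (1 / 2))"

definition conj_tail :: "nat \<Rightarrow> (nat \<Rightarrow> real) \<Rightarrow> ereal \<Rightarrow> nat \<Rightarrow> real"
  where "conj_tail N \<sigma> p k = (\<Sum>j=k+1..N. \<sigma> j powr conj_exp p) powr (1 / conj_exp p)"

definition I_set :: "nat \<Rightarrow> nat \<Rightarrow> (nat \<Rightarrow> real) \<Rightarrow> ereal \<Rightarrow> nat set"
  where "I_set N n \<sigma> p = {k. 1 \<le> k \<and> k < N \<and> conj_tail N \<sigma> p k \<ge>
    (if p \<le> 2 then 8 * sqrt n * \<sigma> (k + 1)
     else 8 * sqrt n * (\<Sum>j=k+1..N. \<sigma> j powr mixed_exp p) powr real_of_ereal (1 / 2 - 1 / p))}"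

definition eta :: "nat \<Rightarrow> (nat \<Rightarrow> real) \<Rightarrow> nat \<Rightarrow> real"
  where "eta N \<sigma> k = (MAX i\<in>{k+1..N}. \<sigma> i * sqrt (ln (2 * real (i - k))))"

definition eta_set :: "real \<Rightarrow> nat \<Rightarrow> nat \<Rightarrow> (nat \<Rightarrow> real) \<Rightarrow> nat set"
  where "eta_set C N n \<sigma> = {k. 1 \<le> k \<and> k < N \<and> eta N \<sigma> k \<ge> C * sqrt n * \<sigma> (k + 1)}"

text \<open>The lower bounds are formed in \<^typ>\<open>ereal\<close>, where \<open>1 / 0 = \<infinity>\<close> and \<open>inverse \<infinity> = 0\<close>: they are
  \<open>0\<close> if one of the two denominators vanishes.\<close>

definition lower_bound :: "nat \<Rightarrow> nat \<Rightarrow> (nat \<Rightarrow> real) \<Rightarrow> ereal \<Rightarrow> nat \<Rightarrow> ereal"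
  where "lower_bound N n \<sigma> p k = inverse (1 / ereal (r_radius \<sigma> p k) +
    ereal (8 * sqrt n) * inverse (ereal (conj_tail N \<sigma> p k)))"

definition lower_bound_1 :: "real \<Rightarrow> nat \<Rightarrow> nat \<Rightarrow> (nat \<Rightarrow> real) \<Rightarrow> nat \<Rightarrow> ereal"
  where "lower_bound_1 c N n \<sigma> k = inverse (1 / ereal (\<sigma> 1) +
    ereal (sqrt n) / ereal (c * eta N \<sigma> k))"

end

theory Submission
  imports Defs
begin

text \<open>The kernel of a Gaussian matrix \<open>G\<close> with \<open>n\<close> rows replaces the random subspace, because both
  distributions are invariant under reflections. For \<open>1 < p\<close> let \<open>x\<close> be a vector of norm
  \<open>r\<^sub>k\<^sub>,\<^sub>p\<close> in the first \<open>k\<close> coordinates and \<open>a\<close> the half-widths of a box in the other ones,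
  both normalized in \<open>\<E>\<^sub>p\<close> in such a way that \<open>y / (1 + \<tau>) \<in> \<E>\<^sub>p\<close> for all \<open>y\<close> in the set \<open>x + \<tau> \<cdot> box\<close>.
  By separation this set meets the kernel if \<open>\<langle>x, v\<rangle> \<le> \<tau> \<Sum>\<^sub>j a\<^sub>j \<bar>v\<^sub>j\<bar>\<close> for all \<open>v = G\<^sup>T u\<close>, and then the
  random radius is at least \<open>r\<^sub>k\<^sub>,\<^sub>p / (1 + \<tau>)\<close>. The difference of the two sides is a sublinear function
  of \<open>u \<in> \<real>\<^sup>n\<close>, so its nonnegativity follows from a lower bound at the lattice points of norm
  about \<open>5 \<surd>n\<close> and an upper bound at the vectors of signs. These are \<open>e\<^sup>O\<^sup>(\<^sup>n\<^sup>)\<close> points, each of which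
  is handled by an exponential moment. For \<open>p = 1\<close> the box is replaced by an \<open>\<ell>\<^sub>1\<close>-ball, and the sum by
  a maximum of independent Gaussian variables.\<close>

section \<open>Gaussian vectors and matrices\<close>

text \<open>For 1 < p, after normalization, the function of u that has to be nonnegative has mean 8
  sqrt(2/pi) sqrt n |u| and fluctuations of order |u|; this is where the factor 8 sqrt n of the
  hypothesis enters. The union bound has room because the function is evaluated at two scales.
  Lattice points have norm at least 9/2 sqrt n, where the mean exceeds 27 n. The sign vectors, which
  control the rounding error, have norm sqrt n and mean about 6.4 n. The thresholds 6 n and 12 n
  separate the two: at most e^(18n/5) lattice points, each failing with probability at most
  e^(-28n/5), and 2^n sign vectors, each failing with probability at most e^(-4n), give 2 e^(-2n).
  The other obstacle is that Haar measure is given by its invariance alone. It is compared with the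
  law of the kernel by double counting the pairs (E, G) with E within r of the kernel of G. This
  compares a set of subspaces with matrices whose kernels are r-close to it, so it is applied to
  open sets exhausted from inside. The set of subspaces of radius below a given number is open,
  which is all that the theorem asks for.\<close>

definition std_normal :: "real measure"
  where "std_normal = density lborel std_normal_density"

lemma sets_std_normal [simp, measurable_cong]: "sets std_normal = sets borel"
  by (simp add: std_normal_def)

lemma space_std_normal [simp]: "space std_normal = UNIV"
  by (simp add: std_normal_def)

lemma prob_space_std_normal: "prob_space std_normal"
  unfolding std_normal_def by (rule prob_space_normal_density) simp

interpretation std_normal: prob_space std_normal
  by (rule prob_space_std_normal)

lemma nn_integral_std_normal:
  "f \<in> borel_measurable borel \<Longrightarrow>
    (\<integral>\<^sup>+t. f t \<partial>std_normal) = (\<integral>\<^sup>+t. ennreal (std_normal_density t) * f t \<partial>lborel)"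
  unfolding std_normal_def by (rule nn_integral_density) auto

lemma nn_integral_std_normal_scaled:
  fixes f :: "real \<Rightarrow> ennreal"
  assumes [measurable]: "f \<in> borel_measurable borel" and k: "k \<noteq> 0"
  shows "(\<integral>\<^sup>+t. f (k * t) \<partial>std_normal) = (\<integral>\<^sup>+u. ennreal (normal_density 0 \<bar>k\<bar> u) * f u \<partial>lborel)"
proof -
  have eq: "ennreal \<bar>k\<bar> * (ennreal (normal_density 0 \<bar>k\<bar> (k * t)) * f (k * t))
      = ennreal (std_normal_density t) * f (k * t)" for t
    using k by (simp add: normal_density_def ennreal_mult[symmetric] mult.assoc[symmetric]
      real_sqrt_mult power_mult_distrib)
  have "(\<integral>\<^sup>+u. ennreal (normal_density 0 \<bar>k\<bar> u) * f u \<partial>lborel)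
      = ennreal \<bar>k\<bar> * (\<integral>\<^sup>+t. ennreal (normal_density 0 \<bar>k\<bar> (0 + k * t)) * f (0 + k * t) \<partial>lborel)"
    using k by (intro nn_integral_real_affine) auto
  also have "\<dots> = (\<integral>\<^sup>+t. ennreal (std_normal_density t) * f (k * t) \<partial>lborel)"
    by (subst nn_integral_cmult[symmetric]) (auto simp: eq)
  finally show ?thesis
    by (simp add: nn_integral_std_normal)
qed

lemma nn_integral_std_normal_abs_scaled:
  fixes f :: "real \<Rightarrow> ennreal"
  assumes [measurable]: "f \<in> borel_measurable borel"
  shows "(\<integral>\<^sup>+t. f (\<bar>k\<bar> * t) \<partial>std_normal) = (\<integral>\<^sup>+t. f (k * t) \<partial>std_normal)"
  by (cases "k = 0") (simp_all add: nn_integral_std_normal_scaled)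

text \<open>Substituting u = k t writes the inner integral against a normal density translated by
  \<kappa> s. After Fubini the convolution of two centred normal densities appears, which is normal
  with the sum of the variances.\<close>

lemma nn_integral_std_normal_add:
  fixes f :: "real \<Rightarrow> ennreal"
  assumes [measurable]: "f \<in> borel_measurable borel" and "0 \<le> \<kappa>"
  shows "(\<integral>\<^sup>+s. (\<integral>\<^sup>+t. f (y + \<kappa> * s + k * t) \<partial>std_normal) \<partial>std_normal)
    = (\<integral>\<^sup>+t. f (y + sqrt (\<kappa>\<^sup>2 + k\<^sup>2) * t) \<partial>std_normal)"
\<comment> \<open>A degenerate summand has no density, so the convolution formula is reserved for
  nonzero coefficients.\<close>
proof (cases "\<kappa> = 0 \<or> k = 0")
  case True
  then show ?thesis
    using \<open>0 \<le> \<kappa>\<close> nn_integral_std_normal_abs_scaled[of "\<lambda>t. f (y + t)" k]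
    by (auto simp: std_normal.emeasure_space_1[simplified] mult.commute)
next
  case False
  then have pos: "0 < \<kappa>" "0 < \<bar>k\<bar>" using \<open>0 \<le> \<kappa>\<close> by auto
  have inner: "(\<integral>\<^sup>+t. f (y + \<kappa> * s + k * t) \<partial>std_normal)
      = (\<integral>\<^sup>+u. ennreal (normal_density 0 \<bar>k\<bar> (u - \<kappa> * s)) * f (y + u) \<partial>lborel)" for s
  proof -
    have "(\<integral>\<^sup>+t. f (y + \<kappa> * s + k * t) \<partial>std_normal)
        = (\<integral>\<^sup>+u. ennreal (normal_density 0 \<bar>k\<bar> u) * f (y + \<kappa> * s + u) \<partial>lborel)"
      using pos by (intro nn_integral_std_normal_scaled) auto
    also have "\<dots> = (\<integral>\<^sup>+u. ennreal (normal_density 0 \<bar>k\<bar> (- (\<kappa> * s) + 1 * u))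
        * f (y + \<kappa> * s + (- (\<kappa> * s) + 1 * u)) \<partial>lborel)"
      using nn_integral_real_affine[of "\<lambda>u. ennreal (normal_density 0 \<bar>k\<bar> u) * f (y + \<kappa> * s + u)" 1 "- (\<kappa> * s)"]
      by simp
    finally show ?thesis by simp
  qed
  have "(\<integral>\<^sup>+s. (\<integral>\<^sup>+t. f (y + \<kappa> * s + k * t) \<partial>std_normal) \<partial>std_normal)
      = (\<integral>\<^sup>+s. ennreal (normal_density 0 \<bar>\<kappa>\<bar> s)
          * (\<integral>\<^sup>+u. ennreal (normal_density 0 \<bar>k\<bar> (u - s)) * f (y + u) \<partial>lborel) \<partial>lborel)"
    unfolding inner using pos by (intro nn_integral_std_normal_scaled) auto
  also have "\<dots> = (\<integral>\<^sup>+s. (\<integral>\<^sup>+u. ennreal (normal_density 0 \<bar>k\<bar> (u - s) * normal_density 0 \<kappa> s)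
      * f (y + u) \<partial>lborel) \<partial>lborel)"
    using pos by (subst nn_integral_cmult[symmetric])
      (auto simp: ennreal_mult' mult_ac intro!: nn_integral_cong)
  also have "\<dots> = (\<integral>\<^sup>+u. (\<integral>\<^sup>+s. ennreal (normal_density 0 \<bar>k\<bar> (u - s) * normal_density 0 \<kappa> s)
      * f (y + u) \<partial>lborel) \<partial>lborel)"
    by (rule lborel_pair.Fubini') auto
  also have "\<dots> = (\<integral>\<^sup>+u. ennreal (normal_density 0 (sqrt (\<kappa>\<^sup>2 + k\<^sup>2)) u) * f (y + u) \<partial>lborel)"
    using fun_cong[OF conv_normal_density_zero_mean[OF pos(2,1)]]
    by (subst nn_integral_multc) (auto simp: add.commute)
  also have "\<dots> = (\<integral>\<^sup>+t. f (y + sqrt (\<kappa>\<^sup>2 + k\<^sup>2) * t) \<partial>std_normal)"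
    using pos by (subst nn_integral_std_normal_scaled[of "\<lambda>t. f (y + t)"]) 
       (auto simp: add_nonneg_eq_0_iff)
  finally show ?thesis .
qed

abbreviation gauss_vec :: "nat \<Rightarrow> (nat \<Rightarrow> real) measure"
  where "gauss_vec N \<equiv> PiM {1..N} (\<lambda>_. std_normal)"

abbreviation gauss_mat :: "nat \<Rightarrow> nat \<Rightarrow> (nat \<Rightarrow> nat \<Rightarrow> real) measure"
  where "gauss_mat n N \<equiv> PiM {..<n} (\<lambda>_. gauss_vec N)"

interpretation gauss_entry: product_prob_space "\<lambda>_::nat. std_normal" "{1..N}" for N
  by unfold_locales

lemma prob_space_gauss_vec: "prob_space (gauss_vec N)"
  by (intro prob_space_PiM prob_space_std_normal)

interpretation gauss_vec: prob_space "gauss_vec N" for N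
  by (rule prob_space_gauss_vec)

lemma prob_space_gauss_mat: "prob_space (gauss_mat n N)"
  by (intro prob_space_PiM prob_space_gauss_vec)

interpretation gauss_mat: prob_space "gauss_mat n N" for n N
  by (rule prob_space_gauss_mat)

interpretation gauss_row: product_sigma_finite "\<lambda>_::'i. gauss_vec N" for N
  by unfold_locales

lemma measurable_gauss_mat_entry:
  "i \<in> J \<Longrightarrow> l \<in> {1..N} \<Longrightarrow> (\<lambda>G. G i l) \<in> borel_measurable (PiM J (\<lambda>_. gauss_vec N))"
  using measurable_compose[OF measurable_component_singleton[of i J "\<lambda>_. gauss_vec N"]
      measurable_component_singleton[of l "{1..N}" "\<lambda>_. std_normal"]]
    measurable_cong_sets[OF refl sets_std_normal]
  by blast

text \<open>A linear combination of independent Gaussian rows has independent Gaussian entries of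
  variance |k|^2. The tail estimates for combinations of rows below reduce to one-dimensional
  integrals through this identity.\<close>

lemma nn_integral_gauss_mat_prod_row_comb:
  fixes f :: "nat \<Rightarrow> real \<Rightarrow> ennreal"
  assumes "finite I" "\<And>l. l \<in> {1..N} \<Longrightarrow> f l \<in> borel_measurable borel"
  shows "(\<integral>\<^sup>+G. (\<Prod>l=1..N. f l (\<Sum>i\<in>I. k i * G i l)) \<partial>PiM I (\<lambda>_. gauss_vec N))
    = (\<Prod>l=1..N. \<integral>\<^sup>+t. f l (sqrt (\<Sum>i\<in>I. (k i)\<^sup>2) * t) \<partial>std_normal)"
  using assms
proof (induction I arbitrary: f rule: finite_induct)
  case empty
  then show ?case
    by (simp add: space_PiM std_normal.emeasure_space_1[simplified])
next
  case (insert j I)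
  note [measurable] = insert.prems and [simp] = insert.hyps
  \<comment> \<open>Integrating out the new row \<open>j\<close> replaces each column function
    \<open>f l\<close> by its average \<open>f' l\<close>, to which the induction hypothesis
    applies; hence \<open>f\<close> is arbitrary in the induction.\<close>
  define f' where "f' l s = (\<integral>\<^sup>+t. f l (s + k j * t) \<partial>std_normal)" for l s
  have [measurable]: "f' l \<in> borel_measurable borel" if "l \<in> {1..N}" for l
    using that unfolding f'_def by measurable
  have meas: "(\<lambda>G. \<Prod>l=1..N. f l (\<Sum>i\<in>insert j I. k i * G i l))
      \<in> borel_measurable (PiM (insert j I) (\<lambda>_. gauss_vec N))"
  proof (rule borel_measurable_prod_ennreal)
    fix l assume l: "l \<in> {1..N}"
    have "(\<lambda>G. \<Sum>i\<in>insert j I. k i * G i l) \<in> borel_measurable (PiM (insert j I) (\<lambda>_. gauss_vec N))"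
      using l by (intro borel_measurable_sum borel_measurable_times borel_measurable_const
        measurable_gauss_mat_entry)
    then show "(\<lambda>G. f l (\<Sum>i\<in>insert j I. k i * G i l))
        \<in> borel_measurable (PiM (insert j I) (\<lambda>_. gauss_vec N))"
      using insert.prems[OF l] by (rule measurable_compose)
  qed
  have "(\<integral>\<^sup>+G. (\<Prod>l=1..N. f l (\<Sum>i\<in>insert j I. k i * G i l)) \<partial>PiM (insert j I) (\<lambda>_. gauss_vec N))
      = (\<integral>\<^sup>+G. (\<integral>\<^sup>+g. (\<Prod>l=1..N. f l (\<Sum>i\<in>insert j I. k i * (G(j := g)) i l)) \<partial>gauss_vec N)
          \<partial>PiM I (\<lambda>_. gauss_vec N))"
    by (rule gauss_row.product_nn_integral_insert[OF insert.hyps meas])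
  also have "\<dots> = (\<integral>\<^sup>+G. (\<integral>\<^sup>+g. (\<Prod>l=1..N. f l ((\<Sum>i\<in>I. k i * G i l) + k j * g l)) \<partial>gauss_vec N)
          \<partial>PiM I (\<lambda>_. gauss_vec N))"
  proof (intro nn_integral_cong prod.cong refl)
    fix G :: "'a \<Rightarrow> nat \<Rightarrow> real" and g :: "nat \<Rightarrow> real" and l
    have "(\<Sum>i\<in>I. k i * (G(j := g)) i l) = (\<Sum>i\<in>I. k i * G i l)"
      using insert.hyps by (intro sum.cong) auto
    then show "f l (\<Sum>i\<in>insert j I. k i * (G(j := g)) i l) = f l ((\<Sum>i\<in>I. k i * G i l) + k j * g l)"
      by (simp add: add.commute)
  qed
  also have "\<dots> = (\<integral>\<^sup>+G. (\<Prod>l=1..N. f' l (\<Sum>i\<in>I. k i * G i l)) \<partial>PiM I (\<lambda>_. gauss_vec N))"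
    unfolding f'_def
    by (intro nn_integral_cong gauss_entry.product_nn_integral_prod) auto
  also have "\<dots> = (\<Prod>l=1..N. \<integral>\<^sup>+s. f' l (sqrt (\<Sum>i\<in>I. (k i)\<^sup>2) * s) \<partial>std_normal)"
    by (rule insert.IH) auto
  also have "\<dots> = (\<Prod>l=1..N. \<integral>\<^sup>+t. f l (sqrt (\<Sum>i\<in>insert j I. (k i)\<^sup>2) * t) \<partial>std_normal)"
    unfolding f'_def
    using nn_integral_std_normal_add[of "f l" "sqrt (\<Sum>i\<in>I. (k i)\<^sup>2)" 0 "k j" for l]
    by (intro prod.cong refl) (simp add: sum_nonneg add.commute)
  finally show ?case .
qed

section \<open>Invariance of product measures under shears, sign changes and reflections\<close>

interpretation lborel_entry: product_sigma_finite "\<lambda>_::'i. lborel :: real measure"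
  by unfold_locales

lemma nn_integral_lborel_translate:
  fixes f :: "real \<Rightarrow> ennreal"
  assumes [measurable]: "f \<in> borel_measurable borel"
  shows "(\<integral>\<^sup>+y. f (y + c) \<partial>lborel) = (\<integral>\<^sup>+y. f y \<partial>lborel)"
  using nn_integral_real_affine[of f 1 c] by (simp add: add.commute)

lemma nn_integral_lborel_uminus:
  fixes f :: "real \<Rightarrow> ennreal"
  assumes [measurable]: "f \<in> borel_measurable borel"
  shows "(\<integral>\<^sup>+y. f (- y) \<partial>lborel) = (\<integral>\<^sup>+y. f y \<partial>lborel)"
  using nn_integral_real_affine[of f "-1" 0] by simp

lemma measurable_fun_upd_lborel:
  assumes "f \<in> borel_measurable (PiM (insert j I) (\<lambda>_. lborel :: real measure))"
    and "x \<in> space (PiM I (\<lambda>_. lborel :: real measure))" "j \<notin> I"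
  shows "(\<lambda>y. f (x(j := y))) \<in> borel_measurable borel"
  using measurable_compose[OF measurable_component_update[OF assms(2,3)] assms(1)] by simp

lemma nn_integral_PiM_lborel_translate:
  fixes v :: "'i \<Rightarrow> real"
  assumes "finite I" "f \<in> borel_measurable (PiM I (\<lambda>_. lborel))"
  shows "(\<integral>\<^sup>+x. f (\<lambda>i\<in>I. x i + v i) \<partial>PiM I (\<lambda>_. lborel)) = (\<integral>\<^sup>+x. f x \<partial>PiM I (\<lambda>_. lborel))"
  using assms
proof (induction I arbitrary: f rule: finite_induct)
  case empty
  then show ?case by (simp add: PiM_empty nn_integral_count_space_finite restrict_def)
next
  case (insert j I)
  note [measurable] = insert.prems and [simp] = insert.hyps
  have "(\<integral>\<^sup>+x. f (\<lambda>i\<in>insert j I. x i + v i) \<partial>PiM (insert j I) (\<lambda>_. lborel))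
      = (\<integral>\<^sup>+x. (\<integral>\<^sup>+y. f (\<lambda>i\<in>insert j I. (x(j := y)) i + v i) \<partial>lborel) \<partial>PiM I (\<lambda>_. lborel))"
    by (intro lborel_entry.product_nn_integral_insert) (simp_all cong: if_cong)
  also have "\<dots> = (\<integral>\<^sup>+x. (\<integral>\<^sup>+y. f ((\<lambda>i\<in>I. x i + v i)(j := y + v j)) \<partial>lborel) \<partial>PiM I (\<lambda>_. lborel))"
    using insert.hyps by (intro nn_integral_cong arg_cong[where f = f]) (auto simp: fun_eq_iff)
  also have "\<dots> = (\<integral>\<^sup>+x. (\<integral>\<^sup>+y. f ((\<lambda>i\<in>I. x i + v i)(j := y)) \<partial>lborel) \<partial>PiM I (\<lambda>_. lborel))"
  proof (rule nn_integral_cong, rule nn_integral_lborel_translate)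
    fix x :: "'i \<Rightarrow> real"
    have "(\<lambda>i\<in>I. x i + v i) \<in> space (PiM I (\<lambda>_. lborel))"
      by (auto simp: space_PiM)
    from measurable_fun_upd_lborel[OF insert.prems this insert.hyps(2)]
    show "(\<lambda>y. f ((\<lambda>i\<in>I. x i + v i)(j := y))) \<in> borel_measurable borel" .
  qed
  also have "\<dots> = (\<integral>\<^sup>+x. (\<integral>\<^sup>+y. f (x(j := y)) \<partial>lborel) \<partial>PiM I (\<lambda>_. lborel))"
    by (rule insert.IH) measurable
  also have "\<dots> = (\<integral>\<^sup>+x. f x \<partial>PiM (insert j I) (\<lambda>_. lborel))"
    by (intro lborel_entry.product_nn_integral_insert[symmetric]) auto
  finally show ?case .
qed

text \<open>For a fixed value of \<open>x i\<close> the map is a translation of the other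
  coordinates, so coordinate \<open>i\<close> is integrated outermost.\<close>

lemma nn_integral_PiM_lborel_shear:
  fixes c :: "'i \<Rightarrow> real"
  assumes "finite I" "i \<notin> I" and [measurable]: "f \<in> borel_measurable (PiM (insert i I) (\<lambda>_. lborel))"
  shows "(\<integral>\<^sup>+x. f (\<lambda>j\<in>insert i I. if j = i then x i else x j + x i * c j) \<partial>PiM (insert i I) (\<lambda>_. lborel))
    = (\<integral>\<^sup>+x. f x \<partial>PiM (insert i I) (\<lambda>_. lborel))"
proof -
  note [simp] = assms(1,2)
  have "(\<integral>\<^sup>+x. f (\<lambda>j\<in>insert i I. if j = i then x i else x j + x i * c j) \<partial>PiM (insert i I) (\<lambda>_. lborel))
      = (\<integral>\<^sup>+y. (\<integral>\<^sup>+x. f (\<lambda>j\<in>insert i I. if j = i then y else (x(i := y)) j + y * c j)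
          \<partial>PiM I (\<lambda>_. lborel)) \<partial>lborel)"
    by (subst lborel_entry.product_nn_integral_insert_rev) (simp_all cong: if_cong)
  also have "\<dots> = (\<integral>\<^sup>+y. (\<integral>\<^sup>+x. f ((\<lambda>j\<in>I. x j + y * c j)(i := y)) \<partial>PiM I (\<lambda>_. lborel)) \<partial>lborel)"
    using assms(2) by (intro nn_integral_cong arg_cong[where f = f]) (auto simp: fun_eq_iff)
  also have "\<dots> = (\<integral>\<^sup>+y. (\<integral>\<^sup>+x. f (x(i := y)) \<partial>PiM I (\<lambda>_. lborel)) \<partial>lborel)"
    by (rule nn_integral_cong, rule nn_integral_PiM_lborel_translate[where f = "\<lambda>x. f (x(i := _))"]) auto
  also have "\<dots> = (\<integral>\<^sup>+x. f x \<partial>PiM (insert i I) (\<lambda>_. lborel))"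
    by (intro lborel_entry.product_nn_integral_insert_rev[symmetric]) auto
  finally show ?thesis .
qed

text \<open>Here coordinate \<open>i\<close> itself is translated, by an amount fixed by the others,
  so it is integrated innermost.\<close>

lemma nn_integral_PiM_lborel_add_comb:
  fixes c :: "'i \<Rightarrow> real"
  assumes "finite I" "i \<notin> I" and [measurable]: "f \<in> borel_measurable (PiM (insert i I) (\<lambda>_. lborel))"
  shows "(\<integral>\<^sup>+x. f (\<lambda>j\<in>insert i I. if j = i then x i + (\<Sum>l\<in>I. c l * x l) else x j) \<partial>PiM (insert i I) (\<lambda>_. lborel))
    = (\<integral>\<^sup>+x. f x \<partial>PiM (insert i I) (\<lambda>_. lborel))"
proof -
  note [simp] = assms(1,2)
  have "(\<integral>\<^sup>+x. f (\<lambda>j\<in>insert i I. if j = i then x i + (\<Sum>l\<in>I. c l * x l) else x j) \<partial>PiM (insert i I) (\<lambda>_. lborel))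
      = (\<integral>\<^sup>+x. (\<integral>\<^sup>+y. f (\<lambda>j\<in>insert i I. if j = i then y + (\<Sum>l\<in>I. c l * (x(i := y)) l) else (x(i := y)) j)
          \<partial>lborel) \<partial>PiM I (\<lambda>_. lborel))"
    by (subst lborel_entry.product_nn_integral_insert) (simp_all cong: if_cong)
  also have "\<dots> = (\<integral>\<^sup>+x. (\<integral>\<^sup>+y. f (x(i := y + (\<Sum>l\<in>I. c l * x l))) \<partial>lborel) \<partial>PiM I (\<lambda>_. lborel))"
  proof (intro nn_integral_cong arg_cong[where f = f])
    fix x y assume "x \<in> space (PiM I (\<lambda>_. lborel :: real measure))"
    moreover have "(\<Sum>l\<in>I. c l * (x(i := y)) l) = (\<Sum>l\<in>I. c l * x l)"
      using assms(2) by (intro sum.cong) auto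
    ultimately show "(\<lambda>j\<in>insert i I. if j = i then y + (\<Sum>l\<in>I. c l * (x(i := y)) l) else (x(i := y)) j)
        = x(i := y + (\<Sum>l\<in>I. c l * x l))"
      by (auto simp: fun_eq_iff space_PiM PiE_def extensional_def)
  qed
  also have "\<dots> = (\<integral>\<^sup>+x. (\<integral>\<^sup>+y. f (x(i := y)) \<partial>lborel) \<partial>PiM I (\<lambda>_. lborel))"
    using nn_integral_lborel_translate[OF measurable_fun_upd_lborel[OF assms(3) _ assms(2)]]
    by (intro nn_integral_cong[of "PiM I (\<lambda>_. lborel)"]) simp
  also have "\<dots> = (\<integral>\<^sup>+x. f x \<partial>PiM (insert i I) (\<lambda>_. lborel))"
    by (intro lborel_entry.product_nn_integral_insert[symmetric]) auto
  finally show ?thesis .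
qed

lemma nn_integral_PiM_lborel_flip:
  assumes "finite I" "i \<notin> I" and [measurable]: "f \<in> borel_measurable (PiM (insert i I) (\<lambda>_. lborel))"
  shows "(\<integral>\<^sup>+x. f (\<lambda>j\<in>insert i I. if j = i then - x i else x j :: real) \<partial>PiM (insert i I) (\<lambda>_. lborel))
    = (\<integral>\<^sup>+x. f x \<partial>PiM (insert i I) (\<lambda>_. lborel))"
proof -
  note [simp] = assms(1,2)
  have "(\<integral>\<^sup>+x. f (\<lambda>j\<in>insert i I. if j = i then - x i else x j) \<partial>PiM (insert i I) (\<lambda>_. lborel))
      = (\<integral>\<^sup>+x. (\<integral>\<^sup>+y. f (\<lambda>j\<in>insert i I. if j = i then - y else (x(i := y)) j) \<partial>lborel) \<partial>PiM I (\<lambda>_. lborel))"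
    by (subst lborel_entry.product_nn_integral_insert) (simp_all cong: if_cong)
  also have "\<dots> = (\<integral>\<^sup>+x. (\<integral>\<^sup>+y. f (x(i := - y)) \<partial>lborel) \<partial>PiM I (\<lambda>_. lborel))"
    by (intro nn_integral_cong arg_cong[where f = f])
      (auto simp: fun_eq_iff space_PiM PiE_def extensional_def)
  also have "\<dots> = (\<integral>\<^sup>+x. (\<integral>\<^sup>+y. f (x(i := y)) \<partial>lborel) \<partial>PiM I (\<lambda>_. lborel))"
    using nn_integral_lborel_uminus[OF measurable_fun_upd_lborel[OF assms(3) _ assms(2)]]
    by (intro nn_integral_cong[of "PiM I (\<lambda>_. lborel)"]) simp
  also have "\<dots> = (\<integral>\<^sup>+x. f x \<partial>PiM (insert i I) (\<lambda>_. lborel))"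
    by (intro lborel_entry.product_nn_integral_insert[symmetric]) auto
  finally show ?thesis .
qed

text \<open>A reflection is a product of shears and one sign change, in the coordinates where \<open>x i\<close> is
  replaced by \<open>\<langle>a, x\<rangle> / a i\<close>.\<close>

lemma nn_integral_PiM_lborel_reflection:
  fixes a :: "'i \<Rightarrow> real"
  assumes fin: "finite I" and unit: "(\<Sum>i\<in>I. (a i)\<^sup>2) = 1"
    and f[measurable]: "f \<in> borel_measurable (PiM I (\<lambda>_. lborel))"
  shows "(\<integral>\<^sup>+x. f (\<lambda>i\<in>I. x i - 2 * (\<Sum>j\<in>I. a j * x j) * a i) \<partial>PiM I (\<lambda>_. lborel))
    = (\<integral>\<^sup>+x. f x \<partial>PiM I (\<lambda>_. lborel))"
proof -
  obtain i where i: "i \<in> I" "a i \<noteq> 0"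
    using unit sum.neutral[of I "\<lambda>i. (a i)\<^sup>2"] by fastforce
  define J where "J = I - {i}"
  have I: "I = insert i J" and J: "finite J" "i \<notin> J"
    using i fin by (auto simp: J_def)
  \<comment> \<open>With s = <a, x>, the map \<open>T1\<close> puts s / a i into coordinate
    \<open>i\<close>. Then \<open>T2\<close> performs the subtraction of 2 s a j in the other
    coordinates, \<open>T3\<close> expresses that the reflection sends s to -s, and
    \<open>T4\<close> inverts \<open>T1\<close>.\<close>
  define T1 where "T1 x = (\<lambda>j\<in>I. if j = i then x i + (\<Sum>l\<in>J. (a l / a i) * x l) else x j)" for x :: "'i \<Rightarrow> real"
  define T2 where "T2 x = (\<lambda>j\<in>I. if j = i then x i else x j + x i * (- 2 * a j * a i))" for x :: "'i \<Rightarrow> real"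
  define T3 where "T3 x = (\<lambda>j\<in>I. if j = i then - x i else x j)" for x :: "'i \<Rightarrow> real"
  define T4 where "T4 x = (\<lambda>j\<in>I. if j = i then x i + (\<Sum>l\<in>J. - (a l / a i) * x l) else x j)" for x :: "'i \<Rightarrow> real"
  have comp: "(\<lambda>x. x j) \<in> borel_measurable (PiM I (\<lambda>_. lborel :: real measure))" if "j \<in> I" for j
    using measurable_component_singleton[OF that, of "\<lambda>_. lborel :: real measure"] by simp
  have [measurable]: "T2 \<in> PiM I (\<lambda>_. lborel) \<rightarrow>\<^sub>M PiM I (\<lambda>_. lborel)"
    "T3 \<in> PiM I (\<lambda>_. lborel) \<rightarrow>\<^sub>M PiM I (\<lambda>_. lborel)"
    "T4 \<in> PiM I (\<lambda>_. lborel) \<rightarrow>\<^sub>M PiM I (\<lambda>_. lborel)"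
    unfolding T2_def T3_def T4_def using i
    by (auto intro!: measurable_restrict borel_measurable_add borel_measurable_times
      borel_measurable_sum borel_measurable_uminus comp simp: J_def)
  have "T4 (T3 (T2 (T1 x))) = (\<lambda>i\<in>I. x i - 2 * (\<Sum>j\<in>I. a j * x j) * a i)" for x
  proof -
    define s where "s = (\<Sum>j\<in>I. a j * x j)"
    have s: "s = a i * x i + (\<Sum>j\<in>J. a j * x j)"
      unfolding s_def I using J by simp
    have u: "(\<Sum>j\<in>J. a j * a j) = 1 - a i * a i"
      using unit J unfolding I by (simp add: power2_eq_square)
    have 1: "T1 x i = s / a i"
      using i J unfolding T1_def by (simp add: s add_divide_distrib sum_divide_distrib)
    have 0: "T3 (T2 (T1 x)) i = - s / a i"
      using i 1 unfolding T3_def T2_def by auto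
    have 2: "T3 (T2 (T1 x)) j = x j - 2 * s * a j" if "j \<in> J" for j
      using i J 1 that unfolding T3_def T2_def by (auto simp: I T1_def)
    have "(\<Sum>l\<in>J. - (a l / a i) * T3 (T2 (T1 x)) l) = (\<Sum>l\<in>J. - (a l / a i) * (x l - 2 * s * a l))"
      using 2 by (intro sum.cong) auto
    also have "\<dots> = - (\<Sum>l\<in>J. a l * x l) / a i + 2 * s / a i * (\<Sum>l\<in>J. a l * a l)"
      by (simp add: sum_divide_distrib sum_distrib_left sum_negf[symmetric] sum.distrib[symmetric] algebra_simps diff_divide_distrib)
    also have "\<dots> = - (s - a i * x i) / a i + 2 * s / a i * (1 - a i * a i)"
      by (simp add: u s)
    finally have "(\<Sum>l\<in>J. - (a l / a i) * T3 (T2 (T1 x)) l)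
      = - (s - a i * x i) / a i + 2 * s / a i * (1 - a i * a i)" .
    moreover have "T4 (T3 (T2 (T1 x))) i
        = T3 (T2 (T1 x)) i + (\<Sum>l\<in>J. - (a l / a i) * T3 (T2 (T1 x)) l)"
      using i by (simp add: T4_def)
    ultimately have "T4 (T3 (T2 (T1 x))) i
        = - s / a i + (- (s - a i * x i) / a i + 2 * s / a i * (1 - a i * a i))"
      unfolding 0 by simp
    also have "\<dots> = x i - 2 * s * a i"
      using i by (simp add: field_simps)
    finally have "T4 (T3 (T2 (T1 x))) i = x i - 2 * s * a i" .
    moreover have "T4 (T3 (T2 (T1 x))) j = x j - 2 * s * a j" if "j \<in> J" for j
      using that 2[OF that] J by (auto simp: T4_def I)
    ultimately show ?thesis
      unfolding s_def[symmetric] by (auto simp: fun_eq_iff I T4_def)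
  qed
  then have "(\<integral>\<^sup>+x. f (\<lambda>i\<in>I. x i - 2 * (\<Sum>j\<in>I. a j * x j) * a i) \<partial>PiM I (\<lambda>_. lborel))
      = (\<integral>\<^sup>+x. f (T4 (T3 (T2 (T1 x)))) \<partial>PiM I (\<lambda>_. lborel))"
    by simp
  also have "\<dots> = (\<integral>\<^sup>+x. f (T4 (T3 (T2 x))) \<partial>PiM I (\<lambda>_. lborel))"
    using nn_integral_PiM_lborel_add_comb[OF J, folded I, of "\<lambda>x. f (T4 (T3 (T2 x)))"]
    by (simp add: T1_def)
  also have "\<dots> = (\<integral>\<^sup>+x. f (T4 (T3 x)) \<partial>PiM I (\<lambda>_. lborel))"
    using nn_integral_PiM_lborel_shear[OF J, folded I, of "\<lambda>x. f (T4 (T3 x))"]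
    by (simp add: T2_def)
  also have "\<dots> = (\<integral>\<^sup>+x. f (T4 x) \<partial>PiM I (\<lambda>_. lborel))"
    using nn_integral_PiM_lborel_flip[OF J, folded I, of "\<lambda>x. f (T4 x)"]
    by (simp add: T3_def)
  also have "\<dots> = (\<integral>\<^sup>+x. f x \<partial>PiM I (\<lambda>_. lborel))"
    using nn_integral_PiM_lborel_add_comb[OF J, folded I, of f "\<lambda>l. - (a l / a i)"] f
    by (simp add: T4_def)
  finally show ?thesis .
qed

lemma nn_integral_PiM_std_normal:
  assumes "finite I" "f \<in> borel_measurable (PiM I (\<lambda>_. lborel))"
  shows "(\<integral>\<^sup>+x. f x \<partial>PiM I (\<lambda>_. std_normal))
    = (\<integral>\<^sup>+x. (\<Prod>i\<in>I. ennreal (std_normal_density (x i))) * f x \<partial>PiM I (\<lambda>_. lborel))"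
  using assms
proof (induction I arbitrary: f rule: finite_induct)
  case empty
  show ?case by (simp add: PiM_empty nn_integral_count_space_finite)
next
  case (insert j I)
  note [measurable] = insert.prems and [simp] = insert.hyps
  interpret entry: product_sigma_finite "\<lambda>_. std_normal"
    by unfold_locales
  have eq: "sets (PiM J (\<lambda>_. std_normal)) = sets (PiM J (\<lambda>_. lborel))" for J :: "'a set"
    by (intro sets_PiM_cong) auto
  have "(\<integral>\<^sup>+x. f x \<partial>PiM (insert j I) (\<lambda>_. std_normal))
      = (\<integral>\<^sup>+x. (\<integral>\<^sup>+y. f (x(j := y)) \<partial>std_normal) \<partial>PiM I (\<lambda>_. std_normal))"
    using insert.prems by (intro entry.product_nn_integral_insert) (auto simp: measurable_cong_sets[OF eq refl])
  also have "\<dots> = (\<integral>\<^sup>+x. (\<integral>\<^sup>+y. ennreal (std_normal_density y) * f (x(j := y)) \<partial>lborel) \<partial>PiM I (\<lambda>_. std_normal))"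
    by (rule nn_integral_cong, rule nn_integral_std_normal, rule measurable_fun_upd_lborel[where f = f])
      (auto simp: space_PiM)
  also have "\<dots> = (\<integral>\<^sup>+x. (\<Prod>i\<in>I. ennreal (std_normal_density (x i))) *
      (\<integral>\<^sup>+y. ennreal (std_normal_density y) * f (x(j := y)) \<partial>lborel) \<partial>PiM I (\<lambda>_. lborel))"
    by (rule insert.IH) measurable
  also have "\<dots> = (\<integral>\<^sup>+x. (\<integral>\<^sup>+y. (\<Prod>i\<in>insert j I. ennreal (std_normal_density ((x(j := y)) i))) *
      f (x(j := y)) \<partial>lborel) \<partial>PiM I (\<lambda>_. lborel))"
  proof (intro nn_integral_cong)
    fix x :: "'a \<Rightarrow> real" assume [measurable]: "x \<in> space (PiM I (\<lambda>_. lborel))"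
    have "(\<Prod>i\<in>I. ennreal (std_normal_density ((x(j := y)) i))) = (\<Prod>i\<in>I. ennreal (std_normal_density (x i)))" for y
      using insert.hyps by (intro prod.cong) auto
    then show "(\<Prod>i\<in>I. ennreal (std_normal_density (x i))) *
        (\<integral>\<^sup>+y. ennreal (std_normal_density y) * f (x(j := y)) \<partial>lborel)
      = (\<integral>\<^sup>+y. (\<Prod>i\<in>insert j I. ennreal (std_normal_density ((x(j := y)) i))) * f (x(j := y)) \<partial>lborel)"
      by (subst nn_integral_cmult[symmetric]) (auto simp: mult_ac)
  qed
  also have "\<dots> = (\<integral>\<^sup>+x. (\<Prod>i\<in>insert j I. ennreal (std_normal_density (x i))) * f x \<partial>PiM (insert j I) (\<lambda>_. lborel))"
    by (intro lborel_entry.product_nn_integral_insert[symmetric]) auto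
  finally show ?case .
qed

lemma sum_power2_reflection:
  fixes a x :: "'i \<Rightarrow> real"
  assumes "(\<Sum>i\<in>I. (a i)\<^sup>2) = 1"
  shows "(\<Sum>i\<in>I. (x i - 2 * (\<Sum>j\<in>I. a j * x j) * a i)\<^sup>2) = (\<Sum>i\<in>I. (x i)\<^sup>2)"
proof -
  define s where "s = (\<Sum>j\<in>I. a j * x j)"
  have "(\<Sum>i\<in>I. (x i - 2 * s * a i)\<^sup>2) = (\<Sum>i\<in>I. (x i)\<^sup>2) - 4 * s * (\<Sum>i\<in>I. a i * x i) + 4 * s\<^sup>2 * (\<Sum>i\<in>I. (a i)\<^sup>2)"
    by (simp add: sum_distrib_left sum.distrib[symmetric] sum_subtractf[symmetric] power2_eq_square algebra_simps)
  then show ?thesis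
    using assms unfolding s_def[symmetric] by (simp add: power2_eq_square)
qed

text \<open>The joint density depends on the Euclidean norm alone, which a reflection preserves, and
  Lebesgue measure is invariant as well.\<close>

lemma distr_PiM_std_normal_reflection:
  assumes fin: "finite I" and unit: "(\<Sum>i\<in>I. (a i)\<^sup>2) = 1"
  shows "distr (PiM I (\<lambda>_. std_normal)) (PiM I (\<lambda>_. std_normal))
      (\<lambda>x. \<lambda>i\<in>I. x i - 2 * (\<Sum>j\<in>I. a j * x j) * a i) = PiM I (\<lambda>_. std_normal)"
    (is "distr ?M ?M ?H = ?M")
proof (rule measure_eqI)
  have [simp, measurable_cong]: "sets ?M = sets (PiM I (\<lambda>_. lborel))"
    by (intro sets_PiM_cong) auto
  have comp: "(\<lambda>x. x j) \<in> borel_measurable (PiM I (\<lambda>_. lborel :: real measure))" if "j \<in> I" for j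
    using measurable_component_singleton[OF that, of "\<lambda>_. lborel :: real measure"] by simp
  have mH'[measurable]: "?H \<in> PiM I (\<lambda>_. lborel) \<rightarrow>\<^sub>M PiM I (\<lambda>_. lborel)"
    by (auto intro!: measurable_restrict borel_measurable_diff borel_measurable_times
      borel_measurable_sum comp)
  then have mH: "?H \<in> ?M \<rightarrow>\<^sub>M ?M"
    by measurable
  have density: "(\<Prod>i\<in>I. ennreal (std_normal_density (x i)))
      = ennreal ((1 / sqrt (2 * pi)) ^ card I * exp (- (\<Sum>i\<in>I. (x i)\<^sup>2) / 2))" for x
  proof -
    have "(\<Prod>i\<in>I. ennreal (std_normal_density (x i))) = ennreal (\<Prod>i\<in>I. std_normal_density (x i))"
      by (rule prod_ennreal) simp
    also have "(\<Prod>i\<in>I. std_normal_density (x i)) = (1 / sqrt (2 * pi)) ^ card I * exp (\<Sum>i\<in>I. - (x i)\<^sup>2 / 2)"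
      using fin unfolding std_normal_density_def prod.distrib by (simp only: prod_constant exp_sum)
    also have "(\<Sum>i\<in>I. - (x i)\<^sup>2 / 2) = - (\<Sum>i\<in>I. (x i)\<^sup>2) / 2"
      by (simp add: sum_negf sum_divide_distrib)
    finally show ?thesis .
  qed
  have inv: "(\<Sum>i\<in>I. (?H x i)\<^sup>2) = (\<Sum>i\<in>I. (x i)\<^sup>2)" for x
    using sum_power2_reflection[OF unit, of x] by simp
  fix A assume "A \<in> sets (distr ?M ?M ?H)"
  then have [measurable]: "A \<in> sets (PiM I (\<lambda>_. lborel))" and A: "A \<in> sets ?M" by auto
  have "emeasure (distr ?M ?M ?H) A = (\<integral>\<^sup>+x. indicator A x \<partial>distr ?M ?M ?H)"
    using A by simp
  also have "\<dots> = (\<integral>\<^sup>+x. indicator A (?H x) \<partial>?M)"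
    using A by (intro nn_integral_distr[OF mH]) auto
  also have "\<dots> = (\<integral>\<^sup>+x. (\<Prod>i\<in>I. ennreal (std_normal_density (x i))) * indicator A (?H x) \<partial>PiM I (\<lambda>_. lborel))"
    by (rule nn_integral_PiM_std_normal[OF fin]) measurable
  also have "\<dots> = (\<integral>\<^sup>+x. (\<Prod>i\<in>I. ennreal (std_normal_density (?H x i))) * indicator A (?H x) \<partial>PiM I (\<lambda>_. lborel))"
    unfolding density inv ..
  also have "\<dots> = (\<integral>\<^sup>+x. (\<Prod>i\<in>I. ennreal (std_normal_density (x i))) * indicator A x \<partial>PiM I (\<lambda>_. lborel))"
    by (rule nn_integral_PiM_lborel_reflection[OF fin unit]) measurable
  also have "\<dots> = (\<integral>\<^sup>+x. indicator A x \<partial>?M)"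
    by (rule nn_integral_PiM_std_normal[OF fin, symmetric]) measurable
  finally show "emeasure (distr ?M ?M ?H) A = emeasure ?M A"
    using A by simp
qed simp

section \<open>Grassmannians\<close>

declare One_nat_def [simp del]

lemma eucl_inner_commute: "eucl_inner N x y = eucl_inner N y x"
  by (simp add: eucl_inner_def mult.commute)

lemma eucl_inner_add_left: "eucl_inner N (x + y) z = eucl_inner N x z + eucl_inner N y z"
  by (simp add: eucl_inner_def sum.distrib algebra_simps)

lemma eucl_inner_diff_left: "eucl_inner N (x - y) z = eucl_inner N x z - eucl_inner N y z"
  by (simp add: eucl_inner_def sum_subtractf algebra_simps)

lemma eucl_inner_scale_left: "eucl_inner N (fun_scale c x) z = c * eucl_inner N x z"
  by (simp add: eucl_inner_def fun_scale_def sum_distrib_left mult.assoc)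

lemma eucl_inner_zero_left: "eucl_inner N 0 z = 0"
  by (simp add: eucl_inner_def)

lemma eucl_inner_sum_left:
  fixes f :: "'a \<Rightarrow> nat \<Rightarrow> real"
  shows "eucl_inner N (\<Sum>i\<in>A. f i) z = (\<Sum>i\<in>A. eucl_inner N (f i) z)"
  by (induction A rule: infinite_finite_induct) (simp_all only: sum.infinite sum.empty
    sum.insert eucl_inner_zero_left eucl_inner_add_left not_False_eq_True)

lemma eucl_inner_add_right: "eucl_inner N z (x + y) = eucl_inner N z x + eucl_inner N z y"
  and eucl_inner_diff_right: "eucl_inner N z (x - y) = eucl_inner N z x - eucl_inner N z y"
  and eucl_inner_scale_right: "eucl_inner N z (fun_scale c x) = c * eucl_inner N z x"
  and eucl_inner_zero_right: "eucl_inner N z 0 = 0"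
  by (simp_all add: eucl_inner_commute[of N z] eucl_inner_add_left eucl_inner_diff_left
    eucl_inner_scale_left eucl_inner_zero_left)

lemmas eucl_inner_simps = eucl_inner_add_left eucl_inner_diff_left eucl_inner_scale_left
  eucl_inner_zero_left eucl_inner_sum_left eucl_inner_add_right eucl_inner_diff_right
  eucl_inner_scale_right eucl_inner_zero_right

lemma eucl_norm_power2: "(eucl_norm N x)\<^sup>2 = eucl_inner N x x"
  by (simp add: L2_set_def eucl_inner_def sum_nonneg power2_eq_square)

lemma eucl_norm_eq_sqrt_inner: "eucl_norm N x = sqrt (eucl_inner N x x)"
  by (simp add: L2_set_def eucl_inner_def power2_eq_square)

lemma eucl_norm_nonneg: "0 \<le> eucl_norm N x"
  by (rule L2_set_nonneg)

lemma eucl_inner_nonneg: "0 \<le> eucl_inner N x x"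
  by (simp add: eucl_inner_def sum_nonneg)

lemma eucl_norm_scale: "eucl_norm N (fun_scale c x) = \<bar>c\<bar> * eucl_norm N x"
  by (simp add: eucl_norm_eq_sqrt_inner eucl_inner_simps real_sqrt_mult flip: power2_eq_square mult.assoc)

lemma eucl_norm_triangle: "eucl_norm N (x + y) \<le> eucl_norm N x + eucl_norm N y"
  using L2_set_triangle_ineq[of x y] by (simp add: plus_fun_def)

lemma eucl_norm_minus_commute: "eucl_norm N (x - y) = eucl_norm N (y - x)"
  by (simp add: L2_set_def power2_commute)

lemma eucl_norm_triangle_diff: "eucl_norm N (x - z) \<le> eucl_norm N (x - y) + eucl_norm N (y - z)"
  using eucl_norm_triangle[of "x - y" "y - z" N] by simp

lemma eucl_norm_zero [simp]: "eucl_norm N 0 = 0"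
  by (simp add: L2_set_def)

lemma abs_le_eucl_norm: "i \<in> {1..N} \<Longrightarrow> \<bar>x i\<bar> \<le> eucl_norm N x"
  unfolding L2_set_def using member_le_sum[of i "{1..N}" "\<lambda>i. (x i)\<^sup>2"]
  by (intro real_le_rsqrt) simp

lemma eucl_norm_le_sum: "eucl_norm N x \<le> (\<Sum>i=1..N. \<bar>x i\<bar>)"
  by (rule L2_set_le_sum_abs)

lemma abs_eucl_inner_le: "\<bar>eucl_inner N x y\<bar> \<le> eucl_norm N x * eucl_norm N y"
  unfolding eucl_inner_def
  by (rule order_trans[OF sum_abs]) (simp add: abs_mult L2_set_mult_ineq)

lemma subspace_eucl: "fs.subspace (eucl N)"
  by (auto simp: fs.subspace_def eucl_def fun_scale_def)

lemma eucl_zero [simp]: "0 \<in> eucl N"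
  and eucl_add: "x \<in> eucl N \<Longrightarrow> y \<in> eucl N \<Longrightarrow> x + y \<in> eucl N"
  and eucl_diff: "x \<in> eucl N \<Longrightarrow> y \<in> eucl N \<Longrightarrow> x - y \<in> eucl N"
  and eucl_scale: "x \<in> eucl N \<Longrightarrow> fun_scale c x \<in> eucl N"
  by (auto simp: eucl_def fun_scale_def)

lemma eucl_inner_self_eq_0: "x \<in> eucl N \<Longrightarrow> eucl_inner N x x = 0 \<longleftrightarrow> x = 0"
  by (auto simp: eucl_inner_def eucl_def sum_nonneg_eq_0_iff fun_eq_iff)

lemma eucl_norm_eq_0: "x \<in> eucl N \<Longrightarrow> eucl_norm N x = 0 \<longleftrightarrow> x = 0"
  by (simp add: eucl_norm_eq_sqrt_inner eucl_inner_self_eq_0)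

section \<open>Orthonormal families and orthogonal projections\<close>

definition orthonormal :: "nat \<Rightarrow> nat \<Rightarrow> (nat \<Rightarrow> nat \<Rightarrow> real) \<Rightarrow> bool"
  where "orthonormal N m q \<longleftrightarrow> (\<forall>i<m. q i \<in> eucl N) \<and>
    (\<forall>i<m. \<forall>j<m. eucl_inner N (q i) (q j) = (if i = j then 1 else 0))"

lemma orthonormalD: "orthonormal N m q \<Longrightarrow> i < m \<Longrightarrow> j < m \<Longrightarrow>
    eucl_inner N (q i) (q j) = (if i = j then 1 else 0)"
  and orthonormal_mem: "orthonormal N m q \<Longrightarrow> i < m \<Longrightarrow> q i \<in> eucl N"
  by (simp_all add: orthonormal_def)

abbreviation frame_span :: "nat \<Rightarrow> (nat \<Rightarrow> nat \<Rightarrow> real) \<Rightarrow> (nat \<Rightarrow> real) set"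
  where "frame_span m q \<equiv> fs.span (q ` {..<m})"

definition frame_proj :: "nat \<Rightarrow> nat \<Rightarrow> (nat \<Rightarrow> nat \<Rightarrow> real) \<Rightarrow> (nat \<Rightarrow> real) \<Rightarrow> nat \<Rightarrow> real"
  where "frame_proj N m q x = (\<Sum>i<m. fun_scale (eucl_inner N x (q i)) (q i))"

lemma frame_span_eucl: "orthonormal N m q \<Longrightarrow> frame_span m q \<subseteq> eucl N"
  by (intro fs.span_minimal subspace_eucl) (auto simp: orthonormal_def)

lemma frame_proj_in_span: "frame_proj N m q x \<in> frame_span m q"
  unfolding frame_proj_def by (intro fs.span_sum fs.span_scale fs.span_base) auto

lemma eucl_inner_frame_proj:
  assumes "orthonormal N m q" "i < m"
  shows "eucl_inner N (frame_proj N m q x) (q i) = eucl_inner N x (q i)"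
proof -
  have "eucl_inner N (frame_proj N m q x) (q i) = (\<Sum>j<m. eucl_inner N x (q j) * (if j = i then 1 else 0))"
    unfolding frame_proj_def eucl_inner_sum_left eucl_inner_scale_left
    using assms by (intro sum.cong) (auto simp: orthonormal_def)
  then show ?thesis
    using assms by (simp add: if_distrib cong: if_cong)
qed

lemma eucl_inner_span_eq_0:
  assumes "z \<in> fs.span S" "\<And>s. s \<in> S \<Longrightarrow> eucl_inner N x s = 0"
  shows "eucl_inner N x z = 0"
  using assms(1)
proof (induction rule: fs.span_induct)
  show "fs.subspace {z. eucl_inner N x z = 0}"
    by (auto simp: fs.subspace_def eucl_inner_simps)
qed (use assms(2) in auto)

lemma frame_proj_orthogonal:
  "orthonormal N m q \<Longrightarrow> z \<in> frame_span m q \<Longrightarrow> eucl_inner N (x - frame_proj N m q x) z = 0"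
  by (erule eucl_inner_span_eq_0) (auto simp: eucl_inner_simps eucl_inner_frame_proj)

lemma orth_proj_eqI:
  assumes E: "fs.subspace E" "E \<subseteq> eucl N" and y: "y \<in> E" "\<And>z. z \<in> E \<Longrightarrow> eucl_inner N (x - y) z = 0"
  shows "orth_proj N E x = y"
  unfolding orth_proj_def
proof (rule the_equality)
  fix y' assume y': "y' \<in> E \<and> (\<forall>z\<in>E. eucl_inner N (x - y') z = 0)"
  then have "y' - y \<in> E"
    using E y by (simp add: fs.subspace_diff)
  then have "eucl_inner N (x - y) (y' - y) - eucl_inner N (x - y') (y' - y) = 0"
    using y y' by simp
  then have "eucl_inner N (y' - y) (y' - y) = 0"
    by (simp add: eucl_inner_simps)
  then show "y' = y"
    using \<open>y' - y \<in> E\<close> E by (simp add: eucl_inner_self_eq_0 subset_iff)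
qed (use y in auto)

lemma orth_proj_frame_span:
  "orthonormal N m q \<Longrightarrow> orth_proj N (frame_span m q) x = frame_proj N m q x"
  by (intro orth_proj_eqI fs.subspace_span frame_span_eucl frame_proj_in_span frame_proj_orthogonal)

lemma frame_proj_span:
  assumes q: "orthonormal N m q" and x: "x \<in> frame_span m q"
  shows "frame_proj N m q x = x"
  using orth_proj_eqI[OF fs.subspace_span frame_span_eucl[OF q] x, of x]
  by (simp add: eucl_inner_simps orth_proj_frame_span[OF q])

lemma orthonormal_le: "orthonormal N m q \<Longrightarrow> k \<le> m \<Longrightarrow> orthonormal N k q"
  by (auto simp: orthonormal_def)

lemma orthonormal_independent:
  assumes "orthonormal N m q"
  shows "fs.independent (q ` {..<m}) \<and> card (q ` {..<m}) = m"
  using assms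
proof (induction m)
  case (Suc m)
  then have IH: "fs.independent (q ` {..<m})" "card (q ` {..<m}) = m"
    and q: "orthonormal N m q"
    using orthonormal_le[of N "Suc m" q m] by auto
  have "q m \<notin> frame_span m q"
  proof
    assume "q m \<in> frame_span m q"
    then have "eucl_inner N (q m) (q m) = 0"
      by (rule eucl_inner_span_eq_0) (use Suc.prems in \<open>auto simp: orthonormal_def\<close>)
    then show False using Suc.prems by (auto simp: orthonormal_def)
  qed
  moreover from this have "q m \<notin> q ` {..<m}"
    using fs.span_base[of "q m" "q ` {..<m}"] by (rule contrapos_nn)
  ultimately show ?case
    using IH unfolding lessThan_Suc image_insert by (simp add: fs.independent_insert)
qed (simp add: fs.independent_empty)

lemma dim_frame_span: "orthonormal N m q \<Longrightarrow> fs.dim (frame_span m q) = m"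
  using orthonormal_independent[of N m q] by (simp add: fs.dim_eq_card_independent)

text \<open>Coordinates run over \<open>{1..N}\<close> but orthonormal families over
  \<open>{..<N}\<close>, hence the shift by \<open>Suc\<close>.\<close>

definition unit_vec :: "nat \<Rightarrow> nat \<Rightarrow> real"
  where "unit_vec i = (\<lambda>j. if j = Suc i then 1 else 0)"

lemma eucl_inner_unit_vec: "i < N \<Longrightarrow> eucl_inner N x (unit_vec i) = x (Suc i)"
  by (simp add: eucl_inner_def unit_vec_def if_distrib cong: if_cong)

lemma orthonormal_unit_vec: "orthonormal N N unit_vec"
  by (auto simp: orthonormal_def eucl_inner_unit_vec) (auto simp: unit_vec_def eucl_def)

lemma frame_proj_unit_vec:
  assumes "x \<in> eucl N" shows "frame_proj N N unit_vec x = x"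
proof -
  have "eucl_inner N (x - frame_proj N N unit_vec x) (unit_vec i) = 0" if "i < N" for i
    using that frame_proj_orthogonal[OF orthonormal_unit_vec fs.span_base] by blast
  then have *: "(x - frame_proj N N unit_vec x) (Suc i) = 0" if "i < N" for i
    using that eucl_inner_unit_vec by metis
  have "x - frame_proj N N unit_vec x \<in> eucl N"
    using assms frame_span_eucl[OF orthonormal_unit_vec] frame_proj_in_span[of N N unit_vec x]
    by (intro eucl_diff) auto
  then have "(x - frame_proj N N unit_vec x) j = 0" for j
    using *[of "j - 1"] by (cases "j \<in> {1..N}") (auto simp: eucl_def)
  then show ?thesis
    by (auto simp: fun_eq_iff)
qed

lemma frame_span_unit_vec: "frame_span N unit_vec = eucl N"
proof
  show "eucl N \<subseteq> frame_span N unit_vec"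
  proof
    fix x assume "x \<in> eucl N"
    then show "x \<in> frame_span N unit_vec"
      using frame_proj_in_span[of N N unit_vec x] by (simp add: frame_proj_unit_vec)
  qed
qed (rule frame_span_eucl[OF orthonormal_unit_vec])

lemma orthonormal_card_le:
  assumes "orthonormal N m q" shows "m \<le> N"
proof -
  have "q ` {..<m} \<subseteq> fs.span (unit_vec ` {..<N})"
    using assms by (auto simp: frame_span_unit_vec orthonormal_def)
  from fs.independent_span_bound[OF _ _ this] orthonormal_independent[OF assms]
    orthonormal_independent[OF orthonormal_unit_vec]
  show ?thesis by simp
qed

lemma orthonormal_extend:
  assumes q: "orthonormal N m q" and E: "fs.subspace E" "E \<subseteq> eucl N" "frame_span m q \<subseteq> E"
    and x: "x \<in> E" "x \<notin> frame_span m q"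
  shows "\<exists>u\<in>E. orthonormal N (Suc m) (q(m := u))"
proof -
  define y where "y = x - frame_proj N m q x"
  have y: "y \<in> E"
    unfolding y_def using E x frame_proj_in_span[of N m q x] by (intro fs.subspace_diff) auto
  have "y \<noteq> 0"
    using x frame_proj_in_span[of N m q x] by (auto simp: y_def)
  then have pos: "0 < eucl_inner N y y"
    using y E eucl_inner_nonneg[of N y] eucl_inner_self_eq_0[of y N] by (auto simp: less_le)
  define u where "u = fun_scale (1 / sqrt (eucl_inner N y y)) y"
  have "eucl_inner N y (q i) = 0" if "i < m" for i
    unfolding y_def using that by (intro frame_proj_orthogonal[OF q] fs.span_base) auto
  then have "eucl_inner N u (q i) = 0" "eucl_inner N (q i) u = 0" if "i < m" for i
    using that by (simp_all add: u_def eucl_inner_simps eucl_inner_commute[of N "q i"])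
  moreover have "eucl_inner N u u = 1"
    using pos by (simp add: u_def eucl_inner_simps flip: mult.assoc)
  moreover have "u \<in> E"
    unfolding u_def using y E by (simp add: fs.subspace_scale)
  ultimately show ?thesis
    using q E by (intro bexI[of _ u]) (auto simp: orthonormal_def less_Suc_eq)
qed

lemma orthonormal_complement_unit:
  assumes q: "orthonormal N m q" and "m < N"
  obtains u where "u \<in> eucl N" "eucl_inner N u u = 1" "\<And>i. i < m \<Longrightarrow> eucl_inner N u (q i) = 0"
proof -
  have "fs.dim (frame_span m q) \<noteq> fs.dim (eucl N)"
    using dim_frame_span[OF orthonormal_unit_vec, of N] \<open>m < N\<close>
    unfolding dim_frame_span[OF q] frame_span_unit_vec by simp
  then have "frame_span m q \<noteq> eucl N" by metis
  then obtain x where "x \<in> eucl N" "x \<notin> frame_span m q"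
    using frame_span_eucl[OF q] by auto
  from orthonormal_extend[OF q subspace_eucl order_refl frame_span_eucl[OF q] this]
  obtain u where u: "u \<in> eucl N" "orthonormal N (Suc m) (q(m := u))" by blast
  show ?thesis
  proof (rule that[OF u(1)])
    show "eucl_inner N u u = 1" using orthonormalD[OF u(2), of m m] by simp
    show "eucl_inner N u (q i) = 0" if "i < m" for i
      using orthonormalD[OF u(2), of m i] that by simp
  qed
qed

text \<open>An orthonormal family in \<open>E\<close> of maximal length spans \<open>E\<close>,
  because any further vector of \<open>E\<close> would extend it; lengths are bounded by
  \<open>N\<close>.\<close>

lemma subspace_orthonormal_basis:
  assumes E: "fs.subspace E" "E \<subseteq> eucl N"
  obtains m q where "orthonormal N m q" "E = frame_span m q"
proof -
  let ?P = "\<lambda>m. \<exists>q. orthonormal N m q \<and> frame_span m q \<subseteq> E"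
  have "?P 0"
    using fs.subspace_0[OF E(1)] by (auto simp: orthonormal_def)
  moreover have "\<forall>m. ?P m \<longrightarrow> m \<le> N"
    using orthonormal_card_le by blast
  ultimately have P: "?P (Greatest ?P)" and max: "\<And>m. ?P m \<Longrightarrow> m \<le> Greatest ?P"
    using GreatestI_nat[of ?P 0 N] Greatest_le_nat[of ?P _ N] by blast+
  define m where "m = Greatest ?P"
  from P obtain q where q: "orthonormal N m q" "frame_span m q \<subseteq> E"
    unfolding m_def by blast
  have "E \<subseteq> frame_span m q"
  proof (rule ccontr)
    assume "\<not> E \<subseteq> frame_span m q"
    then obtain x where x: "x \<in> E" "x \<notin> frame_span m q" by auto
    from orthonormal_extend[OF q(1) E q(2) x]
    obtain u where u: "u \<in> E" "orthonormal N (Suc m) (q(m := u))" by blast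
    have "q ` {..<m} \<subseteq> E"
      using fs.span_superset q(2) by (rule order_trans)
    then have "frame_span (Suc m) (q(m := u)) \<subseteq> E"
      using u E by (intro fs.span_minimal) (auto simp: less_Suc_eq)
    with u(2) have "?P (Suc m)" by blast
    from max[OF this] show False unfolding m_def by simp
  qed
  then show ?thesis
    using q that by blast
qed

lemma grassmannianE:
  assumes "E \<in> grassmannian N m"
  obtains q where "orthonormal N m q" "E = frame_span m q"
proof -
  have E: "fs.subspace E" "E \<subseteq> eucl N" "fs.dim E = m"
    using assms by (auto simp: grassmannian_def)
  obtain m' q where q: "orthonormal N m' q" "E = frame_span m' q"
    using subspace_orthonormal_basis[OF E(1,2)] .
  with E(3) have "m' = m" using dim_frame_span[OF q(1)] by simp
  with q that show ?thesis by blast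
qed

lemma frame_span_grassmannian: "orthonormal N m q \<Longrightarrow> frame_span m q \<in> grassmannian N m"
  using frame_span_eucl[of N m q] dim_frame_span[of N m q] by (simp add: grassmannian_def)

lemma grassmannian_subspace: "E \<in> grassmannian N m \<Longrightarrow> fs.subspace E"
  and grassmannian_subset: "E \<in> grassmannian N m \<Longrightarrow> E \<subseteq> eucl N"
  by (auto simp: grassmannian_def)

lemma orth_proj_mem: "E \<in> grassmannian N m \<Longrightarrow> orth_proj N E x \<in> E"
  by (elim grassmannianE) (simp add: orth_proj_frame_span frame_proj_in_span)

lemma orth_proj_eucl: "E \<in> grassmannian N m \<Longrightarrow> orth_proj N E x \<in> eucl N"
  using orth_proj_mem grassmannian_subset by blast

lemma orth_proj_orthogonal:
  "E \<in> grassmannian N m \<Longrightarrow> z \<in> E \<Longrightarrow> eucl_inner N (x - orth_proj N E x) z = 0"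
  by (elim grassmannianE) (simp add: orth_proj_frame_span frame_proj_orthogonal)

lemma orth_proj_id: "E \<in> grassmannian N m \<Longrightarrow> x \<in> E \<Longrightarrow> orth_proj N E x = x"
  by (elim grassmannianE) (simp add: orth_proj_frame_span frame_proj_span)

lemma orth_proj_add:
  assumes "E \<in> grassmannian N m"
  shows "orth_proj N E (x + y) = orth_proj N E x + orth_proj N E y"
proof (rule orth_proj_eqI)
  fix z assume "z \<in> E"
  then have "eucl_inner N (x - orth_proj N E x) z = 0" "eucl_inner N (y - orth_proj N E y) z = 0"
    using assms by (auto intro: orth_proj_orthogonal)
  then show "eucl_inner N (x + y - (orth_proj N E x + orth_proj N E y)) z = 0"
    by (simp add: eucl_inner_simps)
qed (use assms in \<open>auto intro: fs.subspace_add orth_proj_mem dest: grassmannian_subspace grassmannian_subset\<close>)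

lemma orth_proj_scale:
  assumes "E \<in> grassmannian N m"
  shows "orth_proj N E (fun_scale c x) = fun_scale c (orth_proj N E x)"
proof (rule orth_proj_eqI)
  fix z assume "z \<in> E"
  then have "eucl_inner N (x - orth_proj N E x) z = 0"
    using assms by (auto intro: orth_proj_orthogonal)
  then show "eucl_inner N (fun_scale c x - fun_scale c (orth_proj N E x)) z = 0"
    by (simp add: eucl_inner_simps)
qed (use assms in \<open>auto intro: fs.subspace_scale orth_proj_mem dest: grassmannian_subspace grassmannian_subset\<close>)

lemma orth_proj_diff:
  assumes "E \<in> grassmannian N m"
  shows "orth_proj N E (x - y) = orth_proj N E x - orth_proj N E y"
  using orth_proj_add[OF assms, of "x - y" y] by (simp add: algebra_simps)

lemma eucl_norm_orth_proj_le:
  assumes "E \<in> grassmannian N m"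
  shows "eucl_norm N (orth_proj N E x) \<le> eucl_norm N x"
proof -
  let ?P = "orth_proj N E x"
  have "eucl_inner N (x - ?P) ?P = 0"
    using assms by (intro orth_proj_orthogonal orth_proj_mem)
  then have "eucl_inner N x ?P = eucl_inner N ?P ?P"
    by (simp add: eucl_inner_simps)
  then have "(eucl_norm N ?P)\<^sup>2 \<le> eucl_norm N x * eucl_norm N ?P"
    using abs_eucl_inner_le[of N x ?P] by (simp add: eucl_norm_power2)
  then show ?thesis
    using eucl_norm_nonneg[of ?P N] eucl_norm_nonneg[of x N]
    by (cases "eucl_norm N ?P = 0") (auto simp: power2_eq_square)
qed

section \<open>The projection metric on the Grassmannian\<close>

lemma grass_dist_eq:
  "E \<in> grassmannian N m \<Longrightarrow> F \<in> grassmannian N m \<Longrightarrow> grass_dist N m E F =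
    (SUP x \<in> {x \<in> eucl N. eucl_norm N x \<le> 1}. eucl_norm N (orth_proj N E x - orth_proj N F x))"
  by (simp add: grass_dist_def)

lemma grass_dist_bdd:
  assumes "E \<in> grassmannian N m" "F \<in> grassmannian N m"
  shows "bdd_above ((\<lambda>x. eucl_norm N (orth_proj N E x - orth_proj N F x)) `
    {x \<in> eucl N. eucl_norm N x \<le> 1})"
proof (rule bdd_aboveI2)
  fix x assume x: "x \<in> {x \<in> eucl N. eucl_norm N x \<le> 1}"
  have "eucl_norm N (orth_proj N E x - orth_proj N F x)
      \<le> eucl_norm N (orth_proj N E x) + eucl_norm N (orth_proj N F x)"
    using eucl_norm_triangle_diff[of "orth_proj N E x" "orth_proj N F x" N 0]
      eucl_norm_minus_commute[of 0 "orth_proj N F x" N] by simp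
  also have "\<dots> \<le> 1 + 1"
    using x assms by (intro add_mono order_trans[OF eucl_norm_orth_proj_le]) auto
  finally show "eucl_norm N (orth_proj N E x - orth_proj N F x) \<le> 2" by simp
qed

lemma grass_dist_norm_le:
  assumes E: "E \<in> grassmannian N m" "F \<in> grassmannian N m" and x: "x \<in> eucl N"
  shows "eucl_norm N (orth_proj N E x - orth_proj N F x) \<le> grass_dist N m E F * eucl_norm N x"
proof (cases "x = 0")
  case True
  have "orth_proj N E 0 = 0" "orth_proj N F 0 = 0"
    using E orth_proj_id fs.subspace_0 grassmannian_subspace by blast+
  with True show ?thesis by simp
next
  case False
  let ?n = "eucl_norm N x"
  have pos: "0 < ?n"
    using False x eucl_norm_eq_0[of x N] eucl_norm_nonneg[of x N] by (auto simp: less_le)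
  define y where "y = fun_scale (1 / ?n) x"
  have y: "y \<in> {x \<in> eucl N. eucl_norm N x \<le> 1}"
    using pos x by (simp add: y_def eucl_scale eucl_norm_scale)
  have "orth_proj N E x - orth_proj N F x = fun_scale ?n (orth_proj N E y - orth_proj N F y)"
    using pos unfolding y_def orth_proj_scale[OF E(1)] orth_proj_scale[OF E(2)]
    by (simp add: fun_scale_def fun_eq_iff field_simps)
  then have "eucl_norm N (orth_proj N E x - orth_proj N F x)
      = ?n * eucl_norm N (orth_proj N E y - orth_proj N F y)"
    using pos by (simp add: eucl_norm_scale)
  also have "\<dots> \<le> ?n * grass_dist N m E F"
    using pos unfolding grass_dist_eq[OF E]
    by (intro mult_left_mono cSUP_upper[OF y] grass_dist_bdd[OF E]) auto
  finally show ?thesis by (simp add: mult.commute)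
qed

lemma grass_dist_le:
  assumes E: "E \<in> grassmannian N m" "F \<in> grassmannian N m" and r: "0 \<le> r"
    and le: "\<And>x. x \<in> eucl N \<Longrightarrow> eucl_norm N (orth_proj N E x - orth_proj N F x) \<le> r * eucl_norm N x"
  shows "grass_dist N m E F \<le> r"
  unfolding grass_dist_eq[OF E]
proof (rule cSUP_least)
  show "{x \<in> eucl N. eucl_norm N x \<le> 1} \<noteq> {}"
    using eucl_zero[of N] eucl_norm_zero[of N] by (metis (mono_tags, lifting) empty_iff mem_Collect_eq zero_le_one)
  fix x assume "x \<in> {x \<in> eucl N. eucl_norm N x \<le> 1}"
  then show "eucl_norm N (orth_proj N E x - orth_proj N F x) \<le> r"
    using le[of x] r mult_left_mono[of "eucl_norm N x" 1 r] by auto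
qed

lemma grass_dist_nonneg: "0 \<le> grass_dist N m E F"
proof (cases "E \<in> grassmannian N m \<and> F \<in> grassmannian N m")
  case True
  then have E: "E \<in> grassmannian N m" "F \<in> grassmannian N m" by auto
  have "0 \<in> {x \<in> eucl N. eucl_norm N x \<le> 1}" by simp
  from cSUP_upper[OF this grass_dist_bdd[OF E]]
  show ?thesis
    unfolding grass_dist_eq[OF E] using eucl_norm_nonneg order_trans by blast
qed (auto simp: grass_dist_def)

lemma grass_dist_commute: "grass_dist N m E F = grass_dist N m F E"
  by (auto simp: grass_dist_def intro!: SUP_cong eucl_norm_minus_commute)

lemma Metric_space_grass_dist: "Metric_space (grassmannian N m) (grass_dist N m)"
proof (rule Metric_space.intro)
  fix E F assume E: "E \<in> grassmannian N m" "F \<in> grassmannian N m"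
  show "grass_dist N m E F = 0 \<longleftrightarrow> E = F"
  proof
    assume "grass_dist N m E F = 0"
    then have 0: "eucl_norm N (orth_proj N E x - orth_proj N F x) = 0" if "x \<in> eucl N" for x
      using grass_dist_norm_le[OF E that] eucl_norm_nonneg by (simp add: antisym)
    then have *: "orth_proj N E x = orth_proj N F x" if "x \<in> eucl N" for x
      using eucl_norm_eq_0[OF eucl_diff[OF orth_proj_eucl[OF E(1)] orth_proj_eucl[OF E(2)]]]
        0[OF that] by simp
    show "E = F"
    proof (intro equalityI subsetI)
      fix x assume "x \<in> E"
      then show "x \<in> F"
        using *[of x] grassmannian_subset[OF E(1)] orth_proj_id[OF E(1), of x] orth_proj_mem[OF E(2), of x]
        by auto
    next
      fix x assume "x \<in> F"
      then show "x \<in> E"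
        using *[of x] grassmannian_subset[OF E(2)] orth_proj_id[OF E(2), of x] orth_proj_mem[OF E(1), of x]
        by auto
    qed
  next
    assume "E = F"
    then show "grass_dist N m E F = 0"
      using E grass_dist_nonneg[of N m E F] grass_dist_le[of E N m F 0] by (simp add: antisym)
  qed
next
  fix E F G assume E: "E \<in> grassmannian N m" "F \<in> grassmannian N m" "G \<in> grassmannian N m"
  show "grass_dist N m E G \<le> grass_dist N m E F + grass_dist N m F G"
  proof (rule grass_dist_le[OF E(1,3)])
    fix x assume x: "x \<in> eucl N"
    have "eucl_norm N (orth_proj N E x - orth_proj N G x)
        \<le> eucl_norm N (orth_proj N E x - orth_proj N F x) + eucl_norm N (orth_proj N F x - orth_proj N G x)"
      by (rule eucl_norm_triangle_diff)
    also have "\<dots> \<le> (grass_dist N m E F + grass_dist N m F G) * eucl_norm N x"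
      using grass_dist_norm_le[OF E(1,2) x] grass_dist_norm_le[OF E(2,3) x] by (simp add: distrib_right)
    finally show "eucl_norm N (orth_proj N E x - orth_proj N G x)
        \<le> (grass_dist N m E F + grass_dist N m F G) * eucl_norm N x" .
  qed (simp add: grass_dist_nonneg)
qed (auto simp: grass_dist_nonneg grass_dist_commute)

interpretation grass: Metric_space "grassmannian N m" "grass_dist N m" for N m
  by (rule Metric_space_grass_dist)

section \<open>Reflections and their action on the Grassmannian\<close>

definition reflection :: "nat \<Rightarrow> (nat \<Rightarrow> real) \<Rightarrow> (nat \<Rightarrow> real) \<Rightarrow> nat \<Rightarrow> real"
  where "reflection N a x = x - fun_scale (2 * eucl_inner N a x) a"

lemma linear_reflection: "Vector_Spaces.linear fun_scale fun_scale (reflection N a)"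
  unfolding Vector_Spaces.linear_iff
proof (intro conjI allI fs.vector_space_axioms)
  show "reflection N a (x + y) = reflection N a x + reflection N a y" for x y
    unfolding reflection_def eucl_inner_simps by (simp add: fun_eq_iff fun_scale_def algebra_simps)
  show "reflection N a (fun_scale c x) = fun_scale c (reflection N a x)" for c x
    unfolding reflection_def eucl_inner_simps by (simp add: fun_eq_iff fun_scale_def algebra_simps)
qed

lemma reflection_eucl: "a \<in> eucl N \<Longrightarrow> x \<in> eucl N \<Longrightarrow> reflection N a x \<in> eucl N"
  unfolding reflection_def by (intro eucl_diff eucl_scale)

lemma reflection_reflection:
  "eucl_inner N a a = 1 \<Longrightarrow> reflection N a (reflection N a x) = x"
  unfolding reflection_def eucl_inner_simps by (simp add: fun_eq_iff fun_scale_def)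

lemma eucl_inner_reflection:
  "eucl_inner N a a = 1 \<Longrightarrow> eucl_inner N (reflection N a x) (reflection N a y) = eucl_inner N x y"
  by (simp add: reflection_def eucl_inner_simps eucl_inner_commute[of N x a] algebra_simps)

lemma eucl_inner_reflection_swap:
  "eucl_inner N (reflection N a x) y = eucl_inner N x (reflection N a y)"
  by (simp add: reflection_def eucl_inner_simps eucl_inner_commute[of N x a] algebra_simps)

lemma eucl_norm_reflection:
  "eucl_inner N a a = 1 \<Longrightarrow> eucl_norm N (reflection N a x) = eucl_norm N x"
  by (simp add: eucl_norm_eq_sqrt_inner eucl_inner_reflection)

lemma reflection_orthogonal_maps:
  "a \<in> eucl N \<Longrightarrow> eucl_inner N a a = 1 \<Longrightarrow> reflection N a \<in> orthogonal_maps N"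
  using linear_reflection by (auto simp: orthogonal_maps_def reflection_eucl eucl_norm_reflection)

lemma reflection_image_span: "reflection N a ` fs.span S = fs.span (reflection N a ` S)"
proof -
  interpret Vector_Spaces.linear fun_scale fun_scale "reflection N a" by (rule linear_reflection)
  show ?thesis by (rule span_image[symmetric])
qed

lemma reflection_image_image: "eucl_inner N a a = 1 \<Longrightarrow> reflection N a ` reflection N a ` A = A"
  by (simp add: image_image reflection_reflection)

lemma orthonormal_reflection:
  "orthonormal N m q \<Longrightarrow> a \<in> eucl N \<Longrightarrow> eucl_inner N a a = 1 \<Longrightarrow>
    orthonormal N m (\<lambda>i. reflection N a (q i))"
  by (simp add: orthonormal_def reflection_eucl eucl_inner_reflection)

lemma reflection_frame_span:
  "reflection N a ` frame_span m q = frame_span m (\<lambda>i. reflection N a (q i))"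
  by (simp add: reflection_image_span image_image)

lemma reflection_grassmannian:
  "E \<in> grassmannian N m \<Longrightarrow> a \<in> eucl N \<Longrightarrow> eucl_inner N a a = 1 \<Longrightarrow> reflection N a ` E \<in> grassmannian N m"
  by (elim grassmannianE) (simp only: reflection_frame_span frame_span_grassmannian orthonormal_reflection)

lemma orth_proj_reflection:
  assumes E: "E \<in> grassmannian N m" and a: "a \<in> eucl N" "eucl_inner N a a = 1"
  shows "orth_proj N (reflection N a ` E) x = reflection N a (orth_proj N E (reflection N a x))"
proof (rule orth_proj_eqI)
  have E': "reflection N a ` E \<in> grassmannian N m"
    using E a by (rule reflection_grassmannian)
  then show "fs.subspace (reflection N a ` E)" "reflection N a ` E \<subseteq> eucl N"
    by (auto dest: grassmannian_subspace grassmannian_subset)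
  show "reflection N a (orth_proj N E (reflection N a x)) \<in> reflection N a ` E"
    using E by (intro imageI orth_proj_mem)
  fix z assume "z \<in> reflection N a ` E"
  then obtain y where y: "y \<in> E" "z = reflection N a y" by auto
  have "eucl_inner N (x - reflection N a (orth_proj N E (reflection N a x))) z
      = eucl_inner N (reflection N a x - orth_proj N E (reflection N a x)) y"
    unfolding y(2) using a(2)
    by (simp add: eucl_inner_diff_left eucl_inner_reflection eucl_inner_reflection_swap reflection_reflection)
  also have "\<dots> = 0"
    using E y(1) by (rule orth_proj_orthogonal)
  finally show "eucl_inner N (x - reflection N a (orth_proj N E (reflection N a x))) z = 0" .
qed

lemma reflection_diff: "reflection N a (x - y) = reflection N a x - reflection N a y"
  unfolding reflection_def eucl_inner_simps by (simp add: fun_eq_iff fun_scale_def algebra_simps)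

text \<open>Conjugating both projections by the same isometry does not increase the distance. Since
  a reflection is an involution, the same inequality applied to the images gives the
  converse.\<close>

lemma grass_dist_reflection:
  assumes E: "E \<in> grassmannian N m" "F \<in> grassmannian N m" and a: "a \<in> eucl N" "eucl_inner N a a = 1"
  shows "grass_dist N m (reflection N a ` E) (reflection N a ` F) = grass_dist N m E F"
proof -
  have le: "grass_dist N m (reflection N a ` E) (reflection N a ` F) \<le> grass_dist N m E F"
    if E: "E \<in> grassmannian N m" "F \<in> grassmannian N m" for E F
  proof (rule grass_dist_le)
    fix x assume "x \<in> eucl N"
    then have "reflection N a x \<in> eucl N" using a(1) by (intro reflection_eucl)
    from grass_dist_norm_le[OF E this]
    show "eucl_norm N (orth_proj N (reflection N a ` E) x - orth_proj N (reflection N a ` F) x)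
        \<le> grass_dist N m E F * eucl_norm N x"
      using a(2) unfolding orth_proj_reflection[OF E(1) a] orth_proj_reflection[OF E(2) a]
      by (simp add: eucl_norm_reflection flip: reflection_diff)
  qed (use E a in \<open>auto intro: reflection_grassmannian grass_dist_nonneg\<close>)
  from le[OF reflection_grassmannian[OF E(1) a] reflection_grassmannian[OF E(2) a]] le[OF E]
  show ?thesis
    by (simp add: reflection_image_image a(2))
qed

text \<open>The Householder reflection along w = u - v. Because u and v have equal norms, <w, u> is
  half of |w|^2, so u is sent to u - w = v, while everything orthogonal to both is fixed.\<close>

lemma reflection_exchange:
  assumes uv: "u \<in> eucl N" "v \<in> eucl N" "eucl_inner N u u = 1" "eucl_inner N v v = 1" and "u \<noteq> v"
  obtains a where "a \<in> eucl N" "eucl_inner N a a = 1" "reflection N a u = v"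
    "\<And>z. eucl_inner N u z = 0 \<Longrightarrow> eucl_inner N v z = 0 \<Longrightarrow> reflection N a z = z"
proof -
  define w where "w = u - v"
  have w: "w \<in> eucl N" "w \<noteq> 0"
    using uv \<open>u \<noteq> v\<close> by (auto simp: w_def eucl_diff)
  define s where "s = eucl_inner N w w"
  have s: "0 < s"
    using w eucl_inner_nonneg[of N w] eucl_inner_self_eq_0[of w N] by (auto simp: less_le s_def)
  define a where "a = fun_scale (1 / sqrt s) w"
  have wu: "2 * eucl_inner N w u = s"
    using uv by (simp add: s_def w_def eucl_inner_simps eucl_inner_commute[of N v u])
  show ?thesis
  proof (rule that[of a])
    show "a \<in> eucl N" using w by (simp add: a_def eucl_scale)
    show "eucl_inner N a a = 1"
      using s by (simp add: a_def eucl_inner_simps flip: s_def mult.assoc)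
    have "fun_scale (2 * eucl_inner N a u) a = fun_scale (2 * eucl_inner N w u / s) w"
      using s by (simp add: a_def eucl_inner_scale_left)
    also have "\<dots> = w" using s unfolding wu by simp
    finally have "reflection N a u = u - w" by (simp add: reflection_def)
    then show "reflection N a u = v" by (simp add: w_def)
    fix z assume "eucl_inner N u z = 0" "eucl_inner N v z = 0"
    then show "reflection N a z = z"
      by (simp add: reflection_def a_def w_def eucl_inner_simps)
  qed
qed

text \<open>Holds because reflections act transitively on the Grassmannian.\<close>

lemma grassmannian_reflection_induct:
  assumes E: "E \<in> grassmannian N m" and F: "F \<in> grassmannian N m" and "Q E"
    and step: "\<And>E a. E \<in> grassmannian N m \<Longrightarrow> a \<in> eucl N \<Longrightarrow> eucl_inner N a a = 1 \<Longrightarrow> Q E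
      \<Longrightarrow> Q (reflection N a ` E)"
  shows "Q F"
proof -
  obtain q where q: "orthonormal N m q" "E = frame_span m q"
    using E by (rule grassmannianE)
  obtain p where p: "orthonormal N m p" "F = frame_span m p"
    using F by (rule grassmannianE)
  \<comment> \<open>The frame of \<open>E\<close> is moved onto the frame of \<open>F\<close> one
    vector at a time. The reflection exchanging \<open>q j\<close> and \<open>p j\<close> keeps the
    earlier vectors, which already agree and hence are orthogonal to both.\<close>
  have "\<exists>q. orthonormal N m q \<and> Q (frame_span m q) \<and> (\<forall>i<j. q i = p i)" if "j \<le> m" for j
    using that
  proof (induction j)
    case 0
    then show ?case using q \<open>Q E\<close> by blast
  next
    case (Suc j)
    then obtain q where q: "orthonormal N m q" "Q (frame_span m q)" "\<And>i. i < j \<Longrightarrow> q i = p i"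
      by auto
    show ?case
    proof (cases "q j = p j")
      case True
      then show ?thesis using q by (auto simp: less_Suc_eq)
    next
      case False
      have j: "j < m" using Suc.prems by simp
      obtain a where a: "a \<in> eucl N" "eucl_inner N a a = 1" "reflection N a (q j) = p j"
        "\<And>z. eucl_inner N (q j) z = 0 \<Longrightarrow> eucl_inner N (p j) z = 0 \<Longrightarrow> reflection N a z = z"
        using orthonormal_mem[OF q(1) j] orthonormal_mem[OF p(1) j]
          orthonormalD[OF q(1) j j] orthonormalD[OF p(1) j j] False
        by (auto elim: reflection_exchange)
      have "reflection N a (q i) = p i" if "i < j" for i
      proof -
        have "reflection N a (q i) = q i"
          using orthonormalD[OF q(1) j, of i] orthonormalD[OF p(1) j, of i] that j q(3)[OF that]
          by (intro a(4)) auto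
        then show ?thesis using q(3)[OF that] by simp
      qed
      moreover have "Q (frame_span m (\<lambda>i. reflection N a (q i)))"
        using step[OF frame_span_grassmannian[OF q(1)] a(1,2) q(2)] by (simp only: reflection_frame_span)
      ultimately show ?thesis
        using orthonormal_reflection[OF q(1) a(1,2)] a(3)
        by (intro exI[of _ "\<lambda>i. reflection N a (q i)"]) (auto simp: less_Suc_eq)
    qed
  qed
  from this[of m] obtain q where "Q (frame_span m q)" "\<And>i. i < m \<Longrightarrow> q i = p i" by auto
  moreover from this(2) have "q ` {..<m} = p ` {..<m}" by (intro image_cong) auto
  ultimately show ?thesis using p by simp
qed

definition frame_ker :: "nat \<Rightarrow> nat \<Rightarrow> (nat \<Rightarrow> nat \<Rightarrow> real) \<Rightarrow> (nat \<Rightarrow> real) set"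
  where "frame_ker N n g = {x \<in> eucl N. \<forall>i<n. eucl_inner N (g i) x = 0}"

lemma subspace_frame_ker: "fs.subspace (frame_ker N n g)"
  by (auto simp: fs.subspace_def frame_ker_def eucl_inner_simps eucl_add eucl_scale)

text \<open>An orthonormal basis \<open>p\<close> of the kernel completes \<open>q\<close> to an
  orthonormal family \<open>b\<close>. If \<open>b\<close> were shorter than \<open>N\<close>, some
  unit vector orthogonal to \<open>b\<close> would lie in the kernel and yet be orthogonal to the
  basis \<open>p\<close> of it. So the kernel has dimension N - n.\<close>

lemma frame_ker_orthonormal:
  assumes q: "orthonormal N n q"
  shows "frame_ker N n q \<in> grassmannian N (N - n)"
    and "x \<in> eucl N \<Longrightarrow> orth_proj N (frame_ker N n q) x = x - frame_proj N n q x"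
proof -
  have sub: "frame_ker N n q \<subseteq> eucl N" by (auto simp: frame_ker_def)
  obtain m p where p: "orthonormal N m p" "frame_ker N n q = frame_span m p"
    by (rule subspace_orthonormal_basis[OF subspace_frame_ker sub])
  have p_ker: "p i \<in> frame_ker N n q" if "i < m" for i
    unfolding p(2) using that by (intro fs.span_base) auto
  define b where "b i = (if i < n then q i else p (i - n))" for i
  have b: "orthonormal N (n + m) b"
    unfolding orthonormal_def
  proof (intro conjI allI impI)
    fix i j assume ij: "i < n + m" "j < n + m"
    show "b i \<in> eucl N"
      using ij orthonormal_mem[OF q, of i] orthonormal_mem[OF p(1), of "i - n"] by (auto simp: b_def)
    show "eucl_inner N (b i) (b j) = (if i = j then 1 else 0)"
    proof -
      have pq: "eucl_inner N (p k) (q l) = 0" "eucl_inner N (q l) (p k) = 0" if "k < m" "l < n" for k l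
        using p_ker[OF that(1)] that(2) by (simp_all add: frame_ker_def eucl_inner_commute[of N "p k"])
      have lt: "i - n < m" "j - n < m" if "\<not> i < n" "\<not> j < n"
        using that ij by auto
      consider "i < n" "j < n" | "i < n" "\<not> j < n" | "\<not> i < n" "j < n" | "\<not> i < n" "\<not> j < n"
        by blast
      then show ?thesis
      proof cases
        case 1
        then show ?thesis using orthonormalD[OF q, of i j] by (simp add: b_def)
      next
        case 2
        then show ?thesis using pq(2)[of "j - n" i] ij by (auto simp: b_def)
      next
        case 3
        then show ?thesis using pq(1)[of "i - n" j] ij by (auto simp: b_def)
      next
        case 4
        then show ?thesis using orthonormalD[OF p(1), of "i - n" "j - n"] lt by (auto simp: b_def)
      qed
    qed
  qed
  have "n + m = N"
  proof (rule ccontr)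
    assume "n + m \<noteq> N"
    with orthonormal_card_le[OF b] have "n + m < N" by simp
    from orthonormal_complement_unit[OF b this]
    obtain u where u: "u \<in> eucl N" "eucl_inner N u u = 1" "\<And>i. i < n + m \<Longrightarrow> eucl_inner N u (b i) = 0"
      by blast
    have "eucl_inner N (q i) u = 0" if "i < n" for i
      using u(3)[of i] that by (simp add: b_def eucl_inner_commute[of N u])
    then have "u \<in> frame_span m p"
      using u(1) by (simp add: frame_ker_def flip: p(2))
    moreover have "eucl_inner N u (p i) = 0" if "i < m" for i
      using u(3)[of "i + n"] that by (simp add: b_def)
    ultimately have "eucl_inner N u u = 0"
      using eucl_inner_span_eq_0[of u "p ` {..<m}" N u] by auto
    with u(2) show False by simp
  qed
  then have "m = N - n" by simp
  then show "frame_ker N n q \<in> grassmannian N (N - n)"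
    using frame_span_grassmannian[OF p(1)] by (simp add: p(2))
  assume x: "x \<in> eucl N"
  show "orth_proj N (frame_ker N n q) x = x - frame_proj N n q x"
  proof (rule orth_proj_eqI[OF subspace_frame_ker sub])
    have "frame_proj N n q x \<in> eucl N"
      using frame_proj_in_span[of N n q x] frame_span_eucl[OF q] by auto
    moreover have "eucl_inner N (x - frame_proj N n q x) (q i) = 0" if "i < n" for i
      using that by (intro frame_proj_orthogonal[OF q] fs.span_base) auto
    ultimately show "x - frame_proj N n q x \<in> frame_ker N n q"
      using x by (simp add: frame_ker_def eucl_diff eucl_inner_commute[of N "q _"])
    fix z assume "z \<in> frame_ker N n q"
    then have "eucl_inner N z (frame_proj N n q x) = 0"
      by (intro eucl_inner_span_eq_0[OF frame_proj_in_span]) (auto simp: frame_ker_def eucl_inner_commute[of N z])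
    then show "eucl_inner N (x - (x - frame_proj N n q x)) z = 0"
      by (simp add: eucl_inner_commute[of N z])
  qed
qed

section \<open>Kernels of matrices of full rank\<close>

text \<open>A row sampled from a product space is \<open>undefined\<close> outside of
  \<open>{1..N}\<close>; its truncation is the vector of \<open>eucl N\<close> with the same
  coordinates.\<close>

definition trunc :: "nat \<Rightarrow> (nat \<Rightarrow> real) \<Rightarrow> nat \<Rightarrow> real"
  where "trunc N x = (\<lambda>j. if j \<in> {1..N} then x j else 0)"

lemma trunc_eucl: "trunc N x \<in> eucl N"
  by (simp add: trunc_def eucl_def)

lemma eucl_inner_trunc [simp]: "eucl_inner N (trunc N x) y = eucl_inner N x y"
  and eucl_inner_trunc_right [simp]: "eucl_inner N x (trunc N y) = eucl_inner N x y"
  by (auto simp: eucl_inner_def trunc_def intro!: sum.cong)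

text \<open>An explicit recursion makes the orthonormalized rows measurable functions of
  \<open>G\<close> that commute with reflections. A vanishing residual is normalized to 0.\<close>

function gram_schmidt :: "nat \<Rightarrow> (nat \<Rightarrow> nat \<Rightarrow> real) \<Rightarrow> nat \<Rightarrow> nat \<Rightarrow> real"
  where "gram_schmidt N G i =
    (let r = trunc N (G i) - (\<Sum>j<i. fun_scale (eucl_inner N (G i) (gram_schmidt N G j)) (gram_schmidt N G j))
     in fun_scale (1 / eucl_norm N r) r)"
  by pat_completeness auto
termination
  by (relation "Wellfounded.measure (\<lambda>(N, G, i). i)") auto

declare gram_schmidt.simps [simp del]

definition residual :: "nat \<Rightarrow> (nat \<Rightarrow> nat \<Rightarrow> real) \<Rightarrow> nat \<Rightarrow> nat \<Rightarrow> real"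
  where "residual N G i = trunc N (G i) - frame_proj N i (gram_schmidt N G) (G i)"

lemma gram_schmidt_residual:
  "gram_schmidt N G i = fun_scale (1 / eucl_norm N (residual N G i)) (residual N G i)"
  by (subst gram_schmidt.simps) (simp add: Let_def residual_def frame_proj_def)

text \<open>Linear independence of the rows, in terms of the recursion; in this form it is
  measurable and carried along by reflections.\<close>

definition full_rank :: "nat \<Rightarrow> nat \<Rightarrow> (nat \<Rightarrow> nat \<Rightarrow> real) \<Rightarrow> bool"
  where "full_rank N n G \<longleftrightarrow> (\<forall>i<n. residual N G i \<noteq> 0)"

lemma gram_schmidt_eucl: "gram_schmidt N G i \<in> eucl N"
proof (induction i rule: less_induct)
  case (less i)
  then have "frame_proj N i (gram_schmidt N G) (G i) \<in> eucl N"
    unfolding frame_proj_def using subspace_eucl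
    by (intro fs.subspace_sum) (auto intro: eucl_scale)
  then show ?case
    by (subst gram_schmidt_residual) (auto simp: residual_def intro!: eucl_scale eucl_diff trunc_eucl)
qed

lemma residual_eucl: "residual N G i \<in> eucl N"
proof -
  have "frame_proj N i (gram_schmidt N G) (G i) \<in> eucl N"
    unfolding frame_proj_def using subspace_eucl
    by (intro fs.subspace_sum) (auto intro: eucl_scale gram_schmidt_eucl)
  then show ?thesis
    unfolding residual_def by (intro eucl_diff trunc_eucl)
qed

lemma scale_gram_schmidt:
  "residual N G i \<noteq> 0 \<Longrightarrow> fun_scale (eucl_norm N (residual N G i)) (gram_schmidt N G i) = residual N G i"
  using eucl_norm_eq_0[OF residual_eucl] by (simp add: gram_schmidt_residual)

lemma orthonormal_gram_schmidt: "full_rank N n G \<Longrightarrow> orthonormal N n (gram_schmidt N G)"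
proof (induction n)
  case 0
  then show ?case by (simp add: orthonormal_def)
next
  case (Suc n)
  let ?q = "gram_schmidt N G" and ?r = "residual N G n"
  have q: "orthonormal N n ?q" and r: "?r \<noteq> 0"
    using Suc by (simp_all add: full_rank_def)
  have "frame_proj N n ?q (G n) = frame_proj N n ?q (trunc N (G n))"
    by (simp add: frame_proj_def)
  then have "eucl_inner N ?r (?q i) = 0" if "i < n" for i
    using frame_proj_orthogonal[OF q fs.span_base, of "?q i" "trunc N (G n)"] that
    by (simp add: residual_def)
  then have 1: "eucl_inner N (?q n) (?q i) = 0" if "i < n" for i
    using that by (subst gram_schmidt_residual) (simp add: eucl_inner_scale_left)
  have 2: "eucl_inner N (?q n) (?q n) = 1"
  proof -
    have "eucl_norm N (?q n) = 1"
      using r eucl_norm_eq_0[OF residual_eucl, of N G n] eucl_norm_nonneg[of ?r N]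
      by (subst gram_schmidt_residual) (simp add: eucl_norm_scale)
    then show ?thesis by (simp flip: eucl_norm_power2)
  qed
  show ?case
    unfolding orthonormal_def
  proof (intro conjI allI impI)
    fix i j assume "i < Suc n" "j < Suc n"
    then consider "i < n" "j < n" | "i = n" "j < n" | "i < n" "j = n" | "i = n" "j = n" by linarith
    then show "eucl_inner N (?q i) (?q j) = (if i = j then 1 else 0)"
      using orthonormalD[OF q, of i j] 1[of j] 1[of i] 2
      by cases (auto simp: eucl_inner_commute[of N "?q i" "?q n"])
  qed (rule gram_schmidt_eucl)
qed

text \<open>Rows and orthonormalized rows determine each other by a triangular system whose diagonal
  entries are the norms of the residuals. One inclusion is direct substitution, the other is forward
  elimination.\<close>

lemma frame_ker_gram_schmidt:
  assumes "full_rank N n G"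
  shows "frame_ker N n (gram_schmidt N G) = frame_ker N n G"
proof -
  let ?q = "gram_schmidt N G"
  have eq: "eucl_inner N (G i) x = eucl_norm N (residual N G i) * eucl_inner N (?q i) x
      + (\<Sum>j<i. eucl_inner N (G i) (?q j) * eucl_inner N (?q j) x)" if "i < n" for i x
  proof -
    have "residual N G i \<noteq> 0" using assms that by (simp add: full_rank_def)
    from scale_gram_schmidt[OF this]
    have "eucl_norm N (residual N G i) * eucl_inner N (?q i) x = eucl_inner N (residual N G i) x"
      by (metis eucl_inner_scale_left)
    then show ?thesis
      by (simp add: residual_def frame_proj_def eucl_inner_simps)
  qed
  have "(\<forall>i<n. eucl_inner N (?q i) x = 0) \<longleftrightarrow> (\<forall>i<n. eucl_inner N (G i) x = 0)" for x
  proof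
    assume "\<forall>i<n. eucl_inner N (?q i) x = 0"
    then show "\<forall>i<n. eucl_inner N (G i) x = 0" by (simp add: eq)
  next
    assume G: "\<forall>i<n. eucl_inner N (G i) x = 0"
    have "eucl_inner N (?q i) x = 0" if "i < n" for i
      using that
    proof (induction i rule: less_induct)
      case (less i)
      then have "eucl_norm N (residual N G i) * eucl_inner N (?q i) x = 0"
        using G eq[of i x] by simp
      moreover have "residual N G i \<noteq> 0"
        using assms less.prems by (simp add: full_rank_def)
      ultimately show ?case
        using eucl_norm_eq_0[OF residual_eucl] by simp
    qed
    then show "\<forall>i<n. eucl_inner N (?q i) x = 0" by simp
  qed
  then show ?thesis by (auto simp: frame_ker_def)
qed

text \<open>Serves to change row \<open>i\<close> while the vectors of smaller index stay
  fixed.\<close>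

lemma gram_schmidt_cong:
  assumes "\<And>j. j \<le> i \<Longrightarrow> G j = G' j"
  shows "gram_schmidt N G i = gram_schmidt N G' i"
  using assms
proof (induction i rule: less_induct)
  case (less i)
  then have "gram_schmidt N G j = gram_schmidt N G' j" if "j < i" for j
    using that by simp
  then show ?case
    using less.prems[of i] by (subst (1 2) gram_schmidt.simps) simp
qed

text \<open>The recursion uses only linear combinations and inner products, and a reflection
  respects both. Rows are compared after truncation because their values outside of
  \<open>{1..N}\<close> are arbitrary.\<close>

lemma gram_schmidt_reflection:
  assumes a: "eucl_inner N a a = 1" and G': "\<And>i. i < n \<Longrightarrow> trunc N (G' i) = reflection N a (trunc N (G i))"
    and "i < n"
  shows "gram_schmidt N G' i = reflection N a (gram_schmidt N G i)"
    and "residual N G' i = reflection N a (residual N G i)"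
proof -
  interpret refl: Vector_Spaces.linear fun_scale fun_scale "reflection N a"
    by (rule linear_reflection)
  have residual: "residual N G' i = reflection N a (residual N G i)"
    if "i < n" "\<And>j. j < i \<Longrightarrow> gram_schmidt N G' j = reflection N a (gram_schmidt N G j)" for i
  proof -
    have "eucl_inner N (G' i) (gram_schmidt N G' j) = eucl_inner N (G i) (gram_schmidt N G j)" if "j < i" for j
    proof -
      have "eucl_inner N (G' i) (gram_schmidt N G' j) = eucl_inner N (trunc N (G' i)) (gram_schmidt N G' j)"
        by simp
      also have "\<dots> = eucl_inner N (trunc N (G i)) (gram_schmidt N G j)"
        using a \<open>i < n\<close> that \<open>\<And>j. j < i \<Longrightarrow> _\<close> by (simp add: G' eucl_inner_reflection del: eucl_inner_trunc)
      finally show ?thesis by simp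
    qed
    then show ?thesis
      unfolding residual_def frame_proj_def using that
      by (simp add: G' refl.diff refl.sum refl.scale)
  qed
  have gs: "gram_schmidt N G' i = reflection N a (gram_schmidt N G i)" if "i < n" for i
    using that
  proof (induction i rule: less_induct)
    case (less i)
    then have "residual N G' i = reflection N a (residual N G i)"
      by (intro residual) auto
    then show ?case
      unfolding gram_schmidt_residual by (simp add: refl.scale eucl_norm_reflection a)
  qed
  show "gram_schmidt N G' i = reflection N a (gram_schmidt N G i)"
    using \<open>i < n\<close> by (rule gs)
  show "residual N G' i = reflection N a (residual N G i)"
    using \<open>i < n\<close> by (intro residual gs) auto
qed

lemma frame_ker_reflection:
  assumes a: "a \<in> eucl N" "eucl_inner N a a = 1"
  shows "frame_ker N n (\<lambda>i. reflection N a (q i)) = reflection N a ` frame_ker N n q"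
proof (intro equalityI subsetI)
  fix x assume "x \<in> frame_ker N n (\<lambda>i. reflection N a (q i))"
  then have "reflection N a x \<in> frame_ker N n q"
    using a by (simp add: frame_ker_def eucl_inner_reflection_swap reflection_eucl)
  then show "x \<in> reflection N a ` frame_ker N n q"
    using reflection_reflection[OF a(2), of x] by (metis image_eqI)
next
  fix x assume "x \<in> reflection N a ` frame_ker N n q"
  then show "x \<in> frame_ker N n (\<lambda>i. reflection N a (q i))"
    using a by (auto simp: frame_ker_def eucl_inner_reflection reflection_eucl)
qed

section \<open>Measurability and almost sure full rank\<close>

lemma measurable_trunc_entry:
  "i < n \<Longrightarrow> (\<lambda>G. trunc N (G i) l) \<in> borel_measurable (gauss_mat n N)"
  by (cases "l \<in> {1..N}") (auto simp: trunc_def intro!: measurable_gauss_mat_entry)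

lemma borel_measurable_eucl_inner:
  assumes "\<And>l. l \<in> {1..N} \<Longrightarrow> (\<lambda>x. f x l) \<in> borel_measurable M"
    and "\<And>l. l \<in> {1..N} \<Longrightarrow> (\<lambda>x. g x l) \<in> borel_measurable M"
  shows "(\<lambda>x. eucl_inner N (f x) (g x)) \<in> borel_measurable M"
  unfolding eucl_inner_def using assms by (intro borel_measurable_sum borel_measurable_times) auto

lemma borel_measurable_eucl_norm:
  assumes "\<And>l. l \<in> {1..N} \<Longrightarrow> (\<lambda>x. f x l) \<in> borel_measurable M"
  shows "(\<lambda>x. eucl_norm N (f x)) \<in> borel_measurable M"
  unfolding L2_set_def using assms
  by (intro measurable_compose[OF _ borel_measurable_sqrt] borel_measurable_sum borel_measurable_power) auto

lemma sum_fun_apply: "(\<Sum>j\<in>A. f j) x = (\<Sum>j\<in>A. f j x)" for f :: "'a \<Rightarrow> 'b \<Rightarrow> real"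
  by (induction A rule: infinite_finite_induct) auto

lemma borel_measurable_frame_proj:
  assumes "\<And>i l. i < n \<Longrightarrow> l \<in> {1..N} \<Longrightarrow> (\<lambda>G. q G i l) \<in> borel_measurable M"
    and "\<And>l. l \<in> {1..N} \<Longrightarrow> (\<lambda>G. x G l) \<in> borel_measurable M" and "l \<in> {1..N}"
  shows "(\<lambda>G. frame_proj N n (q G) (x G) l) \<in> borel_measurable M"
  unfolding frame_proj_def sum_fun_apply fun_scale_def using assms
  by (intro borel_measurable_sum borel_measurable_times borel_measurable_eucl_inner) auto

lemma measurable_gauss_mat_row_entry:
  "i < n \<Longrightarrow> l \<in> {1..N} \<Longrightarrow> (\<lambda>G. G i l) \<in> borel_measurable (gauss_mat n N)"
  by (intro measurable_gauss_mat_entry) auto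

lemma borel_measurable_gram_schmidt:
  assumes "i < n" "l \<in> {1..N}"
  shows "(\<lambda>G. gram_schmidt N G i l) \<in> borel_measurable (gauss_mat n N)"
    and "(\<lambda>G. residual N G i l) \<in> borel_measurable (gauss_mat n N)"
proof -
  have residual: "(\<lambda>G. residual N G i l) \<in> borel_measurable (gauss_mat n N)"
    if "i < n" "l \<in> {1..N}" "\<And>j l. j < i \<Longrightarrow> l \<in> {1..N} \<Longrightarrow>
      (\<lambda>G. gram_schmidt N G j l) \<in> borel_measurable (gauss_mat n N)" for i l
    unfolding residual_def fun_diff_def using that
    by (intro borel_measurable_diff measurable_trunc_entry borel_measurable_frame_proj
      measurable_gauss_mat_row_entry) auto
  have gs: "(\<lambda>G. gram_schmidt N G i l) \<in> borel_measurable (gauss_mat n N)"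
    if "i < n" "l \<in> {1..N}" for i l
    using that
  proof (induction i arbitrary: l rule: less_induct)
    case (less i)
    show ?case
      unfolding gram_schmidt_residual[of N _ i] unfolding fun_scale_def using less
      by (intro borel_measurable_times borel_measurable_divide borel_measurable_const
        borel_measurable_eucl_norm residual) auto
  qed
  show "(\<lambda>G. gram_schmidt N G i l) \<in> borel_measurable (gauss_mat n N)"
    using assms by (rule gs)
  show "(\<lambda>G. residual N G i l) \<in> borel_measurable (gauss_mat n N)"
    using assms by (intro residual gs) auto
qed

lemma sets_residual_eq_0:
  assumes "i < n"
  shows "{G \<in> space (gauss_mat n N). residual N G i = 0} \<in> sets (gauss_mat n N)"
proof -
  have "residual N G i = 0 \<longleftrightarrow> eucl_norm N (residual N G i) = 0" for G
    by (simp add: eucl_norm_eq_0 residual_eucl)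
  moreover have "(\<lambda>G. eucl_norm N (residual N G i)) \<in> borel_measurable (gauss_mat n N)"
    using assms by (intro borel_measurable_eucl_norm borel_measurable_gram_schmidt)
  ultimately show ?thesis
    using borel_measurable_eq[OF _ borel_measurable_const] by simp
qed

lemma emeasure_std_normal_singleton: "emeasure std_normal {c} = 0"
  by (simp add: std_normal_def emeasure_density nn_integral_0_iff_AE AE_lborel_singleton
    flip: AE_iff_measurable)

text \<open>Choose a coordinate \<open>l\<close> with nonzero \<open>u l\<close>. For fixed values
  of the others, the equation has a single solution in coordinate \<open>l\<close>, and points have
  Gaussian measure 0.\<close>

lemma gauss_vec_hyperplane:
  assumes "u \<in> eucl N" "u \<noteq> 0"
  shows "(\<integral>\<^sup>+g. indicator {g. eucl_inner N g u = 0} g \<partial>gauss_vec N) = 0"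
proof -
  obtain l where l: "u l \<noteq> 0" using assms(2) by (auto simp: fun_eq_iff)
  then have lN: "l \<in> {1..N}" using assms(1) by (auto simp: eucl_def)
  define J where "J = {1..N} - {l}"
  have J: "finite J" "l \<notin> J" "insert l J = {1..N}" using lN by (auto simp: J_def)
  have entry: "(\<lambda>g. g i) \<in> borel_measurable (gauss_vec N)" if "i \<in> {1..N}" for i
    using measurable_component_singleton[OF that, of "\<lambda>_. std_normal"]
    by (simp cong: measurable_cong_sets)
  have "(\<lambda>g. eucl_inner N g u) \<in> borel_measurable (gauss_vec N)"
    by (intro borel_measurable_eucl_inner entry) auto
  then have "{g \<in> space (gauss_vec N). eucl_inner N g u = 0} \<in> sets (gauss_vec N)"
    using borel_measurable_eq[OF _ borel_measurable_const] by simp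
  then have meas: "(indicator {g. eucl_inner N g u = 0} :: _ \<Rightarrow> ennreal) \<in> borel_measurable (gauss_vec N)"
    by (simp add: borel_measurable_indicator_iff Int_def conj_commute)
  have "(\<integral>\<^sup>+g. indicator {g. eucl_inner N g u = 0} g \<partial>gauss_vec N)
      = (\<integral>\<^sup>+g. (\<integral>\<^sup>+y. indicator {g. eucl_inner N g u = 0} (g(l := y)) \<partial>std_normal) \<partial>PiM J (\<lambda>_. std_normal))"
    using gauss_entry.product_nn_integral_insert[OF J(1,2)] meas unfolding J(3) by blast
  also have "\<dots> = (\<integral>\<^sup>+g. 0 \<partial>PiM J (\<lambda>_. std_normal))"
  proof (rule nn_integral_cong)
    fix g :: "nat \<Rightarrow> real"
    define c where "c = - (\<Sum>i\<in>J. g i * u i) / u l"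
    have "eucl_inner N (g(l := y)) u = y * u l + (\<Sum>i\<in>J. g i * u i)" for y
    proof -
      have "(\<Sum>i\<in>J. (g(l := y)) i * u i) = (\<Sum>i\<in>J. g i * u i)"
        using J by (intro sum.cong) auto
      then show ?thesis unfolding eucl_inner_def J(3)[symmetric] using J(1,2) by simp
    qed
    then have "indicator {g. eucl_inner N g u = 0} (g(l := y)) = (indicator {c} y :: ennreal)" for y
      using l by (auto simp: c_def indicator_def field_simps)
    then show "(\<integral>\<^sup>+y. indicator {g. eucl_inner N g u = 0} (g(l := y)) \<partial>std_normal) = 0"
      by (simp add: emeasure_std_normal_singleton)
  qed
  finally show ?thesis by simp
qed

text \<open>With all rows but row \<open>i\<close> fixed, the first \<open>i\<close> Gram-Schmidt
  vectors are orthogonal to some unit vector u, because i < N. A vanishing residual then forces row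
  \<open>i\<close> into the hyperplane orthogonal to u, a null set.\<close>

lemma AE_residual_nonzero:
  assumes "i < n" "n \<le> N"
  shows "AE G in gauss_mat n N. residual N G i \<noteq> 0"
proof -
  let ?Z = "{G. residual N G i = 0}"
  define J where "J = {..<n} - {i}"
  have J: "finite J" "i \<notin> J" "insert i J = {..<n}" using assms by (auto simp: J_def)
  have meas: "(indicator ?Z :: _ \<Rightarrow> ennreal) \<in> borel_measurable (gauss_mat n N)"
    using sets_residual_eq_0[OF assms(1), of N]
    by (simp add: borel_measurable_indicator_iff Int_def conj_commute)
  have "emeasure (gauss_mat n N) {G \<in> space (gauss_mat n N). residual N G i = 0}
      = (\<integral>\<^sup>+G. indicator {G \<in> space (gauss_mat n N). residual N G i = 0} G \<partial>gauss_mat n N)"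
    using sets_residual_eq_0[OF assms(1), of N] by simp
  also have "\<dots> = (\<integral>\<^sup>+G. indicator ?Z G \<partial>gauss_mat n N)"
    by (intro nn_integral_cong) (auto simp: indicator_def)
  also have "\<dots> = (\<integral>\<^sup>+G. (\<integral>\<^sup>+g. indicator ?Z (G(i := g)) \<partial>gauss_vec N) \<partial>PiM J (\<lambda>_. gauss_vec N))"
    using gauss_row.product_nn_integral_insert[OF J(1,2)] meas unfolding J(3) by blast
  also have "\<dots> = (\<integral>\<^sup>+G. 0 \<partial>PiM J (\<lambda>_. gauss_vec N))"
  proof (rule nn_integral_cong)
    fix G :: "nat \<Rightarrow> nat \<Rightarrow> real"
    let ?q = "gram_schmidt N G"
    have "fs.span (?q ` {..<i}) \<subseteq> eucl N"
      by (intro fs.span_minimal subspace_eucl) (auto intro: gram_schmidt_eucl)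
    \<comment> \<open>For this \<open>G\<close> earlier residuals may vanish, so the vectors
      \<open>?q j\<close> may fail to be orthonormal. An orthonormal basis of their span has at most
      \<open>i\<close> members.\<close>
    then obtain m p where p: "orthonormal N m p" "fs.span (?q ` {..<i}) = frame_span m p"
      using subspace_orthonormal_basis[OF fs.subspace_span] by metis
    have "p ` {..<m} \<subseteq> fs.span (?q ` {..<i})"
      unfolding p(2) by (rule fs.span_superset)
    then have "m \<le> card (?q ` {..<i})"
      using fs.independent_span_bound[of "?q ` {..<i}" "p ` {..<m}"] orthonormal_independent[OF p(1)] by auto
    also have "\<dots> \<le> i" using card_image_le[of "{..<i}" ?q] by simp
    finally have "m < N" using assms by simp
    from orthonormal_complement_unit[OF p(1) this]
    obtain u where u: "u \<in> eucl N" "eucl_inner N u u = 1" "\<And>j. j < m \<Longrightarrow> eucl_inner N u (p j) = 0"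
      by blast
    have perp: "eucl_inner N (?q j) u = 0" if "j < i" for j
    proof -
      have "?q j \<in> frame_span m p"
        using that p(2) fs.span_base[of "?q j" "?q ` {..<i}"] by auto
      then have "eucl_inner N u (?q j) = 0"
        by (rule eucl_inner_span_eq_0) (use u(3) in auto)
      then show ?thesis by (simp add: eucl_inner_commute[of N "?q j"])
    qed
    have "indicator ?Z (G(i := g)) \<le> (indicator {g. eucl_inner N g u = 0} g :: ennreal)" for g
    proof -
      have "gram_schmidt N (G(i := g)) j = ?q j" if "j < i" for j
        using that by (intro gram_schmidt_cong) auto
      then have "eucl_inner N (residual N (G(i := g)) i) u = eucl_inner N g u"
        using perp by (simp add: residual_def frame_proj_def eucl_inner_simps)
      then show ?thesis
        by (auto simp: indicator_def eucl_inner_zero_left)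
    qed
    then have "(\<integral>\<^sup>+g. indicator ?Z (G(i := g)) \<partial>gauss_vec N)
        \<le> (\<integral>\<^sup>+g. indicator {g. eucl_inner N g u = 0} g \<partial>gauss_vec N)"
      by (intro nn_integral_mono)
    also have "\<dots> = 0"
      using u by (intro gauss_vec_hyperplane) (auto simp: eucl_inner_zero_left)
    finally show "(\<integral>\<^sup>+g. indicator ?Z (G(i := g)) \<partial>gauss_vec N) = 0" by simp
  qed
  finally have "emeasure (gauss_mat n N) {G \<in> space (gauss_mat n N). residual N G i = 0} = 0"
    by simp
  then show ?thesis
    using sets_residual_eq_0[OF assms(1), of N] by (subst AE_iff_measurable[OF _ refl]) simp_all
qed

lemma AE_full_rank: "n \<le> N \<Longrightarrow> AE G in gauss_mat n N. full_rank N n G"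
  unfolding full_rank_def by (intro AE_all_countable[THEN iffD2] allI) (auto intro: AE_residual_nonzero)

lemma sets_full_rank: "{G \<in> space (gauss_mat n N). full_rank N n G} \<in> sets (gauss_mat n N)"
proof -
  have "{G \<in> space (gauss_mat n N). full_rank N n G}
      = space (gauss_mat n N) - (\<Union>i<n. {G \<in> space (gauss_mat n N). residual N G i = 0})"
    by (auto simp: full_rank_def)
  then show ?thesis
    using sets_residual_eq_0 by auto
qed

text \<open>Restricted functions keep the result inside the product space, so that
  \<open>gauss_mat\<close> is mapped to itself.\<close>

definition reflect_rows :: "nat \<Rightarrow> nat \<Rightarrow> (nat \<Rightarrow> real) \<Rightarrow> (nat \<Rightarrow> nat \<Rightarrow> real) \<Rightarrow> nat \<Rightarrow> nat \<Rightarrow> real"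
  where "reflect_rows n N a = compose {..<n}
    (\<lambda>x. \<lambda>i\<in>{1..N}. x i - 2 * (\<Sum>j=1..N. a j * x j) * a i)"

lemma distr_reflect_rows:
  assumes "eucl_inner N a a = 1"
  shows "distr (gauss_mat n N) (gauss_mat n N) (reflect_rows n N a) = gauss_mat n N"
    and "reflect_rows n N a \<in> gauss_mat n N \<rightarrow>\<^sub>M gauss_mat n N"
proof -
  let ?H = "\<lambda>x. \<lambda>i\<in>{1..N}. x i - 2 * (\<Sum>j=1..N. a j * x j) * a i"
  have entry: "(\<lambda>g. g i) \<in> borel_measurable (gauss_vec N)" if "i \<in> {1..N}" for i
    using measurable_component_singleton[OF that, of "\<lambda>_. std_normal"]
    by (simp cong: measurable_cong_sets)
  have H: "?H \<in> gauss_vec N \<rightarrow>\<^sub>M gauss_vec N"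
  proof (rule measurable_restrict)
    fix i assume "i \<in> {1..N}"
    then have "(\<lambda>x. x i - 2 * (\<Sum>j=1..N. a j * x j) * a i) \<in> borel_measurable (gauss_vec N)"
      by (intro borel_measurable_diff borel_measurable_times borel_measurable_sum borel_measurable_const entry)
    then show "(\<lambda>x. x i - 2 * (\<Sum>j=1..N. a j * x j) * a i) \<in> gauss_vec N \<rightarrow>\<^sub>M std_normal"
      by (simp cong: measurable_cong_sets)
  qed
  have "distr (gauss_mat n N) (gauss_mat n N) (reflect_rows n N a)
      = PiM {..<n} (\<lambda>_. distr (gauss_vec N) (gauss_vec N) ?H)"
    unfolding reflect_rows_def
    by (rule distr_PiM_finite_prob_space'[OF _ _ _ H]) (auto intro: prob_space_gauss_vec)
  also have "distr (gauss_vec N) (gauss_vec N) ?H = gauss_vec N"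
    using assms by (intro distr_PiM_std_normal_reflection) (auto simp: eucl_inner_def power2_eq_square)
  finally show "distr (gauss_mat n N) (gauss_mat n N) (reflect_rows n N a) = gauss_mat n N" .
  show "reflect_rows n N a \<in> gauss_mat n N \<rightarrow>\<^sub>M gauss_mat n N"
    unfolding reflect_rows_def compose_def
  proof (rule measurable_restrict)
    fix i assume "i \<in> {..<n}"
    from measurable_compose[OF measurable_component_singleton[OF this, of "\<lambda>_. gauss_vec N"] H]
    show "(\<lambda>x. ?H (x i)) \<in> gauss_mat n N \<rightarrow>\<^sub>M gauss_vec N" .
  qed
qed

lemma trunc_reflect_rows:
  assumes "a \<in> eucl N" "i < n"
  shows "trunc N (reflect_rows n N a G i) = reflection N a (trunc N (G i))"
  using assms
  by (auto simp: fun_eq_iff trunc_def reflect_rows_def compose_def reflection_def fun_scale_def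
      eucl_inner_def eucl_def intro!: sum.cong)

abbreviation gauss_ker :: "nat \<Rightarrow> nat \<Rightarrow> (nat \<Rightarrow> nat \<Rightarrow> real) \<Rightarrow> (nat \<Rightarrow> real) set"
  where "gauss_ker N n G \<equiv> frame_ker N n (gram_schmidt N G)"

section \<open>Measurability and ball measures on the Grassmannian\<close>

lemma countable_rational_eucl: "countable {x \<in> eucl N. \<forall>i. x i \<in> \<rat>}"
proof -
  have 1: "countable (PiE {1..N} (\<lambda>_. \<rat> :: real set))"
    by (intro countable_PiE countable_rat) auto
  have 2: "{x \<in> eucl N. \<forall>i. x i \<in> \<rat>} \<subseteq> trunc N ` PiE {1..N} (\<lambda>_. \<rat>)"
  proof
    fix x assume "x \<in> {x \<in> eucl N. \<forall>i. x i \<in> \<rat>}"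
    then have "x = trunc N (restrict x {1..N})" "restrict x {1..N} \<in> PiE {1..N} (\<lambda>_. \<rat>)"
      by (auto simp: trunc_def eucl_def fun_eq_iff)
    then show "x \<in> trunc N ` PiE {1..N} (\<lambda>_. \<rat>)" by (rule image_eqI)
  qed
  show ?thesis
    by (rule countable_subset[OF 2 countable_image[OF 1]])
qed

lemma rational_eucl_dense:
  assumes x: "x \<in> eucl N" and e: "0 < e"
  obtains y where "y \<in> eucl N" "\<And>i. y i \<in> \<rat>" "eucl_norm N (x - y) \<le> e"
proof -
  have "\<exists>r\<in>\<rat>. x i < r \<and> r < x i + e / (real N + 1)" for i
    using e Rats_dense_in_real[of "x i" "x i + e / (real N + 1)"] by auto
  then obtain r where r: "\<And>i. r i \<in> \<rat>" "\<And>i. x i < r i" "\<And>i. r i < x i + e / (real N + 1)"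
    by metis
  define y where "y = trunc N r"
  show ?thesis
  proof (rule that)
    show "y \<in> eucl N" by (simp add: y_def trunc_eucl)
    show "y i \<in> \<rat>" for i using r(1) by (simp add: y_def trunc_def)
    have "eucl_norm N (x - y) \<le> (\<Sum>i=1..N. \<bar>(x - y) i\<bar>)"
      by (rule eucl_norm_le_sum)
    also have "\<dots> \<le> (\<Sum>i=1..N. e / (real N + 1))"
    proof (rule sum_mono)
      fix i assume "i \<in> {1..N}"
      then show "\<bar>(x - y) i\<bar> \<le> e / (real N + 1)"
        using r(2,3)[of i] by (auto simp: y_def trunc_def)
    qed
    also have "\<dots> \<le> e"
      using e by (simp add: field_simps)
    finally show "eucl_norm N (x - y) \<le> e" .
  qed
qed

text \<open>Turns the supremum over a ball into a countable conjunction, which is what makes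
  nearness of a subspace to a random kernel measurable. Projections are contractions, so rational
  vectors suffice by approximation.\<close>

lemma grass_dist_le_iff_rational:
  assumes E: "E \<in> grassmannian N m" "F \<in> grassmannian N m" and r: "0 \<le> r"
  shows "grass_dist N m E F \<le> r \<longleftrightarrow> (\<forall>x\<in>{x \<in> eucl N. \<forall>i. x i \<in> \<rat>}.
    eucl_norm N (orth_proj N E x - orth_proj N F x) \<le> r * eucl_norm N x)"
proof
  assume le: "grass_dist N m E F \<le> r"
  show "\<forall>x\<in>{x \<in> eucl N. \<forall>i. x i \<in> \<rat>}. eucl_norm N (orth_proj N E x - orth_proj N F x) \<le> r * eucl_norm N x"
  proof
    fix x assume "x \<in> {x \<in> eucl N. \<forall>i. x i \<in> \<rat>}"
    then have "eucl_norm N (orth_proj N E x - orth_proj N F x) \<le> grass_dist N m E F * eucl_norm N x"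
      using E by (intro grass_dist_norm_le) auto
    also have "\<dots> \<le> r * eucl_norm N x"
      using le by (intro mult_right_mono eucl_norm_nonneg)
    finally show "eucl_norm N (orth_proj N E x - orth_proj N F x) \<le> r * eucl_norm N x" .
  qed
next
  assume le: "\<forall>x\<in>{x \<in> eucl N. \<forall>i. x i \<in> \<rat>}.
    eucl_norm N (orth_proj N E x - orth_proj N F x) \<le> r * eucl_norm N x"
  show "grass_dist N m E F \<le> r"
  proof (rule grass_dist_le[OF E r])
    fix x assume x: "x \<in> eucl N"
    show "eucl_norm N (orth_proj N E x - orth_proj N F x) \<le> r * eucl_norm N x"
    proof (rule field_le_epsilon)
      fix e :: real assume "0 < e"
      \<comment> \<open>Replacing \<open>x\<close> by a rational vector within \<open>d\<close>
        costs at most 2 d in the two projections and r d on the right-hand side.\<close>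
      define d where "d = e / (2 + r)"
      have d: "0 < d" using \<open>0 < e\<close> r by (simp add: d_def)
      obtain y where y: "y \<in> eucl N" "\<And>i. y i \<in> \<rat>" "eucl_norm N (x - y) \<le> d"
        by (rule rational_eucl_dense[OF x d]) blast
      have split: "orth_proj N E x - orth_proj N F x
          = (orth_proj N E y - orth_proj N F y) + (orth_proj N E (x - y) - orth_proj N F (x - y))"
        unfolding orth_proj_diff[OF E(1)] orth_proj_diff[OF E(2)] by simp
      have "eucl_norm N (orth_proj N E (x - y) - orth_proj N F (x - y))
          \<le> eucl_norm N (orth_proj N E (x - y)) + eucl_norm N (orth_proj N F (x - y))"
        using eucl_norm_triangle_diff[of "orth_proj N E (x - y)" "orth_proj N F (x - y)" N 0]
          eucl_norm_minus_commute[of 0 "orth_proj N F (x - y)" N] by simp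
      also have "\<dots> \<le> eucl_norm N (x - y) + eucl_norm N (x - y)"
        by (intro add_mono eucl_norm_orth_proj_le[OF E(1)] eucl_norm_orth_proj_le[OF E(2)])
      finally have 1: "eucl_norm N (orth_proj N E (x - y) - orth_proj N F (x - y)) \<le> 2 * d"
        using y(3) by simp
      have "eucl_norm N y \<le> eucl_norm N x + eucl_norm N (x - y)"
        using eucl_norm_triangle_diff[of y 0 N x] eucl_norm_minus_commute[of x y N] by simp
      then have "r * eucl_norm N y \<le> r * (eucl_norm N x + d)"
        using y(3) r by (intro mult_left_mono) auto
      moreover have "eucl_norm N (orth_proj N E y - orth_proj N F y) \<le> r * eucl_norm N y"
        using le y by auto
      ultimately have "eucl_norm N (orth_proj N E x - orth_proj N F x) \<le> r * (eucl_norm N x + d) + 2 * d"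
        using eucl_norm_triangle[of "orth_proj N E y - orth_proj N F y"
            "orth_proj N E (x - y) - orth_proj N F (x - y)" N] 1
        unfolding split by linarith
      also have "\<dots> = r * eucl_norm N x + d * (2 + r)" by (simp add: algebra_simps)
      also have "d * (2 + r) = e" using r by (simp add: d_def)
      finally show "eucl_norm N (orth_proj N E x - orth_proj N F x) \<le> r * eucl_norm N x + e" .
    qed
  qed
qed

text \<open>Superlevel sets of a Lipschitz function are open, hence Borel. The distance to a fixed
  subspace and the entries of a projected vector are of this kind.\<close>

lemma grass_lipschitz_measurable:
  fixes f :: "(nat \<Rightarrow> real) set \<Rightarrow> real"
  assumes \<mu>: "space \<mu> = grassmannian N m" "sets \<mu> = sets (grass_borel N m)"
    and K: "\<And>E F. E \<in> grassmannian N m \<Longrightarrow> F \<in> grassmannian N m \<Longrightarrow> \<bar>f E - f F\<bar> \<le> K * grass_dist N m E F"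
  shows "f \<in> borel_measurable \<mu>"
proof (rule borel_measurableI_greater)
  fix c
  have "openin (grass.mtopology N m) {E \<in> grassmannian N m. c < f E}"
    unfolding grass.openin_mtopology
  proof (intro conjI allI impI)
    fix E assume E: "E \<in> {E \<in> grassmannian N m. c < f E}"
    \<comment> \<open>Dividing by |K| + 1 keeps \<open>r\<close> positive and finite whatever the
      sign of \<open>K\<close>.\<close>
    define r where "r = (f E - c) / (\<bar>K\<bar> + 1)"
    have r: "0 < r" using E by (simp add: r_def)
    have "grass.mball N m E r \<subseteq> {E \<in> grassmannian N m. c < f E}"
    proof
      fix F assume F: "F \<in> grass.mball N m E r"
      then have F': "F \<in> grassmannian N m" "grass_dist N m E F < r" by (auto simp: grass.in_mball)
      have "\<bar>f E - f F\<bar> \<le> K * grass_dist N m E F" using E F' by (intro K) auto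
      also have "\<dots> \<le> (\<bar>K\<bar> + 1) * grass_dist N m E F"
        by (intro mult_right_mono grass_dist_nonneg) auto
      also have "\<dots> < (\<bar>K\<bar> + 1) * r"
        using F' by (intro mult_strict_left_mono) auto
      also have "\<dots> = f E - c" by (simp add: r_def)
      finally show "F \<in> {E \<in> grassmannian N m. c < f E}" using F' by auto
    qed
    with r show "\<exists>r>0. grass.mball N m E r \<subseteq> {E \<in> grassmannian N m. c < f E}" by blast
  qed auto
  then show "{E \<in> space \<mu>. c < f E} \<in> sets \<mu>"
    unfolding \<mu> by (auto simp: grass_borel_def sets_measure_of_conv grass.openin_mtopology)
qed

lemma grass_dist_measurable:
  assumes \<mu>: "space \<mu> = grassmannian N m" "sets \<mu> = sets (grass_borel N m)" and F: "F \<in> grassmannian N m"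
  shows "(\<lambda>E. grass_dist N m E F) \<in> borel_measurable \<mu>"
proof (rule grass_lipschitz_measurable[OF \<mu>])
  fix E E' assume "E \<in> grassmannian N m" "E' \<in> grassmannian N m"
  then show "\<bar>grass_dist N m E F - grass_dist N m E' F\<bar> \<le> 1 * grass_dist N m E E'"
    using grass.triangle[of E N m E' F] grass.triangle[of E' N m E F] F
    by (simp add: grass_dist_commute abs_le_iff)
qed

lemma orth_proj_entry_measurable:
  assumes \<mu>: "space \<mu> = grassmannian N m" "sets \<mu> = sets (grass_borel N m)"
    and x: "x \<in> eucl N" and l: "l \<in> {1..N}"
  shows "(\<lambda>E. orth_proj N E x l) \<in> borel_measurable \<mu>"
proof (rule grass_lipschitz_measurable[OF \<mu>])
  fix E F assume E: "E \<in> grassmannian N m" "F \<in> grassmannian N m"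
  have "\<bar>orth_proj N E x l - orth_proj N F x l\<bar> \<le> eucl_norm N (orth_proj N E x - orth_proj N F x)"
    using abs_le_eucl_norm[OF l, of "orth_proj N E x - orth_proj N F x"] by simp
  also have "\<dots> \<le> eucl_norm N x * grass_dist N m E F"
    using grass_dist_norm_le[OF E x] by (simp add: mult.commute)
  finally show "\<bar>orth_proj N E x l - orth_proj N F x l\<bar> \<le> eucl_norm N x * grass_dist N m E F" .
qed

lemma eucl_norm_le_frame_expansion:
  assumes E: "E \<in> grassmannian N m" "F \<in> grassmannian N m" and x: "x \<in> eucl N"
    and d: "\<And>i. i < N \<Longrightarrow> eucl_norm N (orth_proj N E (unit_vec i) - orth_proj N F (unit_vec i)) \<le> d"
  shows "eucl_norm N (orth_proj N E x - orth_proj N F x) \<le> real N * d * eucl_norm N x"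
proof -
  define A where "A y = orth_proj N E y - orth_proj N F y" for y
  have A: "A (y + z) = A y + A z" "A (fun_scale c y) = fun_scale c (A y)" for y z c
    unfolding A_def orth_proj_add[OF E(1)] orth_proj_add[OF E(2)] orth_proj_scale[OF E(1)] orth_proj_scale[OF E(2)]
    by (simp_all add: fs.scale_right_diff_distrib)
  have A0: "A 0 = 0"
    using A(2)[of 0 0] by simp
  have sum: "eucl_norm N (A (\<Sum>i\<in>I. fun_scale (c i) (unit_vec i))) \<le> (\<Sum>i\<in>I. \<bar>c i\<bar> * d)"
    if "finite I" "I \<subseteq> {..<N}" for I and c :: "nat \<Rightarrow> real"
    using that
  proof (induction I rule: finite_induct)
    case empty
    show ?case by (simp only: sum.empty A0 eucl_norm_zero order_refl)
  next
    case (insert i I)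
    have "eucl_norm N (A (\<Sum>i\<in>insert i I. fun_scale (c i) (unit_vec i)))
        = eucl_norm N (fun_scale (c i) (A (unit_vec i)) + A (\<Sum>i\<in>I. fun_scale (c i) (unit_vec i)))"
      using sum.insert[OF insert.hyps, of "\<lambda>i. fun_scale (c i) (unit_vec i)"] by (simp only: A)
    also have "\<dots> \<le> eucl_norm N (fun_scale (c i) (A (unit_vec i))) + eucl_norm N (A (\<Sum>i\<in>I. fun_scale (c i) (unit_vec i)))"
      by (rule eucl_norm_triangle)
    also have "\<dots> \<le> \<bar>c i\<bar> * d + (\<Sum>i\<in>I. \<bar>c i\<bar> * d)"
      unfolding eucl_norm_scale
    proof (intro add_mono mult_left_mono)
      show "eucl_norm N (A (unit_vec i)) \<le> d"
        using insert.prems d[of i] by (simp add: A_def)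
      show "eucl_norm N (A (\<Sum>i\<in>I. fun_scale (c i) (unit_vec i))) \<le> (\<Sum>i\<in>I. \<bar>c i\<bar> * d)"
        using insert.prems by (intro insert.IH) auto
    qed simp
    finally show ?case by (simp only: sum.insert[OF insert.hyps])
  qed
  have d0: "0 \<le> d" if "N \<noteq> 0"
    using d[of 0] eucl_norm_nonneg[of _ N] that by (metis gr0I order_trans)
  have "eucl_norm N (A (frame_proj N N unit_vec x)) \<le> (\<Sum>i<N. \<bar>eucl_inner N x (unit_vec i)\<bar> * d)"
    unfolding frame_proj_def by (rule sum) auto
  also have "\<dots> \<le> (\<Sum>i<N. eucl_norm N x * d)"
    using d0 by (intro sum_mono mult_right_mono) (auto simp: eucl_inner_unit_vec intro!: abs_le_eucl_norm)
  finally show ?thesis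
    by (simp add: A_def frame_proj_unit_vec x mult_ac)
qed

text \<open>A separability argument: countably many balls of radius \<open>r\<close> cover the
  Grassmannian, so they cannot all be null sets of a probability measure.\<close>

lemma grass_small_ball_pos:
  assumes "prob_space \<mu>" and \<mu>: "space \<mu> = grassmannian N m" "sets \<mu> = sets (grass_borel N m)"
    and r: "0 < r"
  shows "\<exists>F\<in>grassmannian N m. emeasure \<mu> {E \<in> space \<mu>. grass_dist N m E F \<le> r} \<noteq> 0"
proof (rule ccontr)
  assume "\<not> ?thesis"
  then have null: "emeasure \<mu> {E \<in> space \<mu>. grass_dist N m E F \<le> r} = 0" if "F \<in> grassmannian N m" for F
    using that by blast
  interpret prob_space \<mu> by fact
  \<comment> \<open>If the entries of two projection matrices agree up to \<open>e\<close>, then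
    their columns agree up to N e in norm and the projections up to N^2 e in operator norm.\<close>
  define e where "e = r / (real N ^ 2 + 1)"
  have N: "0 < real N ^ 2 + 1" by (simp add: add_nonneg_pos)
  then have e: "0 < e" "(real N ^ 2 + 1) * e = r"
    using r by (simp_all add: e_def)
  then have e2: "real N * (real N * e) \<le> r"
    by (simp add: power2_eq_square algebra_simps)
  \<comment> \<open>The projection matrix rounded to a grid of mesh \<open>e\<close>. Keys are lists
    of lists of integers, so there are only countably many.\<close>
  define key where "key E = map (\<lambda>i. map (\<lambda>j. \<lfloor>orth_proj N E (unit_vec i) (Suc j) / e\<rfloor>) [0..<N]) [0..<N]"
    for E
  have close: "grass_dist N m E F \<le> r"
    if E: "E \<in> grassmannian N m" "F \<in> grassmannian N m" and "key E = key F" for E F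
  proof (rule grass_dist_le[OF E])
    fix x assume x: "x \<in> eucl N"
    have le: "eucl_norm N (orth_proj N E (unit_vec i) - orth_proj N F (unit_vec i)) \<le> real N * e" if i: "i < N" for i
    proof -
      have "\<bar>(orth_proj N E (unit_vec i) - orth_proj N F (unit_vec i)) j\<bar> \<le> e" if j: "j \<in> {1..N}" for j
      proof -
        have j': "j - 1 < N" "Suc (j - 1) = j" using j by auto
        have "key E ! i ! (j - 1) = key F ! i ! (j - 1)"
          using \<open>key E = key F\<close> by simp
        then have "\<lfloor>orth_proj N E (unit_vec i) j / e\<rfloor> = \<lfloor>orth_proj N F (unit_vec i) j / e\<rfloor>"
          using i j'(1) unfolding key_def by (simp add: j'(2))
        then have "\<bar>orth_proj N E (unit_vec i) j / e - orth_proj N F (unit_vec i) j / e\<bar> \<le> 1"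
          by linarith
        then show ?thesis
          using e(1) by (simp flip: diff_divide_distrib add: abs_divide)
      qed
      then have "(\<Sum>j=1..N. \<bar>(orth_proj N E (unit_vec i) - orth_proj N F (unit_vec i)) j\<bar>) \<le> (\<Sum>j=1..N. e)"
        by (rule sum_mono)
      then show ?thesis
        using eucl_norm_le_sum[of "orth_proj N E (unit_vec i) - orth_proj N F (unit_vec i)" N] by simp
    qed
    have "eucl_norm N (orth_proj N E x - orth_proj N F x) \<le> real N * (real N * e) * eucl_norm N x"
      by (rule eucl_norm_le_frame_expansion[OF E x le])
    also have "\<dots> \<le> r * eucl_norm N x"
      using e2 by (intro mult_right_mono eucl_norm_nonneg) auto
    finally show "eucl_norm N (orth_proj N E x - orth_proj N F x) \<le> r * eucl_norm N x" .
  qed (use r in auto)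
  define ball where "ball F = {E \<in> space \<mu>. grass_dist N m E F \<le> r}" for F
  have ball: "ball F \<in> null_sets \<mu>" if "F \<in> grassmannian N m" for F
  proof
    show "emeasure \<mu> (ball F) = 0" unfolding ball_def using that by (rule null)
    show "ball F \<in> sets \<mu>"
      unfolding ball_def using grass_dist_measurable[OF \<mu> that] by measurable
  qed
  define rep where "rep c = (SOME F. F \<in> grassmannian N m \<and> key F = c)" for c
  have rep: "rep (key E) \<in> grassmannian N m \<and> key (rep (key E)) = key E" if "E \<in> grassmannian N m" for E
    unfolding rep_def by (rule someI[of _ E]) (use that in simp)
  have "space \<mu> \<subseteq> (\<Union>c\<in>key ` grassmannian N m. ball (rep c))"
  proof
    fix E assume "E \<in> space \<mu>"
    then have E: "E \<in> grassmannian N m" by (simp add: \<mu>)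
    then have "E \<in> ball (rep (key E))"
      using rep[OF E] close[OF E, of "rep (key E)"] by (simp add: ball_def \<mu>)
    then show "E \<in> (\<Union>c\<in>key ` grassmannian N m. ball (rep c))" using E by blast
  qed
  moreover have "(\<Union>c\<in>key ` grassmannian N m. ball (rep c)) \<in> null_sets \<mu>"
    by (rule null_sets_UN') (auto intro: ball rep[THEN conjunct1])
  ultimately have "emeasure \<mu> (space \<mu>) = 0"
    using null_sets_subset[of _ \<mu> "space \<mu>"] sets.top by (meson null_setsD1)
  then show False by (simp add: emeasure_space_1)
qed

lemma gauss_ker_grassmannian: "full_rank N n G \<Longrightarrow> gauss_ker N n G \<in> grassmannian N (N - n)"
  by (intro frame_ker_orthonormal orthonormal_gram_schmidt)

text \<open>The incidence relation between subspaces and matrices that is integrated in both orders.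
  It is invariant under simultaneous reflection of the subspace and of the rows.\<close>

definition near_ker :: "nat \<Rightarrow> nat \<Rightarrow> real \<Rightarrow> ((nat \<Rightarrow> real) set \<times> (nat \<Rightarrow> nat \<Rightarrow> real)) set"
  where "near_ker N n r = {(E, G). full_rank N n G \<and> grass_dist N (N - n) E (gauss_ker N n G) \<le> r}"

lemma near_ker_measurable:
  assumes \<mu>: "space \<mu> = grassmannian N (N - n)" "sets \<mu> = sets (grass_borel N (N - n))" and r: "0 \<le> r"
  shows "{z \<in> space (\<mu> \<Otimes>\<^sub>M gauss_mat n N). z \<in> near_ker N n r} \<in> sets (\<mu> \<Otimes>\<^sub>M gauss_mat n N)"
proof -
  let ?M = "\<mu> \<Otimes>\<^sub>M gauss_mat n N" and ?Q = "{x \<in> eucl N. \<forall>i. x i \<in> \<rat>}"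
  define D where "D x z = orth_proj N (fst z) x - (x - frame_proj N n (gram_schmidt N (snd z)) x)"
    for x and z :: "(nat \<Rightarrow> real) set \<times> (nat \<Rightarrow> nat \<Rightarrow> real)"
  \<comment> \<open>For full rank the projection to the kernel is x minus its projection to the
    orthonormalized rows, which is explicit and measurable in \<open>G\<close>; the distance
    condition becomes a countable intersection over rational x.\<close>
  have eq: "{z \<in> space ?M. z \<in> near_ker N n r} = {z \<in> space ?M. full_rank N n (snd z)} \<inter>
      {z \<in> space ?M. \<forall>x\<in>?Q. eucl_norm N (D x z) \<le> r * eucl_norm N x}"
  proof -
    have "(E, G) \<in> near_ker N n r \<longleftrightarrow> full_rank N n G \<and> (\<forall>x\<in>?Q. eucl_norm N (D x (E, G)) \<le> r * eucl_norm N x)"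
      if "E \<in> grassmannian N (N - n)" for E G
    proof (cases "full_rank N n G")
      case True
      have "orth_proj N (gauss_ker N n G) x = x - frame_proj N n (gram_schmidt N G) x" if "x \<in> ?Q" for x
        using True that by (intro frame_ker_orthonormal orthonormal_gram_schmidt) auto
      then show ?thesis
        using grass_dist_le_iff_rational[OF that gauss_ker_grassmannian[OF True] r] True
        by (auto simp: near_ker_def D_def)
    qed (simp add: near_ker_def)
    then show ?thesis
      by (auto simp: space_pair_measure \<mu>)
  qed
  have "(\<lambda>z. D x z l) \<in> borel_measurable ?M" if x: "x \<in> ?Q" and l: "l \<in> {1..N}" for x l
  proof -
    have "(\<lambda>G. frame_proj N n (gram_schmidt N G) x l) \<in> borel_measurable (gauss_mat n N)"
      using l by (intro borel_measurable_frame_proj borel_measurable_gram_schmidt borel_measurable_const)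
    from measurable_compose[OF measurable_snd this]
    have "(\<lambda>z. frame_proj N n (gram_schmidt N (snd z)) x l) \<in> borel_measurable ?M" .
    moreover have "(\<lambda>z. orth_proj N (fst z) x l) \<in> borel_measurable ?M"
      using x by (intro measurable_compose[OF measurable_fst] orth_proj_entry_measurable[OF \<mu> _ l]) auto
    ultimately show ?thesis
      unfolding D_def fun_diff_def by (intro borel_measurable_diff borel_measurable_const)
  qed
  then have "(\<lambda>z. eucl_norm N (D x z)) \<in> borel_measurable ?M" if "x \<in> ?Q" for x
    using that by (intro borel_measurable_eucl_norm)
  then have "{z \<in> space ?M. eucl_norm N (D x z) \<le> r * eucl_norm N x} \<in> sets ?M" if "x \<in> ?Q" for x
    using that by (intro borel_measurable_le borel_measurable_const)
  then have "{z \<in> space ?M. \<forall>x\<in>?Q. eucl_norm N (D x z) \<le> r * eucl_norm N x} \<in> sets ?M"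
  proof -
    assume *: "\<And>x. x \<in> ?Q \<Longrightarrow> {z \<in> space ?M. eucl_norm N (D x z) \<le> r * eucl_norm N x} \<in> sets ?M"
    have "0 \<in> ?Q" by simp
    then have Q: "?Q \<noteq> {}" by blast
    then have eq: "{z \<in> space ?M. \<forall>x\<in>?Q. eucl_norm N (D x z) \<le> r * eucl_norm N x}
        = (\<Inter>x\<in>?Q. {z \<in> space ?M. eucl_norm N (D x z) \<le> r * eucl_norm N x})"
      by blast
    show ?thesis
      unfolding eq by (rule sets.countable_INT'[OF countable_rational_eucl Q]) (use * in blast)
  qed
  moreover have "{z \<in> space ?M. full_rank N n (snd z)} \<in> sets ?M"
  proof -
    have "snd \<in> ?M \<rightarrow>\<^sub>M gauss_mat n N" by (rule measurable_snd)
    from measurable_sets[OF this sets_full_rank]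
    have "snd -` {G \<in> space (gauss_mat n N). full_rank N n G} \<inter> space ?M \<in> sets ?M" .
    also have "snd -` {G \<in> space (gauss_mat n N). full_rank N n G} \<inter> space ?M
        = {z \<in> space ?M. full_rank N n (snd z)}"
      by (auto simp: space_pair_measure)
    finally show ?thesis .
  qed
  ultimately show ?thesis unfolding eq by (intro sets.Int)
qed

section \<open>Haar measure and Gaussian kernels\<close>

lemma gauss_ker_reflect_rows:
  assumes a: "a \<in> eucl N" "eucl_inner N a a = 1"
  shows "full_rank N n (reflect_rows n N a G) \<longleftrightarrow> full_rank N n G"
    and "gauss_ker N n (reflect_rows n N a G) = reflection N a ` gauss_ker N n G"
proof -
  have gs: "gram_schmidt N (reflect_rows n N a G) i = reflection N a (gram_schmidt N G i)"
    "residual N (reflect_rows n N a G) i = reflection N a (residual N G i)" if "i < n" for i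
    using that by (intro gram_schmidt_reflection[where n = n] trunc_reflect_rows a; simp)+
  have "reflection N a x = 0 \<longleftrightarrow> x = 0" for x
    using reflection_reflection[OF a(2), of x] reflection_diff[of N a 0 0]
    by (metis diff_self)
  then show "full_rank N n (reflect_rows n N a G) \<longleftrightarrow> full_rank N n G"
    by (simp add: full_rank_def gs)
  have "gauss_ker N n (reflect_rows n N a G) = frame_ker N n (\<lambda>i. reflection N a (gram_schmidt N G i))"
    by (simp add: frame_ker_def gs)
  then show "gauss_ker N n (reflect_rows n N a G) = reflection N a ` gauss_ker N n G"
    by (simp add: frame_ker_reflection a)
qed

lemma near_ker_reflection:
  assumes E: "E \<in> grassmannian N (N - n)" and a: "a \<in> eucl N" "eucl_inner N a a = 1"
  shows "(reflection N a ` E, reflect_rows n N a G) \<in> near_ker N n r \<longleftrightarrow> (E, G) \<in> near_ker N n r"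
proof (cases "full_rank N n G")
  case True
  then show ?thesis
    using grass_dist_reflection[OF E gauss_ker_grassmannian[OF True] a]
    by (simp add: near_ker_def gauss_ker_reflect_rows[OF a])
qed (simp add: near_ker_def gauss_ker_reflect_rows[OF a])

lemma grass_ball_reflection:
  assumes F: "F \<in> grassmannian N m" and a: "a \<in> eucl N" "eucl_inner N a a = 1"
  shows "{E \<in> grassmannian N m. grass_dist N m E (reflection N a ` F) \<le> r}
    = (\<lambda>E. reflection N a ` E) ` {E \<in> grassmannian N m. grass_dist N m E F \<le> r}"
proof (intro equalityI subsetI)
  fix E assume E: "E \<in> {E \<in> grassmannian N m. grass_dist N m E (reflection N a ` F) \<le> r}"
  have "reflection N a ` E \<in> grassmannian N m"
    using E a by (auto intro: reflection_grassmannian)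
  moreover have "grass_dist N m (reflection N a ` E) F \<le> r"
    using grass_dist_reflection[of E N m "reflection N a ` F" a] reflection_grassmannian[OF F a] E a
    by (simp add: reflection_image_image)
  moreover have "E = reflection N a ` reflection N a ` E"
    using a by (simp add: reflection_image_image)
  ultimately show "E \<in> (\<lambda>E. reflection N a ` E) ` {E \<in> grassmannian N m. grass_dist N m E F \<le> r}"
    by blast
next
  fix E assume "E \<in> (\<lambda>E. reflection N a ` E) ` {E \<in> grassmannian N m. grass_dist N m E F \<le> r}"
  then show "E \<in> {E \<in> grassmannian N m. grass_dist N m E (reflection N a ` F) \<le> r}"
    using grass_dist_reflection[OF _ F a] reflection_grassmannian[OF _ a] by auto
qed

text \<open>Both \<open>h\<close> and \<open>g\<close> below are constant by invariance and hence equal by Fubini.\<close>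

lemma haar_le_gauss_interior:
  assumes haar: "is_haar_grassmannian N (N - n) \<mu>" and nN: "n \<le> N" and r: "0 < r"
    and A: "A \<in> sets \<mu>" and S: "S \<in> sets (gauss_mat n N)"
    and sub: "\<And>E G. E \<in> A \<Longrightarrow> G \<in> space (gauss_mat n N) \<Longrightarrow> full_rank N n G \<Longrightarrow>
      grass_dist N (N - n) E (gauss_ker N n G) \<le> r \<Longrightarrow> G \<in> S"
  shows "emeasure \<mu> A \<le> emeasure (gauss_mat n N) S"
proof -
  let ?P = "gauss_mat n N" and ?m = "N - n"
  have \<mu>: "prob_space \<mu>" "space \<mu> = grassmannian N ?m" "sets \<mu> = sets (grass_borel N ?m)"
    and inv: "\<And>U A. U \<in> orthogonal_maps N \<Longrightarrow> A \<in> sets \<mu> \<Longrightarrow> emeasure \<mu> ((\<lambda>E. U ` E) ` A) = emeasure \<mu> A"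
    using haar by (auto simp: is_haar_grassmannian_def)
  interpret \<mu>: prob_space \<mu> by fact
  interpret pair: pair_sigma_finite \<mu> ?P
    by (intro pair_sigma_finite.intro \<mu>.sigma_finite_measure gauss_mat.sigma_finite_measure)
  let ?I = "indicator (near_ker N n r) :: _ \<Rightarrow> ennreal"
  have near: "{z \<in> space (\<mu> \<Otimes>\<^sub>M ?P). z \<in> near_ker N n r} \<in> sets (\<mu> \<Otimes>\<^sub>M ?P)"
    using r by (intro near_ker_measurable \<mu>) auto
  then have I: "?I \<in> borel_measurable (\<mu> \<Otimes>\<^sub>M ?P)"
    by (simp add: borel_measurable_indicator_iff Int_def conj_commute)
  define h where "h E = (\<integral>\<^sup>+G. ?I (E, G) \<partial>?P)" for E
  define g where "g F = emeasure \<mu> {E \<in> space \<mu>. grass_dist N ?m E F \<le> r}" for F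
  \<comment> \<open>The constant value of \<open>g\<close> is nonzero by this choice and finite, so
    it can be cancelled in the final inequality.\<close>
  obtain F0 where F0: "F0 \<in> grassmannian N ?m" "g F0 \<noteq> 0"
    using grass_small_ball_pos[OF \<mu> r] by (auto simp: g_def)
  have g_const: "g F = g F0" if "F \<in> grassmannian N ?m" for F
  proof (rule grassmannian_reflection_induct[OF F0(1) that, where Q = "\<lambda>F. g F = g F0"])
    fix F a assume F: "F \<in> grassmannian N ?m" and a: "a \<in> eucl N" "eucl_inner N a a = 1" and "g F = g F0"
    have "{E \<in> space \<mu>. grass_dist N ?m E F \<le> r} \<in> sets \<mu>"
      by (intro borel_measurable_le grass_dist_measurable[OF \<mu>(2,3) F] borel_measurable_const)
    from inv[OF reflection_orthogonal_maps[OF a] this] show "g (reflection N a ` F) = g F0"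
      unfolding g_def \<mu>(2) grass_ball_reflection[OF F a] using \<open>g F = g F0\<close> by (simp add: g_def \<mu>(2))
  qed simp
  have section_meas: "(\<lambda>G. ?I (E, G)) \<in> borel_measurable ?P" if "E \<in> space \<mu>" for E
    using I that by (rule measurable_Pair2)
  have h_const: "h E = h F0" if "E \<in> grassmannian N ?m" for E
  proof (rule grassmannian_reflection_induct[OF F0(1) that, where Q = "\<lambda>E. h E = h F0"])
    fix E a assume E: "E \<in> grassmannian N ?m" and a: "a \<in> eucl N" "eucl_inner N a a = 1" and "h E = h F0"
    have E': "reflection N a ` E \<in> space \<mu>"
      unfolding \<mu>(2) by (rule reflection_grassmannian[OF E a])
    have "h (reflection N a ` E) = (\<integral>\<^sup>+G. ?I (reflection N a ` E, G) \<partial>distr ?P ?P (reflect_rows n N a))"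
      unfolding h_def distr_reflect_rows(1)[OF a(2)] ..
    also have "\<dots> = (\<integral>\<^sup>+G. ?I (reflection N a ` E, reflect_rows n N a G) \<partial>?P)"
      by (rule nn_integral_distr[OF distr_reflect_rows(2)[OF a(2)]]) (use section_meas[OF E'] in simp)
    also have "\<dots> = h E"
      unfolding h_def by (simp add: indicator_def near_ker_reflection[OF E a])
    finally show "h (reflection N a ` E) = h F0" using \<open>h E = h F0\<close> by simp
  qed simp
  have inner: "(\<integral>\<^sup>+E. ?I (E, G) \<partial>\<mu>) = g F0" if "full_rank N n G" for G
  proof -
    have K: "gauss_ker N n G \<in> grassmannian N ?m" using that by (rule gauss_ker_grassmannian)
    have "(\<integral>\<^sup>+E. ?I (E, G) \<partial>\<mu>) = (\<integral>\<^sup>+E. indicator {E \<in> space \<mu>. grass_dist N ?m E (gauss_ker N n G) \<le> r} E \<partial>\<mu>)"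
      using that by (intro nn_integral_cong) (auto simp: indicator_def near_ker_def)
    also have "\<dots> = g (gauss_ker N n G)"
      unfolding g_def
      by (intro nn_integral_indicator borel_measurable_le grass_dist_measurable[OF \<mu>(2,3) K] borel_measurable_const)
    also have "\<dots> = g F0" using K by (rule g_const)
    finally show ?thesis .
  qed
  have fubini: "(\<integral>\<^sup>+G. (\<integral>\<^sup>+E. indicator C E * ?I (E, G) \<partial>\<mu>) \<partial>?P) = h F0 * emeasure \<mu> C" if C: "C \<in> sets \<mu>" for C
  proof -
    have "(\<lambda>z. indicator C (fst z)) \<in> borel_measurable (\<mu> \<Otimes>\<^sub>M ?P)"
      by (rule measurable_compose[OF measurable_fst]) (use C in simp)
    then have "(\<lambda>z. indicator C (fst z) * ?I z) \<in> borel_measurable (\<mu> \<Otimes>\<^sub>M ?P)"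
      using I by (intro borel_measurable_times_ennreal)
    then have "(\<lambda>(E, G). indicator C E * ?I (E, G)) \<in> borel_measurable (\<mu> \<Otimes>\<^sub>M ?P)"
      by (simp add: case_prod_beta')
    from pair.Fubini'[OF this]
    have "(\<integral>\<^sup>+G. (\<integral>\<^sup>+E. indicator C E * ?I (E, G) \<partial>\<mu>) \<partial>?P) = (\<integral>\<^sup>+E. (\<integral>\<^sup>+G. indicator C E * ?I (E, G) \<partial>?P) \<partial>\<mu>)" .
    also have "\<dots> = (\<integral>\<^sup>+E. h F0 * indicator C E \<partial>\<mu>)"
    proof (rule nn_integral_cong)
      fix E assume E: "E \<in> space \<mu>"
      have "(\<integral>\<^sup>+G. indicator C E * ?I (E, G) \<partial>?P) = indicator C E * h E"
        unfolding h_def by (rule nn_integral_cmult[OF section_meas[OF E]])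
      then show "(\<integral>\<^sup>+G. indicator C E * ?I (E, G) \<partial>?P) = h F0 * indicator C E"
        using h_const[of E] E by (simp add: \<mu>(2) mult.commute)
    qed
    also have "\<dots> = h F0 * emeasure \<mu> C"
      using C by (rule nn_integral_cmult_indicator)
    finally show ?thesis .
  qed
  \<comment> \<open>Taking the whole Grassmannian for \<open>C\<close> identifies the two constants,
    since almost every \<open>G\<close> has full rank.\<close>
  have "h F0 = (\<integral>\<^sup>+G. (\<integral>\<^sup>+E. indicator (space \<mu>) E * ?I (E, G) \<partial>\<mu>) \<partial>?P)"
    using fubini[OF sets.top] by (simp add: \<mu>.emeasure_space_1)
  also have "\<dots> = (\<integral>\<^sup>+G. g F0 \<partial>?P)"
  proof (rule nn_integral_cong_AE)
    show "AE G in ?P. (\<integral>\<^sup>+E. indicator (space \<mu>) E * ?I (E, G) \<partial>\<mu>) = g F0"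
      using AE_full_rank[OF nN]
    proof eventually_elim
      fix G assume "full_rank N n G"
      then show "(\<integral>\<^sup>+E. indicator (space \<mu>) E * ?I (E, G) \<partial>\<mu>) = g F0"
        using inner by (simp cong: nn_integral_cong)
    qed
  qed
  finally have hg: "h F0 = g F0"
    by (simp add: gauss_mat.emeasure_space_1)
  \<comment> \<open>Now \<open>A\<close> is taken for \<open>C\<close>. By \<open>sub\<close>, a
    subspace in \<open>A\<close> can be near the kernel of a full-rank \<open>G\<close> only if
    \<open>G\<close> lies in \<open>S\<close>; so the inner integral is at most \<open>g F0\<close>
    on \<open>S\<close> and vanishes elsewhere.\<close>
  have "g F0 * emeasure \<mu> A = (\<integral>\<^sup>+G. (\<integral>\<^sup>+E. indicator A E * ?I (E, G) \<partial>\<mu>) \<partial>?P)"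
    using fubini[OF A] by (simp add: hg)
  also have "\<dots> \<le> (\<integral>\<^sup>+G. g F0 * indicator S G \<partial>?P)"
  proof (rule nn_integral_mono)
    fix G assume G: "G \<in> space ?P"
    show "(\<integral>\<^sup>+E. indicator A E * ?I (E, G) \<partial>\<mu>) \<le> g F0 * indicator S G"
    proof (cases "full_rank N n G \<and> G \<in> S")
      case True
      have "(\<integral>\<^sup>+E. indicator A E * ?I (E, G) \<partial>\<mu>) \<le> (\<integral>\<^sup>+E. ?I (E, G) \<partial>\<mu>)"
        by (intro nn_integral_mono) (auto simp: indicator_def)
      then show ?thesis using True inner by simp
    next
      case False
      then have "indicator A E * ?I (E, G) = 0" for E
        using sub[OF _ G, of E] by (auto simp: indicator_def near_ker_def)
      then have "(\<integral>\<^sup>+E. indicator A E * ?I (E, G) \<partial>\<mu>) = (\<integral>\<^sup>+E. 0 \<partial>\<mu>)"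
        by (intro nn_integral_cong)
      then show ?thesis by simp
    qed
  qed
  also have "\<dots> = g F0 * emeasure ?P S"
    using S by (rule nn_integral_cmult_indicator)
  finally have "g F0 * emeasure \<mu> A \<le> g F0 * emeasure ?P S" .
  moreover have "g F0 \<noteq> \<top>"
    unfolding g_def by (rule \<mu>.emeasure_finite)
  ultimately show ?thesis
    using F0(2) by (simp add: ennreal_mult_le_mult_iff)
qed

text \<open>The preceding comparison has a margin \<open>r\<close> between the subspace and the
  kernel. It is applied to the sets \<open>A k\<close> of subspaces that keep a positive distance
  from the complement of \<open>B\<close>; for open \<open>B\<close> they increase to
  \<open>B\<close>, and measures are continuous from below.\<close>

lemma haar_le_gauss:
  assumes haar: "is_haar_grassmannian N (N - n) \<mu>" and nN: "n \<le> N"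
    and B: "openin (grass.mtopology N (N - n)) B" and S: "S \<in> sets (gauss_mat n N)"
    and sub: "\<And>G. G \<in> space (gauss_mat n N) \<Longrightarrow> full_rank N n G \<Longrightarrow> gauss_ker N n G \<in> B \<Longrightarrow> G \<in> S"
  shows "emeasure \<mu> B \<le> emeasure (gauss_mat n N) S"
proof -
  let ?m = "N - n" and ?d = "grass_dist N (N - n)" and ?Gr = "grassmannian N (N - n)"
  have \<mu>: "prob_space \<mu>" "space \<mu> = ?Gr" "sets \<mu> = sets (grass_borel N ?m)"
    using haar by (auto simp: is_haar_grassmannian_def)
  have open_sets: "U \<in> sets \<mu>" if "openin (grass.mtopology N ?m) U" for U
    using that unfolding \<mu> by (auto simp: grass_borel_def sets_measure_of_conv grass.openin_mtopology)
  have B': "B \<subseteq> ?Gr" using B by (simp add: grass.openin_mtopology)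
  \<comment> \<open>The ball in \<open>A k\<close> is open while nearness is a non-strict
    inequality, hence the radius 2 / (k + 1) against the margin 1 / (k + 1). The complement of
    \<open>A k\<close> is open, so \<open>A k\<close> is measurable.\<close>
  define A where "A k = {E \<in> ?Gr. \<forall>F\<in>?Gr. ?d E F < 2 / real (Suc k) \<longrightarrow> F \<in> B}" for k
  have A_sets: "A k \<in> sets \<mu>" for k
  proof -
    have "openin (grass.mtopology N ?m) (?Gr - A k)"
      unfolding grass.openin_mtopology
    proof (intro conjI allI impI)
      fix E assume "E \<in> ?Gr - A k"
      then obtain F where E: "E \<in> ?Gr" and F: "F \<in> ?Gr" "?d E F < 2 / real (Suc k)" "F \<notin> B"
        by (auto simp: A_def)
      have "grass.mball N ?m E (2 / real (Suc k) - ?d E F) \<subseteq> ?Gr - A k"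
      proof
        fix E' assume "E' \<in> grass.mball N ?m E (2 / real (Suc k) - ?d E F)"
        then have E': "E' \<in> ?Gr" "?d E E' < 2 / real (Suc k) - ?d E F" by (auto simp: grass.in_mball)
        have "?d E' F < 2 / real (Suc k)"
          using grass.triangle[OF E'(1) E F(1)] E'(2) by (simp add: grass_dist_commute[of N ?m E' E])
        then show "E' \<in> ?Gr - A k" using E' F by (auto simp: A_def)
      qed
      then show "\<exists>r>0. grass.mball N ?m E r \<subseteq> ?Gr - A k"
        using F(2) by (intro exI[of _ "2 / real (Suc k) - ?d E F"]) auto
    qed auto
    from sets.Diff[OF sets.top open_sets[OF this]]
    have "space \<mu> - (?Gr - A k) \<in> sets \<mu>" .
    moreover have "space \<mu> - (?Gr - A k) = A k" by (auto simp: \<mu> A_def)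
    ultimately show ?thesis by simp
  qed
  have "emeasure \<mu> (A k) \<le> emeasure (gauss_mat n N) S" for k
  proof (rule haar_le_gauss_interior[OF haar nN _ A_sets S, of "1 / real (Suc k)"])
    fix E G assume E: "E \<in> A k" and G: "G \<in> space (gauss_mat n N)" "full_rank N n G"
      and d: "?d E (gauss_ker N n G) \<le> 1 / real (Suc k)"
    have "?d E (gauss_ker N n G) < 2 / real (Suc k)"
      by (rule le_less_trans[OF d]) (simp add: divide_strict_right_mono)
    then have "gauss_ker N n G \<in> B"
      using E gauss_ker_grassmannian[OF G(2)] by (auto simp: A_def)
    with G show "G \<in> S" by (rule sub)
  qed simp
  then have "(SUP k. emeasure \<mu> (A k)) \<le> emeasure (gauss_mat n N) S"
    by (intro SUP_least)
  moreover have "(SUP k. emeasure \<mu> (A k)) = emeasure \<mu> (\<Union>k. A k)"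
  proof (rule SUP_emeasure_incseq)
    show "range A \<subseteq> sets \<mu>" using A_sets by auto
    have "2 / real (Suc l) \<le> 2 / real (Suc k)" if "k \<le> l" for k l
      using that by (intro divide_left_mono) auto
    then show "incseq A"
      unfolding incseq_def A_def by (blast intro: less_le_trans)
  qed
  moreover have "(\<Union>k. A k) = B"
  proof (intro equalityI subsetI)
    fix E assume "E \<in> (\<Union>k. A k)"
    then obtain k where k: "E \<in> A k" by blast
    then have "E \<in> ?Gr" by (simp add: A_def)
    moreover from this have "?d E E < 2 / real (Suc k)" by simp
    ultimately show "E \<in> B" using k unfolding A_def by blast
  next
    fix E assume E: "E \<in> B"
    then obtain r where r: "0 < r" "grass.mball N ?m E r \<subseteq> B"
      using B by (auto simp: grass.openin_mtopology)
    obtain k where "2 / r < real k"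
      using reals_Archimedean2 by blast
    then have "2 / r < real (Suc k)" by simp
    then have k: "2 / real (Suc k) < r"
      using r(1) by (simp add: field_simps)
    have "F \<in> B" if "F \<in> ?Gr" "?d E F < 2 / real (Suc k)" for F
    proof -
      have "F \<in> grass.mball N ?m E r"
        using that k E B' by (auto simp: grass.in_mball)
      then show ?thesis using r(2) by blast
    qed
    then have "E \<in> A k" using E B' by (auto simp: A_def)
    then show "E \<in> (\<Union>k. A k)" by blast
  qed
  ultimately show ?thesis
    by simp
qed

section \<open>Nets and sublinear functions\<close>

text \<open>What rounding a vector of norm 5 sqrt n can produce. By Cauchy-Schwarz such a vector has
  coordinate sum at most 5 n in absolute values, and rounding adds at most n / 2; the norm drops by
  at most sqrt n / 2. The box makes the set finite.\<close>

definition lattice_net :: "nat \<Rightarrow> (nat \<Rightarrow> int) set"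
  where "lattice_net n = {k \<in> PiE {..<n} (\<lambda>_. {- int (6 * n)..int (6 * n)}).
    (\<Sum>i<n. \<bar>real_of_int (k i)\<bar>) \<le> 11 / 2 * n \<and>
    9 / 2 * sqrt n \<le> L2_set (\<lambda>i. real_of_int (k i)) {..<n}}"

definition sign_vectors :: "nat \<Rightarrow> (nat \<Rightarrow> real) set"
  where "sign_vectors n = PiE {..<n} (\<lambda>_. {- 1, 1})"

lemma finite_lattice_net: "finite (lattice_net n)"
  unfolding lattice_net_def by (rule finite_subset[OF _ finite_PiE[of "{..<n}" "\<lambda>_. {- int (6 * n)..int (6 * n)}"]]) auto

lemma finite_sign_vectors: "finite (sign_vectors n)"
  unfolding sign_vectors_def by (intro finite_PiE) auto

lemma card_sign_vectors: "card (sign_vectors n) = 2 ^ n"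
  by (simp add: sign_vectors_def card_PiE numeral_2_eq_2)

text \<open>A two-sided geometric sum of ratio w = exp (-1/5), bounded by counting 0 twice. The
  quadratic Taylor bound of exp at 1/5 gives w <= 50/61, and the one at 1/2 gives exp (1/2) >=
  13/8.\<close>

lemma sum_exp_abs_int_le:
  "(\<Sum>z\<in>{- int L..int L}. exp ((11 / 2 - \<bar>real_of_int z\<bar>) / 5)) \<le> exp (18 / 5)"
proof -
  define w :: real where "w = exp (- 1 / 5)"
  have "1 + 1 / 5 + (1 / 5)\<^sup>2 / 2 \<le> exp (1 / 5 :: real)"
    by (rule exp_lower_Taylor_quadratic) simp
  then have "61 / 50 \<le> 1 / w"
    by (simp add: w_def exp_minus field_simps power2_eq_square)
  then have w: "0 < w" "w \<le> 50 / 61"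
    by (simp_all add: w_def field_simps)
  have exp_eq: "exp ((11 / 2 - \<bar>real_of_int z\<bar>) / 5) = exp (11 / 10) * w ^ nat \<bar>z\<bar>" for z
    by (simp add: w_def exp_of_nat_mult[symmetric] exp_add[symmetric] field_simps)
  have geom: "(\<Sum>j\<le>L. w ^ j) \<le> 1 / (1 - w)"
    using sum_le_suminf[of "\<lambda>j. w ^ j" "{..L}"] w suminf_geometric[of w] summable_geometric[of w] by simp
  have "(\<Sum>z\<in>{- int L..int L}. w ^ nat \<bar>z\<bar>)
      \<le> (\<Sum>z\<in>int ` {..L} \<union> (\<lambda>j. - int j) ` {..L}. w ^ nat \<bar>z\<bar>)"
  proof (rule sum_mono2)
    show "{- int L..int L} \<subseteq> int ` {..L} \<union> (\<lambda>j. - int j) ` {..L}"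
    proof
      fix z assume z: "z \<in> {- int L..int L}"
      show "z \<in> int ` {..L} \<union> (\<lambda>j. - int j) ` {..L}"
      proof (cases "0 \<le> z")
        case True
        then have "z = int (nat z)" "nat z \<in> {..L}" using z by auto
        then show ?thesis by blast
      next
        case False
        then have "z = - int (nat (- z))" "nat (- z) \<in> {..L}" using z by auto
        then show ?thesis by blast
      qed
    qed
  qed (use w in auto)
  also have "\<dots> \<le> (\<Sum>z\<in>int ` {..L}. w ^ nat \<bar>z\<bar>) + (\<Sum>z\<in>(\<lambda>j. - int j) ` {..L}. w ^ nat \<bar>z\<bar>)"
    using w by (subst sum.union_inter[symmetric]) (auto intro!: sum_nonneg)
  also have "\<dots> = 2 * (\<Sum>j\<le>L. w ^ j)"
    by (simp add: sum.reindex inj_on_def)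
  also have "\<dots> \<le> 2 * (1 / (1 - w))"
    using geom by simp
  also have "\<dots> \<le> 2 * (1 / (1 - 50 / 61))"
    using w by (intro mult_left_mono divide_left_mono) auto
  \<comment> \<open>The left-hand side is 122/11. The target exp (5/2) is what remains of exp (18/5)
    after the factor exp (11/10) has been split off.\<close>
  also have "\<dots> \<le> (13 / 8) ^ 5" by (simp add: power_divide)
  also have "\<dots> \<le> exp (1 / 2) ^ 5"
    using exp_lower_Taylor_quadratic[of "1 / 2"] by (intro power_mono) (auto simp: power2_eq_square)
  also have "\<dots> = exp (5 / 2 :: real)"
    by (simp flip: exp_of_nat_mult)
  finally have "(\<Sum>z\<in>{- int L..int L}. w ^ nat \<bar>z\<bar>) \<le> exp (5 / 2)" .
  then have "exp (11 / 10) * (\<Sum>z\<in>{- int L..int L}. w ^ nat \<bar>z\<bar>) \<le> exp (11 / 10) * exp (5 / 2)"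
    by (intro mult_left_mono) auto
  then show ?thesis
    by (simp add: exp_eq sum_distrib_left flip: exp_add)
qed

text \<open>Exponential weights: every lattice point contributes at least \<open>1\<close> to a sum which factorizes.\<close>

lemma card_lattice_net: "real (card (lattice_net n)) \<le> exp (18 / 5 * n)"
proof -
  let ?B = "{- int (6 * n)..int (6 * n)}"
  have "real (card (lattice_net n)) = (\<Sum>k\<in>lattice_net n. 1)" by simp
  also have "\<dots> \<le> (\<Sum>k\<in>lattice_net n. \<Prod>i<n. exp ((11 / 2 - \<bar>real_of_int (k i)\<bar>) / 5))"
  proof (rule sum_mono)
    fix k assume "k \<in> lattice_net n"
    then have "0 \<le> (\<Sum>i<n. (11 / 2 - \<bar>real_of_int (k i)\<bar>) / 5)"
      by (simp add: lattice_net_def sum_divide_distrib[symmetric] sum_subtractf)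
    then show "1 \<le> (\<Prod>i<n. exp ((11 / 2 - \<bar>real_of_int (k i)\<bar>) / 5))"
      by (simp flip: exp_sum)
  qed
  also have "\<dots> \<le> (\<Sum>k\<in>PiE {..<n} (\<lambda>_. ?B). \<Prod>i<n. exp ((11 / 2 - \<bar>real_of_int (k i)\<bar>) / 5))"
  proof (rule sum_mono2)
    show "finite (PiE {..<n} (\<lambda>_. ?B))" by (intro finite_PiE) auto
    show "lattice_net n \<subseteq> PiE {..<n} (\<lambda>_. ?B)" unfolding lattice_net_def by (rule Collect_restrict)
    show "0 \<le> (\<Prod>i<n. exp ((11 / 2 - \<bar>real_of_int (k i)\<bar>) / 5))" for k by (intro prod_nonneg) simp
  qed
  also have "\<dots> = (\<Prod>i<n. \<Sum>z\<in>?B. exp ((11 / 2 - \<bar>real_of_int z\<bar>) / 5))"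
    by (rule prod_sum_PiE[symmetric]) auto
  also have "\<dots> \<le> (\<Prod>i<n. exp (18 / 5))"
    using sum_exp_abs_int_le[of "6 * n"] by (intro prod_mono conjI sum_nonneg) auto
  also have "\<dots> = exp (18 / 5 * n)"
    by (simp add: exp_of_nat_mult[symmetric] mult.commute)
  finally show ?thesis .
qed

text \<open>A sublinear function is convex, and a convex function on a cube is bounded by its values
  at the vertices. The induction is on the number of leading coordinates that may differ from 1 and
  -1. The hypothesis \<open>supp\<close> is there because sign vectors are \<open>undefined\<close>
  beyond \<open>n\<close>.\<close>

lemma convex_le_of_sign_vectors:
  fixes F :: "(nat \<Rightarrow> real) \<Rightarrow> real"
  assumes add: "\<And>u v. F (\<lambda>i. u i + v i) \<le> F u + F v"
    and scale: "\<And>c u. 0 \<le> c \<Longrightarrow> F (\<lambda>i. c * u i) = c * F u"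
    and supp: "\<And>u v. (\<And>i. i < n \<Longrightarrow> u i = v i) \<Longrightarrow> F u = F v"
    and signs: "\<And>e. e \<in> sign_vectors n \<Longrightarrow> F e \<le> K"
    and d: "\<And>i. i < n \<Longrightarrow> \<bar>d i\<bar> \<le> 1"
  shows "F d \<le> K"
proof -
  have "F d \<le> K" if "m \<le> n" "\<And>i. i < n \<Longrightarrow> \<bar>d i\<bar> \<le> 1" "\<And>i. m \<le> i \<Longrightarrow> i < n \<Longrightarrow> d i \<in> {- 1, 1}" for m d
    using that
  proof (induction m arbitrary: d)
    case 0
    have "restrict d {..<n} \<in> sign_vectors n"
      using 0 by (auto simp: sign_vectors_def)
    from signs[OF this] show ?case
      using supp[of "restrict d {..<n}" d] by simp
  next
    case (Suc m)
    have m: "m < n" using Suc.prems(1) by simp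
    define s where "s = d m"
    have s: "- 1 \<le> s" "s \<le> 1" using Suc.prems(2)[OF m] by (auto simp: s_def abs_le_iff)
    define d1 where "d1 = d(m := 1)"
    define d2 where "d2 = d(m := - 1)"
    have "F d1 \<le> K" unfolding d1_def using Suc.prems by (intro Suc.IH) (auto simp: le_Suc_eq)
    moreover have "F d2 \<le> K" unfolding d2_def using Suc.prems by (intro Suc.IH) (auto simp: le_Suc_eq)
    moreover have "F d \<le> (1 + s) / 2 * F d1 + (1 - s) / 2 * F d2"
    proof -
      have "d = (\<lambda>i. (1 + s) / 2 * d1 i + (1 - s) / 2 * d2 i)"
        by (auto simp: fun_eq_iff d1_def d2_def s_def field_simps)
      then have "F d \<le> F (\<lambda>i. (1 + s) / 2 * d1 i) + F (\<lambda>i. (1 - s) / 2 * d2 i)"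
        using add[of "\<lambda>i. (1 + s) / 2 * d1 i" "\<lambda>i. (1 - s) / 2 * d2 i"] by simp
      moreover have "F (\<lambda>i. (1 + s) / 2 * d1 i) = (1 + s) / 2 * F d1" "F (\<lambda>i. (1 - s) / 2 * d2 i) = (1 - s) / 2 * F d2"
        using s by (intro scale; simp)+
      ultimately show ?thesis by simp
    qed
    moreover have "(1 + s) / 2 * F d1 \<le> (1 + s) / 2 * K" if "F d1 \<le> K"
      using that s by (intro mult_left_mono) auto
    moreover have "(1 - s) / 2 * F d2 \<le> (1 - s) / 2 * K" if "F d2 \<le> K"
      using that s by (intro mult_left_mono) auto
    ultimately have "F d \<le> (1 + s) / 2 * K + (1 - s) / 2 * K" by linarith
    then show ?case by (simp add: field_simps)
  qed
  from this[of n d] d show ?thesis by simp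
qed

text \<open>Rounding \<open>u\<close>, rescaled to norm \<open>5 \<surd>n\<close>, leaves an error in the cube \<open>[-1/2, 1/2]\<^sup>n\<close>, on which the convex
  function \<open>F\<close> is controlled by its values at the vertices.\<close>

lemma sublinear_nonneg:
  fixes F :: "(nat \<Rightarrow> real) \<Rightarrow> real"
  assumes add: "\<And>u v. F (\<lambda>i. u i + v i) \<le> F u + F v"
    and scale: "\<And>c u. 0 \<le> c \<Longrightarrow> F (\<lambda>i. c * u i) = c * F u"
    and supp: "\<And>u v. (\<And>i. i < n \<Longrightarrow> u i = v i) \<Longrightarrow> F u = F v"
    and lattice: "\<And>k. k \<in> lattice_net n \<Longrightarrow> A \<le> F (\<lambda>i. real_of_int (k i))"
    and signs: "\<And>e. e \<in> sign_vectors n \<Longrightarrow> F e \<le> 2 * A"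
  shows "0 \<le> F u"
proof (cases "L2_set u {..<n} = 0")
  case True
  then have "u i = 0" if "i < n" for i
    using that by (simp add: L2_set_eq_0_iff)
  then have "F u = F (\<lambda>i. 0 * u i)" by (intro supp) auto
  then show ?thesis using scale[of 0 u] by simp
next
  case False
  then have pos: "0 < L2_set u {..<n}" using L2_set_nonneg[of u "{..<n}"] by (simp add: less_le)
  then have n: "0 < n" by (cases n) auto
  \<comment> \<open>At norm 5 sqrt n the rounding error, of norm at most sqrt n / 2, is at most a
    tenth of the vector.\<close>
  define c where "c = 5 * sqrt n / L2_set u {..<n}"
  have c: "0 < c" using pos n by (simp add: c_def)
  define y where "y i = c * u i" for i
  have y_norm: "L2_set y {..<n} = 5 * sqrt n"
  proof -
    have "L2_set y {..<n} = c * L2_set u {..<n}"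
      unfolding y_def using c by (simp add: L2_set_right_distrib)
    then show ?thesis using pos by (simp add: c_def)
  qed
  define k where "k = (\<lambda>i\<in>{..<n}. round (y i))"
  have k: "\<bar>real_of_int (k i) - y i\<bar> \<le> 1 / 2" if "i < n" for i
    using of_int_round_abs_le[of "y i"] that by (simp add: k_def)
  have y_sum: "(\<Sum>i<n. \<bar>y i\<bar>) \<le> 5 * n"
  proof -
    have "(\<Sum>i<n. \<bar>y i\<bar>) = (\<Sum>i<n. \<bar>y i\<bar> * \<bar>1\<bar>)" by simp
    also have "\<dots> \<le> L2_set y {..<n} * L2_set (\<lambda>_. 1) {..<n}"
      by (rule L2_set_mult_ineq)
    also have "\<dots> = 5 * (sqrt n * sqrt n)"
      unfolding y_norm by (simp add: L2_set_def)
    finally show ?thesis by simp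
  qed
  have diff_norm: "L2_set (\<lambda>i. real_of_int (k i) - y i) {..<n} \<le> sqrt n / 2"
  proof -
    have "L2_set (\<lambda>i. real_of_int (k i) - y i) {..<n} = L2_set (\<lambda>i. \<bar>real_of_int (k i) - y i\<bar>) {..<n}"
      by (simp add: L2_set_def)
    also have "\<dots> \<le> L2_set (\<lambda>i. 1 / 2) {..<n}"
      using k by (intro L2_set_mono) auto
    also have "\<dots> = sqrt n / 2"
      by (simp add: L2_set_def real_sqrt_divide power_divide)
    finally show ?thesis .
  qed
  have k_lattice: "k \<in> lattice_net n"
    unfolding lattice_net_def
  proof (intro CollectI conjI)
    have "\<bar>y i\<bar> \<le> 5 * n" if "i < n" for i
      using y_sum member_le_sum[of i "{..<n}" "\<lambda>i. \<bar>y i\<bar>"] that by simp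
    moreover have "\<bar>real_of_int (k i)\<bar> \<le> \<bar>y i\<bar> + 1 / 2" if "i < n" for i
      using k[OF that] by linarith
    moreover have "1 \<le> real n" using n by simp
    ultimately have "\<bar>real_of_int (k i)\<bar> \<le> 6 * n" if "i < n" for i
      using that by fastforce
    then have "real_of_int \<bar>k i\<bar> \<le> real_of_int (int (6 * n))" if "i < n" for i
      using that by simp
    then have "\<bar>k i\<bar> \<le> int (6 * n)" if "i < n" for i
      using that by (simp only: of_int_le_iff)
    then show "k \<in> PiE {..<n} (\<lambda>_. {- int (6 * n)..int (6 * n)})"
      by (intro PiE_I) (auto simp: k_def abs_le_iff minus_le_iff)
    have "(\<Sum>i<n. \<bar>real_of_int (k i)\<bar>) \<le> (\<Sum>i<n. \<bar>y i\<bar> + 1 / 2)"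
    proof (rule sum_mono)
      fix i assume "i \<in> {..<n}"
      then have "\<bar>real_of_int (k i) - y i\<bar> \<le> 1 / 2" by (intro k) simp
      then show "\<bar>real_of_int (k i)\<bar> \<le> \<bar>y i\<bar> + 1 / 2" by linarith
    qed
    also have "\<dots> \<le> 11 / 2 * n" using y_sum by (simp add: sum.distrib)
    finally show "(\<Sum>i<n. \<bar>real_of_int (k i)\<bar>) \<le> 11 / 2 * n" .
    have "L2_set y {..<n} \<le> L2_set (\<lambda>i. real_of_int (k i)) {..<n} + L2_set (\<lambda>i. y i - real_of_int (k i)) {..<n}"
      using L2_set_triangle_ineq[of "\<lambda>i. real_of_int (k i)" "\<lambda>i. y i - real_of_int (k i)" "{..<n}"] by simp
    moreover have "L2_set (\<lambda>i. y i - real_of_int (k i)) {..<n} = L2_set (\<lambda>i. real_of_int (k i) - y i) {..<n}"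
      by (simp add: L2_set_def power2_commute)
    ultimately show "9 / 2 * sqrt n \<le> L2_set (\<lambda>i. real_of_int (k i)) {..<n}"
      using diff_norm y_norm by simp
  qed
  \<comment> \<open>The doubled rounding error lies in [-1, 1]^n. Halving gives F (k - y) <= A, so
    that F y >= F k - F (k - y) >= A - A.\<close>
  have "F (\<lambda>i. 2 * (real_of_int (k i) - y i)) \<le> 2 * A"
  proof (rule convex_le_of_sign_vectors[OF add scale supp signs])
    fix i assume "i < n"
    then show "\<bar>2 * (real_of_int (k i) - y i)\<bar> \<le> 1"
      unfolding abs_mult abs_numeral using mult_left_mono[OF k[OF \<open>i < n\<close>], of 2] by simp
  qed auto
  then have "F (\<lambda>i. real_of_int (k i) - y i) \<le> A"
    using scale[of 2 "\<lambda>i. real_of_int (k i) - y i"] by simp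
  moreover have "F (\<lambda>i. real_of_int (k i)) \<le> F y + F (\<lambda>i. real_of_int (k i) - y i)"
    using add[of y "\<lambda>i. real_of_int (k i) - y i"] by simp
  ultimately have "0 \<le> F y" using lattice[OF k_lattice] by simp
  moreover have "y = (\<lambda>i. c * u i)" by (simp add: y_def fun_eq_iff)
  ultimately have "0 \<le> c * F u" using scale[of c u] c by simp
  then show ?thesis using c by (simp add: zero_le_mult_iff)
qed

text \<open>At a minimizer \<open>y\<close> of \<open>\<Sum>\<langle>G i, y\<rangle>\<^sup>2\<close>, the residual vector \<open>\<langle>G i, y\<rangle>\<close> separates the image of \<open>M\<close>
  from the origin.\<close>

lemma compact_convex_meets_kernel:
  fixes M :: "(nat \<Rightarrow> real) set" and n :: nat
  assumes M: "compact M" "M \<noteq> {}"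
    and convex: "\<And>y z t. y \<in> M \<Longrightarrow> z \<in> M \<Longrightarrow> 0 \<le> t \<Longrightarrow> t \<le> 1 \<Longrightarrow> (\<lambda>i. (1 - t) * y i + t * z i) \<in> M"
    and sep: "\<And>u. \<exists>y\<in>M. (\<Sum>i<n. u i * eucl_inner N (G i) y) \<le> 0"
  obtains y where "y \<in> M" "\<And>i. i < n \<Longrightarrow> eucl_inner N (G i) y = 0"
proof -
  define f where "f y = (\<Sum>i<n. (eucl_inner N (G i) y)\<^sup>2)" for y
  have "continuous_on M f"
    unfolding f_def eucl_inner_def
    by (intro continuous_intros continuous_on_product_coordinates[THEN continuous_on_subset]) auto
  from continuous_attains_inf[OF M this]
  obtain y where y: "y \<in> M" "\<And>z. z \<in> M \<Longrightarrow> f y \<le> f z" by blast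
  define u where "u i = eucl_inner N (G i) y" for i
  obtain z where z: "z \<in> M" "(\<Sum>i<n. u i * eucl_inner N (G i) z) \<le> 0"
    using sep[of u] by blast
  define v where "v i = eucl_inner N (G i) z" for i
  define U where "U = (\<Sum>i<n. (u i)\<^sup>2)"
  define V where "V = (\<Sum>i<n. (v i)\<^sup>2)"
  define W where "W = (\<Sum>i<n. u i * v i)"
  have UV: "0 \<le> U" "0 \<le> V" "W \<le> 0"
    using z by (auto simp: U_def V_def W_def v_def intro: sum_nonneg)
  have "U = 0"
  proof (rule ccontr)
    assume "U \<noteq> 0"
    then have U: "0 < U" using UV by simp
    \<comment> \<open>The minimizer of (1 - t)^2 U + t^2 V, which is the value of \<open>f\<close>
      on the segment from \<open>y\<close> to \<open>z\<close> without the nonpositive mixed term.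
      The minimum U - t U contradicts the choice of \<open>y\<close>.\<close>
    define t where "t = U / (U + V)"
    have t: "0 < t" "t \<le> 1" "t * (U + V) = U" using U UV by (auto simp: t_def)
    have "f (\<lambda>i. (1 - t) * y i + t * z i) = (\<Sum>i<n. ((1 - t) * u i + t * v i)\<^sup>2)"
      unfolding f_def u_def v_def eucl_inner_def
      by (simp add: sum_distrib_left sum.distrib[symmetric] algebra_simps)
    also have "\<dots> = (1 - t)\<^sup>2 * U + 2 * t * (1 - t) * W + t\<^sup>2 * V"
      unfolding U_def V_def W_def
      by (simp add: sum_distrib_left sum.distrib[symmetric] power2_eq_square algebra_simps)
    also have "\<dots> \<le> (1 - t)\<^sup>2 * U + t\<^sup>2 * V"
      using t UV by (simp add: mult_nonneg_nonpos)
    also have "\<dots> = U - 2 * t * U + t * (t * (U + V))"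
      by (simp add: power2_eq_square algebra_simps)
    also have "\<dots> = U - t * U" using t by (simp add: algebra_simps)
    finally have "f (\<lambda>i. (1 - t) * y i + t * z i) < U"
      using mult_pos_pos[OF t(1) U] by linarith
    moreover have "U \<le> f (\<lambda>i. (1 - t) * y i + t * z i)"
      using y(2)[OF convex[OF y(1) z(1)], of t] t by (simp add: f_def U_def u_def)
    ultimately show False by simp
  qed
  then have "\<forall>i\<in>{..<n}. (u i)\<^sup>2 = 0"
    unfolding U_def by (subst (asm) sum_nonneg_eq_0_iff) auto
  then have "u i = 0" if "i < n" for i
    using that by simp
  then show ?thesis using that[OF y(1)] by (simp add: u_def)
qed

section \<open>Compactness of ellipsoids and semicontinuity of the radius\<close>

lemma compact_box: "compact {x :: nat \<Rightarrow> real. \<forall>i. l i \<le> x i \<and> x i \<le> h i}"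
proof -
  have "compactin (product_topology (\<lambda>_. euclidean) UNIV) (PiE UNIV (\<lambda>i. {l i..h i}))"
    unfolding compactin_PiE by auto
  then have "compact (PiE UNIV (\<lambda>i. {l i..h i}))"
    by (simp add: euclidean_product_topology)
  moreover have "PiE UNIV (\<lambda>i. {l i..h i}) = {x. \<forall>i. l i \<le> x i \<and> x i \<le> h i}"
    by (auto simp: PiE_def Pi_def extensional_def)
  ultimately show ?thesis by simp
qed

lemma closed_eucl: "closed (eucl N)"
proof -
  have "closed {x :: nat \<Rightarrow> real. i \<notin> {1..N} \<longrightarrow> x i = 0}" for i
    by (cases "i \<in> {1..N}") (auto intro!: closed_Collect_eq continuous_on_product_coordinates)
  then show ?thesis
    unfolding eucl_def by (intro closed_Collect_all)
qed

lemma continuous_on_eucl_norm: "continuous_on UNIV (eucl_norm N)"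
  unfolding L2_set_def
  by (intro continuous_intros continuous_on_product_coordinates)

lemma ellipsoid_entry_le:
  assumes x: "x \<in> ellipsoid N \<sigma> p" and p: "1 \<le> p" and i: "i \<in> {1..N}" and \<sigma>: "\<forall>i\<in>{1..N}. 0 \<le> \<sigma> i"
  shows "\<bar>x i\<bar> \<le> \<sigma> i"
proof (cases "\<sigma> i = 0")
  case True
  then show ?thesis using x i by (auto simp: ellipsoid_def)
next
  case False
  then have pos: "0 < \<sigma> i" using \<sigma> i by (auto simp: less_le)
  have "\<bar>x i\<bar> / \<sigma> i \<le> 1"
  proof (cases "p = \<infinity>")
    case True
    then have "(MAX i\<in>{1..N}. \<bar>x i\<bar> / \<sigma> i) \<le> 1" using x by (simp add: ellipsoid_def)
    then show ?thesis using i by (subst (asm) Max_le_iff) auto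
  next
    case False
    then obtain r where r: "p = ereal r" "1 \<le> r"
      using p by (cases p) auto
    have "(\<bar>x i\<bar> / \<sigma> i) powr r \<le> (\<Sum>i=1..N. (\<bar>x i\<bar> / \<sigma> i) powr r)"
      using i by (intro member_le_sum) auto
    also have "\<dots> \<le> 1" using x False r by (simp add: ellipsoid_def)
    finally have le: "(\<bar>x i\<bar> / \<sigma> i) powr r \<le> 1" .
    show ?thesis
    proof (rule ccontr)
      assume "\<not> \<bar>x i\<bar> / \<sigma> i \<le> 1"
      then have "1 < (\<bar>x i\<bar> / \<sigma> i) powr r"
        using r by (intro gr_one_powr) auto
      with le show False by linarith
    qed
  qed
  then show ?thesis using pos by (simp add: field_simps)
qed

text \<open>A closed subset of the box given by the entrywise bound. Functions carry the product
  topology, so that box is compact by Tychonoff.\<close>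

lemma compact_ellipsoid:
  assumes p: "1 \<le> p" and N: "1 \<le> N" and \<sigma>: "\<forall>i\<in>{1..N}. 0 \<le> \<sigma> i"
  shows "compact (ellipsoid N \<sigma> p)"
proof -
  define h where "h i = (if i \<in> {1..N} then \<sigma> i else 0)" for i
  have "ellipsoid N \<sigma> p \<subseteq> {x. \<forall>i. - h i \<le> x i \<and> x i \<le> h i}"
    using ellipsoid_entry_le[OF _ p _ \<sigma>] by (auto simp: h_def abs_le_iff ellipsoid_def eucl_def minus_le_iff)
  moreover have "closed (ellipsoid N \<sigma> p)"
  proof -
    have "closed {x :: nat \<Rightarrow> real. if p = \<infinity> then (MAX i\<in>{1..N}. \<bar>x i\<bar> / \<sigma> i) \<le> 1
        else (\<Sum>i=1..N. (\<bar>x i\<bar> / \<sigma> i) powr real_of_ereal p) \<le> 1}"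
    proof (cases "p = \<infinity>")
      case True
      have "closed {x :: nat \<Rightarrow> real. \<forall>i. i \<in> {1..N} \<longrightarrow> \<bar>x i\<bar> / \<sigma> i \<le> 1}"
      proof (rule closed_Collect_all)
        fix i show "closed {x :: nat \<Rightarrow> real. i \<in> {1..N} \<longrightarrow> \<bar>x i\<bar> / \<sigma> i \<le> 1}"
          by (cases "i \<in> {1..N}") (auto intro!: closed_Collect_le continuous_intros continuous_on_product_coordinates
            simp: divide_inverse)
      qed
      moreover have "(MAX i\<in>{1..N}. \<bar>x i\<bar> / \<sigma> i) \<le> 1 \<longleftrightarrow> (\<forall>i. i \<in> {1..N} \<longrightarrow> \<bar>x i\<bar> / \<sigma> i \<le> 1)" for x
        using N by (subst Max_le_iff) auto
      ultimately show ?thesis using True by simp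
    next
      case False
      then obtain r where r: "p = ereal r" "1 \<le> r"
        using p by (cases p) auto
      have "continuous_on UNIV (\<lambda>x :: nat \<Rightarrow> real. (\<bar>x i\<bar> / \<sigma> i) powr r)" if "i \<in> {1..N}" for i
        using \<sigma> r that unfolding divide_inverse
        by (intro continuous_on_powr' continuous_intros continuous_on_product_coordinates) auto
      then have "closed {x :: nat \<Rightarrow> real. (\<Sum>i=1..N. (\<bar>x i\<bar> / \<sigma> i) powr r) \<le> 1}"
        by (intro closed_Collect_le continuous_on_sum continuous_on_const) auto
      then show ?thesis using r by simp
    qed
    moreover have "closed {x :: nat \<Rightarrow> real. \<forall>i. i \<in> {1..N} \<longrightarrow> \<sigma> i = 0 \<longrightarrow> x i = 0}"
    proof (rule closed_Collect_all)
      fix i show "closed {x :: nat \<Rightarrow> real. i \<in> {1..N} \<longrightarrow> \<sigma> i = 0 \<longrightarrow> x i = 0}"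
        by (cases "i \<in> {1..N} \<and> \<sigma> i = 0") (auto intro!: closed_Collect_eq continuous_on_product_coordinates)
    qed
    ultimately have "closed (eucl N \<inter> ({x. \<forall>i. i \<in> {1..N} \<longrightarrow> \<sigma> i = 0 \<longrightarrow> x i = 0} \<inter>
        {x. if p = \<infinity> then (MAX i\<in>{1..N}. \<bar>x i\<bar> / \<sigma> i) \<le> 1
        else (\<Sum>i=1..N. (\<bar>x i\<bar> / \<sigma> i) powr real_of_ereal p) \<le> 1}))"
      by (intro closed_Int closed_eucl)
    also have "eucl N \<inter> ({x. \<forall>i. i \<in> {1..N} \<longrightarrow> \<sigma> i = 0 \<longrightarrow> x i = 0} \<inter>
        {x. if p = \<infinity> then (MAX i\<in>{1..N}. \<bar>x i\<bar> / \<sigma> i) \<le> 1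
        else (\<Sum>i=1..N. (\<bar>x i\<bar> / \<sigma> i) powr real_of_ereal p) \<le> 1}) = ellipsoid N \<sigma> p"
      by (auto simp: ellipsoid_def)
    finally show ?thesis .
  qed
  ultimately have "ellipsoid N \<sigma> p = {x. \<forall>i. - h i \<le> x i \<and> x i \<le> h i} \<inter> ellipsoid N \<sigma> p"
    by blast
  then show ?thesis
    using compact_Int_closed[OF compact_box \<open>closed (ellipsoid N \<sigma> p)\<close>, of "\<lambda>i. - h i" h] by simp
qed

lemma zero_in_ellipsoid: "1 \<le> N \<Longrightarrow> 1 \<le> p \<Longrightarrow> 0 \<in> ellipsoid N \<sigma> p"
  by (cases p) (auto simp: ellipsoid_def)

lemma ellipsoid_eucl: "ellipsoid N \<sigma> p \<subseteq> eucl N"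
  by (auto simp: ellipsoid_def)

lemma eucl_norm_ellipsoid_le:
  assumes "x \<in> ellipsoid N \<sigma> p" "1 \<le> p" "\<forall>i\<in>{1..N}. 0 \<le> \<sigma> i"
  shows "eucl_norm N x \<le> (\<Sum>i=1..N. \<sigma> i)"
  using ellipsoid_entry_le[OF assms(1,2) _ assms(3)]
  by (intro order_trans[OF eucl_norm_le_sum] sum_mono)

lemma random_radius_upper:
  assumes "y \<in> E" "y \<in> ellipsoid N \<sigma> p" "1 \<le> p" "\<forall>i\<in>{1..N}. 0 \<le> \<sigma> i"
  shows "eucl_norm N y \<le> random_radius N \<sigma> p E"
  unfolding random_radius_def
proof (rule cSUP_upper)
  show "bdd_above (eucl_norm N ` (E \<inter> ellipsoid N \<sigma> p))"
    using eucl_norm_ellipsoid_le[OF _ assms(3,4)] by (auto intro!: bdd_aboveI2)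
qed (use assms in auto)

lemma random_radius_nonneg:
  assumes E: "E \<in> grassmannian N m" and "1 \<le> N" "1 \<le> p" "\<forall>i\<in>{1..N}. 0 \<le> \<sigma> i"
  shows "0 \<le> random_radius N \<sigma> p E"
  using random_radius_upper[OF fs.subspace_0[OF grassmannian_subspace[OF E]] zero_in_ellipsoid] assms by simp

lemma continuous_on_orth_proj_residual:
  assumes "E \<in> grassmannian N m"
  shows "continuous_on UNIV (\<lambda>y. eucl_norm N (y - orth_proj N E y))"
proof -
  obtain q where q: "orthonormal N m q" "E = frame_span m q"
    using assms by (rule grassmannianE)
  have "continuous_on UNIV (\<lambda>y. sqrt (\<Sum>l=1..N. (y l - (\<Sum>i<m. (\<Sum>j=1..N. y j * q i j) * q i l))\<^sup>2))"
    by (intro continuous_intros continuous_on_product_coordinates)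
  then show ?thesis
    by (simp add: q orth_proj_frame_span L2_set_def frame_proj_def sum_fun_apply fun_scale_def eucl_inner_def)
qed

text \<open>Upper semicontinuity of the radius: the long vectors of the ellipsoid form a compact set
  disjoint from \<open>E\<close>, hence at positive distance from it, and subspaces close to
  \<open>E\<close> miss this set too.\<close>

lemma openin_random_radius_less:
  assumes p: "1 \<le> p" and N: "1 \<le> N" and \<sigma>: "\<forall>i\<in>{1..N}. 0 \<le> \<sigma> i"
  shows "openin (grass.mtopology N m) {E \<in> grassmannian N m. random_radius N \<sigma> p E < a}"
  unfolding grass.openin_mtopology
proof (intro conjI allI impI)
  fix E assume "E \<in> {E \<in> grassmannian N m. random_radius N \<sigma> p E < a}"
  then have E: "E \<in> grassmannian N m" and "random_radius N \<sigma> p E < a" by auto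
  \<comment> \<open>The gap is used on both sides: above the radius of \<open>E\<close>, so that
    \<open>K\<close> misses \<open>E\<close>, and below \<open>a\<close>, since a subspace missing
    \<open>K\<close> has radius at most \<open>b\<close>.\<close>
  then obtain b where b: "random_radius N \<sigma> p E < b" "b < a" using dense by blast
  define K where "K = ellipsoid N \<sigma> p \<inter> {y. b \<le> eucl_norm N y}"
  define \<phi> where "\<phi> y = eucl_norm N (y - orth_proj N E y)" for y
  have radius_le: "random_radius N \<sigma> p F < a"
    if F: "F \<in> grassmannian N m" "F \<inter> K = {}" for F
  proof -
    have "random_radius N \<sigma> p F \<le> b"
      unfolding random_radius_def
    proof (rule cSUP_least)
      show "F \<inter> ellipsoid N \<sigma> p \<noteq> {}"
        using fs.subspace_0[OF grassmannian_subspace[OF F(1)]] zero_in_ellipsoid[OF N p] by blast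
      show "eucl_norm N y \<le> b" if "y \<in> F \<inter> ellipsoid N \<sigma> p" for y
        using that F(2) by (auto simp: K_def not_le[symmetric])
    qed
    with b show ?thesis by simp
  qed
  show "\<exists>r>0. grass.mball N m E r \<subseteq> {E \<in> grassmannian N m. random_radius N \<sigma> p E < a}"
  proof (cases "K = {}")
    case True
    then show ?thesis
      using radius_le by (intro exI[of _ 1]) (auto simp: grass.in_mball)
  next
    case False
    have "compact K"
      unfolding K_def
      by (intro compact_Int_closed compact_ellipsoid p N \<sigma> closed_Collect_le continuous_on_const continuous_on_eucl_norm)
    moreover have "continuous_on K \<phi>"
      unfolding \<phi>_def using continuous_on_orth_proj_residual[OF E] by (rule continuous_on_subset) auto
    ultimately obtain y0 where y0: "y0 \<in> K" "\<And>y. y \<in> K \<Longrightarrow> \<phi> y0 \<le> \<phi> y"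
      using continuous_attains_inf[of K \<phi>] False by blast
    have eucl: "y \<in> eucl N" if "y \<in> K" for y
      using that ellipsoid_eucl by (auto simp: K_def)
    have "\<phi> y0 \<noteq> 0"
    proof
      assume "\<phi> y0 = 0"
      then have "y0 = orth_proj N E y0"
        unfolding \<phi>_def using eucl_norm_eq_0[OF eucl_diff[OF eucl[OF y0(1)] orth_proj_eucl[OF E]]] by simp
      then have "y0 \<in> E" using orth_proj_mem[OF E, of y0] by simp
      then have "eucl_norm N y0 \<le> random_radius N \<sigma> p E"
        using y0(1) by (intro random_radius_upper p \<sigma>) (auto simp: K_def)
      then show False using y0(1) b by (auto simp: K_def)
    qed
    then have pos: "0 < \<phi> y0"
      using eucl_norm_nonneg[of "y0 - orth_proj N E y0" N] by (simp add: \<phi>_def less_le)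
    \<comment> \<open>Bounds the norm on the ellipsoid and is positive even if \<sigma>
      vanishes.\<close>
    define D where "D = (\<Sum>i=1..N. \<sigma> i) + 1"
    have D: "0 < D" using \<sigma> by (auto simp: D_def intro!: add_nonneg_pos sum_nonneg)
    have "grass.mball N m E (\<phi> y0 / D) \<subseteq> {E \<in> grassmannian N m. random_radius N \<sigma> p E < a}"
    proof
      fix F assume "F \<in> grass.mball N m E (\<phi> y0 / D)"
      then have F: "F \<in> grassmannian N m" "grass_dist N m E F < \<phi> y0 / D" by (auto simp: grass.in_mball)
      have "F \<inter> K = {}"
      proof (rule ccontr)
        assume "F \<inter> K \<noteq> {}"
        then obtain y where y: "y \<in> F" "y \<in> K" by blast
        have "\<phi> y = eucl_norm N (orth_proj N E y - orth_proj N F y)"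
          unfolding \<phi>_def orth_proj_id[OF F(1) y(1)] by (rule eucl_norm_minus_commute)
        also have "\<dots> \<le> grass_dist N m E F * eucl_norm N y"
          by (rule grass_dist_norm_le[OF E F(1) eucl[OF y(2)]])
        also have "\<dots> \<le> grass_dist N m E F * D"
          using y(2) eucl_norm_ellipsoid_le[of y N \<sigma> p] p \<sigma>
          by (intro mult_left_mono grass_dist_nonneg) (auto simp: K_def D_def intro: order_trans)
        also have "\<dots> < \<phi> y0" using F(2) D by (simp add: field_simps)
        finally show False using y0(2)[OF y(2)] by simp
      qed
      then show "F \<in> {E \<in> grassmannian N m. random_radius N \<sigma> p E < a}"
        using F(1) radius_le by simp
    qed
    moreover have "0 < \<phi> y0 / D" using pos D by simp
    ultimately show ?thesis by blast
  qed
qed auto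

section \<open>Gaussian estimates\<close>

lemma arctan_le_self: "0 \<le> x \<Longrightarrow> arctan x \<le> x"
proof -
  assume "0 \<le> x"
  have "0 - arctan 0 \<le> x - arctan x"
  proof (rule DERIV_nonneg_imp_nondecreasing[OF \<open>0 \<le> x\<close>])
    fix y :: real
    have "((\<lambda>x. x - arctan x) has_real_derivative (1 - inverse (1 + y\<^sup>2))) (at y)"
      by (auto intro!: derivative_eq_intros)
    moreover have "0 \<le> 1 - inverse (1 + y\<^sup>2)"
      by (simp add: inverse_le_1_iff)
    ultimately show "\<exists>d. ((\<lambda>x. x - arctan x) has_real_derivative d) (at y) \<and> 0 \<le> d" by blast
  qed
  then show ?thesis by simp
qed

text \<open>Euler's identity pi / 4 = arctan (1/2) + arctan (1/3), together with arctan x <= x. The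
  bound serves to estimate the mean sqrt(2/pi) of |t| under the standard normal law.\<close>

lemma pi_le_ten_thirds: "pi \<le> 10 / 3"
proof -
  have "arctan (1 / 2) + arctan (1 / 3) = arctan ((1 / 2 + 1 / 3) / (1 - 1 / 2 * (1 / 3)))"
    by (rule arctan_add) auto
  also have "\<dots> = pi / 4" by (simp add: arctan_one)
  finally show ?thesis
    using arctan_le_self[of "1 / 2"] arctan_le_self[of "1 / 3"] by simp
qed

lemma sqrt_two_over_pi_ge: "77 / 100 \<le> sqrt (2 / pi)"
proof (rule real_le_rsqrt)
  show "(77 / 100)\<^sup>2 \<le> 2 / pi"
    using pi_le_ten_thirds pi_gt_zero by (simp add: field_simps power2_eq_square)
qed

text \<open>Completing the square: an exponential weight is absorbed into the Gaussian density as a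
  translation.\<close>

lemma nn_integral_std_normal_shift:
  fixes f :: "real \<Rightarrow> ennreal"
  assumes [measurable]: "f \<in> borel_measurable borel"
  shows "(\<integral>\<^sup>+t. ennreal (exp (c * t)) * f t \<partial>std_normal)
    = ennreal (exp (c\<^sup>2 / 2)) * (\<integral>\<^sup>+t. f (t + c) \<partial>std_normal)"
proof -
  have eq: "std_normal_density (t + c) * exp (c * (t + c)) = exp (c\<^sup>2 / 2) * std_normal_density t" for t
  proof -
    have "exp (- (t + c)\<^sup>2 / 2) * exp (c * (t + c)) = exp (c\<^sup>2 / 2) * exp (- t\<^sup>2 / 2)"
      unfolding exp_add[symmetric]
      by (rule arg_cong[where f = exp]) (simp add: field_simps power2_eq_square)
    then show ?thesis
      by (simp add: std_normal_density_def mult.assoc mult.left_commute)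
  qed
  have "(\<integral>\<^sup>+t. ennreal (exp (c * t)) * f t \<partial>std_normal)
      = (\<integral>\<^sup>+t. ennreal (std_normal_density t) * (ennreal (exp (c * t)) * f t) \<partial>lborel)"
    by (rule nn_integral_std_normal) auto
  also have "\<dots> = (\<integral>\<^sup>+t. ennreal (std_normal_density (t + c)) * (ennreal (exp (c * (t + c))) * f (t + c)) \<partial>lborel)"
    using nn_integral_lborel_translate[of "\<lambda>t. ennreal (std_normal_density t) * (ennreal (exp (c * t)) * f t)" c]
    by simp
  also have "\<dots> = (\<integral>\<^sup>+t. ennreal (exp (c\<^sup>2 / 2)) * (ennreal (std_normal_density t) * f (t + c)) \<partial>lborel)"
  proof (rule nn_integral_cong)
    fix t
    have "ennreal (std_normal_density (t + c)) * (ennreal (exp (c * (t + c))) * f (t + c))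
        = ennreal (std_normal_density (t + c) * exp (c * (t + c))) * f (t + c)"
      by (simp add: ennreal_mult' mult.assoc)
    also have "\<dots> = ennreal (exp (c\<^sup>2 / 2)) * (ennreal (std_normal_density t) * f (t + c))"
      unfolding eq by (simp add: ennreal_mult' mult.assoc)
    finally show "ennreal (std_normal_density (t + c)) * (ennreal (exp (c * (t + c))) * f (t + c))
        = ennreal (exp (c\<^sup>2 / 2)) * (ennreal (std_normal_density t) * f (t + c))" .
  qed
  also have "\<dots> = ennreal (exp (c\<^sup>2 / 2)) * (\<integral>\<^sup>+t. ennreal (std_normal_density t) * f (t + c) \<partial>lborel)"
    by (rule nn_integral_cmult) auto
  also have "(\<integral>\<^sup>+t. ennreal (std_normal_density t) * f (t + c) \<partial>lborel) = (\<integral>\<^sup>+t. f (t + c) \<partial>std_normal)"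
    by (rule nn_integral_std_normal[symmetric]) auto
  finally show ?thesis .
qed

lemma nn_integral_std_normal_exp: "(\<integral>\<^sup>+t. ennreal (exp (c * t)) \<partial>std_normal) = ennreal (exp (c\<^sup>2 / 2))"
  using nn_integral_std_normal_shift[of "\<lambda>_. 1" c] std_normal.emeasure_space_1 by simp

lemma exp_minus_le_quadratic: "0 \<le> x \<Longrightarrow> exp (- x) \<le> 1 - x + x\<^sup>2 / 2" for x :: real
proof -
  assume x: "0 \<le> x"
  let ?p = "1 + x + x\<^sup>2 / 2"
  have p: "0 < ?p" using x by (simp add: add_pos_nonneg)
  \<comment> \<open>The product equals 1 + x^4 / 4.\<close>
  have "1 \<le> (1 - x + x\<^sup>2 / 2) * ?p"
    using x by (simp add: algebra_simps power2_eq_square)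
  then have "1 / ?p \<le> 1 - x + x\<^sup>2 / 2"
    using p by (simp add: pos_divide_le_eq)
  moreover have "exp (- x) \<le> 1 / ?p"
    using exp_lower_Taylor_quadratic[OF x] p by (simp add: exp_minus inverse_eq_divide frac_le)
  ultimately show ?thesis by simp
qed

text \<open>The quadratic upper bound for exp (-x) is integrated with the absolute first and the
  second moment; 1 + z <= exp z then brings it into a form that multiplies well over
  columns.\<close>

lemma nn_integral_std_normal_exp_minus_abs:
  assumes a: "0 \<le> a"
  shows "(\<integral>\<^sup>+t. ennreal (exp (- a * \<bar>t\<bar>)) \<partial>std_normal) \<le> ennreal (exp (a\<^sup>2 / 2 - 77 / 100 * a))"
proof -
  have I0: "has_bochner_integral lborel (\<lambda>x. std_normal_density x) 1"
    using std_normal_moment_even[of 0] by simp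
  have I1: "has_bochner_integral lborel (\<lambda>x. a * (std_normal_density x * \<bar>x\<bar>)) (a * sqrt (2 / pi))"
    using std_normal_moment_abs_odd[of 0] by (intro has_bochner_integral_mult_right) simp
  have I2: "has_bochner_integral lborel (\<lambda>x. a\<^sup>2 / 2 * (std_normal_density x * x\<^sup>2)) (a\<^sup>2 / 2 * 1)"
    using std_normal_moment_even[of 1] by (intro has_bochner_integral_mult_right) (simp add: fact_2)
  let ?f = "\<lambda>x. std_normal_density x - a * (std_normal_density x * \<bar>x\<bar>) + a\<^sup>2 / 2 * (std_normal_density x * x\<^sup>2)"
  have I: "has_bochner_integral lborel ?f (1 - a * sqrt (2 / pi) + a\<^sup>2 / 2 * 1)"
    by (intro has_bochner_integral_add has_bochner_integral_diff I0 I1 I2)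
  have le: "std_normal_density x * exp (- a * \<bar>x\<bar>) \<le> ?f x" for x
  proof -
    have "exp (- (a * \<bar>x\<bar>)) \<le> 1 - a * \<bar>x\<bar> + (a * \<bar>x\<bar>)\<^sup>2 / 2"
      using a by (intro exp_minus_le_quadratic) simp
    then have "std_normal_density x * exp (- (a * \<bar>x\<bar>)) \<le> std_normal_density x * (1 - a * \<bar>x\<bar> + (a * \<bar>x\<bar>)\<^sup>2 / 2)"
      by (intro mult_left_mono) auto
    then show ?thesis by (simp add: algebra_simps power_mult_distrib)
  qed
  then have nonneg: "0 \<le> ?f x" for x
    using order_trans[OF _ le[of x]] by simp
  have "(\<integral>\<^sup>+t. ennreal (exp (- a * \<bar>t\<bar>)) \<partial>std_normal)
      = (\<integral>\<^sup>+t. ennreal (std_normal_density t) * ennreal (exp (- a * \<bar>t\<bar>)) \<partial>lborel)"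
    by (rule nn_integral_std_normal) auto
  also have "\<dots> \<le> (\<integral>\<^sup>+t. ennreal (?f t) \<partial>lborel)"
    using le by (intro nn_integral_mono) (simp add: ennreal_mult[symmetric] ennreal_leI)
  also have "\<dots> = ennreal (1 - a * sqrt (2 / pi) + a\<^sup>2 / 2 * 1)"
    using I nonneg has_bochner_integral_integral_eq[OF I]
    by (subst nn_integral_eq_integral) (auto simp: has_bochner_integral_iff)
  also have "\<dots> \<le> ennreal (exp (a\<^sup>2 / 2 - 77 / 100 * a))"
  proof (rule ennreal_leI)
    have "1 - a * sqrt (2 / pi) + a\<^sup>2 / 2 * 1 \<le> 1 + (a\<^sup>2 / 2 - 77 / 100 * a)"
      using mult_left_mono[OF sqrt_two_over_pi_ge a] by simp
    also have "\<dots> \<le> exp (a\<^sup>2 / 2 - 77 / 100 * a)" by (rule exp_ge_add_one_self)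
    finally show "1 - a * sqrt (2 / pi) + a\<^sup>2 / 2 * 1 \<le> exp (a\<^sup>2 / 2 - 77 / 100 * a)" .
  qed
  finally show ?thesis .
qed

lemma std_normal_density_bounds:
  "std_normal_density x \<le> 1 / 2" "exp (- x\<^sup>2 / 2) / 3 \<le> std_normal_density x"
proof -
  have s: "2 \<le> sqrt (2 * pi)" "sqrt (2 * pi) \<le> 3"
    using pi_ge_two pi_less_4 by (auto intro!: real_le_rsqrt real_le_lsqrt)
  have "1 / sqrt (2 * pi) * exp (- x\<^sup>2 / 2) \<le> 1 / 2 * 1"
    using s by (intro mult_mono) (auto simp: frac_le)
  then show "std_normal_density x \<le> 1 / 2" by (simp add: std_normal_density_def)
  have "1 / 3 * exp (- x\<^sup>2 / 2) \<le> 1 / sqrt (2 * pi) * exp (- x\<^sup>2 / 2)"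
    using s by (intro mult_right_mono frac_le) auto
  then show "exp (- x\<^sup>2 / 2) / 3 \<le> std_normal_density x" by (simp add: std_normal_density_def)
qed

lemma emeasure_std_normal:
  "A \<in> sets borel \<Longrightarrow> emeasure std_normal A = (\<integral>\<^sup>+t. ennreal (std_normal_density t) * indicator A t \<partial>lborel)"
  unfolding std_normal_def by (rule emeasure_density) auto

lemma std_normal_interval_le:
  assumes "a \<le> b" shows "measure std_normal {a..b} \<le> (b - a) / 2"
proof -
  have "emeasure std_normal {a..b} \<le> (\<integral>\<^sup>+t. ennreal (1 / 2) * indicator {a..b} t \<partial>lborel)"
    unfolding emeasure_std_normal[OF atLeastAtMost_borel]
    by (intro nn_integral_mono mult_right_mono ennreal_leI std_normal_density_bounds) auto
  also have "\<dots> = ennreal (1 / 2) * ennreal (b - a)"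
    using assms by (subst nn_integral_cmult_indicator) simp_all
  also have "\<dots> = ennreal (1 / 2 * (b - a))"
    by (rule ennreal_mult'[symmetric]) simp
  finally show ?thesis
    using assms by (simp add: std_normal.emeasure_eq_measure)
qed

lemma std_normal_interval_ge:
  assumes "0 \<le> a" shows "exp (- (a + 1)\<^sup>2 / 2) / 3 \<le> measure std_normal {a..a + 1}"
proof -
  have "ennreal (exp (- (a + 1)\<^sup>2 / 2) / 3) = (\<integral>\<^sup>+t. ennreal (exp (- (a + 1)\<^sup>2 / 2) / 3) * indicator {a..a + 1} t \<partial>lborel)"
    by (subst nn_integral_cmult_indicator) auto
  also have "\<dots> \<le> (\<integral>\<^sup>+t. ennreal (std_normal_density t) * indicator {a..a + 1} t \<partial>lborel)"
  proof (rule nn_integral_mono)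
    fix t :: real
    show "ennreal (exp (- (a + 1)\<^sup>2 / 2) / 3) * indicator {a..a + 1} t \<le> ennreal (std_normal_density t) * indicator {a..a + 1} t"
    proof (cases "t \<in> {a..a + 1}")
      case True
      then have "t\<^sup>2 \<le> (a + 1)\<^sup>2" using assms by (intro power_mono) auto
      then have "exp (- (a + 1)\<^sup>2 / 2) / 3 \<le> exp (- t\<^sup>2 / 2) / 3" by simp
      also have "\<dots> \<le> std_normal_density t" by (rule std_normal_density_bounds)
      finally show ?thesis using True by (simp add: ennreal_leI)
    qed simp
  qed
  also have "\<dots> = emeasure std_normal {a..a + 1}"
    by (rule emeasure_std_normal[symmetric]) simp
  finally show ?thesis
    by (simp add: std_normal.emeasure_eq_measure)
qed

lemma std_normal_half_line: "measure std_normal {0..} = 1 / 2"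
proof -
  have meas: "{..0} \<in> sets std_normal" "{0<..} \<in> sets std_normal" "{0..} \<in> sets std_normal" "{0} \<in> sets std_normal"
    by simp_all
  have "emeasure std_normal {0..} = (\<integral>\<^sup>+t. indicator {0..} (\<bar>- 1\<bar> * t) \<partial>std_normal)"
    by simp
  also have "\<dots> = (\<integral>\<^sup>+t. indicator {0..} (- 1 * t) \<partial>std_normal)"
    by (rule nn_integral_std_normal_abs_scaled) simp
  also have "\<dots> = (\<integral>\<^sup>+t. indicator {..0} t \<partial>std_normal)"
    by (intro nn_integral_cong) (auto simp: indicator_def)
  also have "\<dots> = emeasure std_normal {..0}" by simp
  finally have 1: "measure std_normal {0..} = measure std_normal {..0}"
    by (simp add: measure_def)
  have "measure std_normal ({0<..} \<union> {0}) = measure std_normal {0<..} + measure std_normal {0}"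
    by (rule std_normal.finite_measure_Union) auto
  moreover have "{0<..} \<union> {0} = {0 :: real..}" by auto
  ultimately have 2: "measure std_normal {0..} = measure std_normal {0<..}"
    by (simp add: measure_def emeasure_std_normal_singleton)
  have "measure std_normal ({..0} \<union> {0<..}) = measure std_normal {..0} + measure std_normal {0<..}"
    by (rule std_normal.finite_measure_Union) auto
  moreover have "{..0} \<union> {0<..} = (UNIV :: real set)" by auto
  moreover have "measure std_normal UNIV = 1" using std_normal.prob_space by simp
  ultimately show ?thesis using 1 2 by simp
qed

text \<open>Each half line contributes exp (a^2/2) times the mass of t >= -a, which is at most (1 +
  a) / 2. Keeping a linear term in the exponent is essential: the bare bound 2 exp (a^2/2) would
  cost a factor 2 for every column, whereas here the total depends on the sums of a and a^2
  only.\<close>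

lemma nn_integral_std_normal_exp_abs:
  assumes a: "0 \<le> a"
  shows "(\<integral>\<^sup>+t. ennreal (exp (a * \<bar>t\<bar>)) \<partial>std_normal) \<le> ennreal (exp (a\<^sup>2 / 2 + a))"
proof -
  define f :: "real \<Rightarrow> ennreal" where "f t = ennreal (exp (a * t)) * indicator {0..} t" for t
  have f[measurable]: "f \<in> borel_measurable borel" unfolding f_def by measurable
  have "(\<integral>\<^sup>+t. ennreal (exp (a * \<bar>t\<bar>)) \<partial>std_normal) \<le> (\<integral>\<^sup>+t. f t + f (- 1 * t) \<partial>std_normal)"
    by (intro nn_integral_mono) (auto simp: f_def indicator_def)
  also have "\<dots> = (\<integral>\<^sup>+t. f t \<partial>std_normal) + (\<integral>\<^sup>+t. f (- 1 * t) \<partial>std_normal)"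
    by (rule nn_integral_add) auto
  also have "(\<integral>\<^sup>+t. f (- 1 * t) \<partial>std_normal) = (\<integral>\<^sup>+t. f t \<partial>std_normal)"
    using nn_integral_std_normal_abs_scaled[OF f, of "- 1"] by simp
  also have "(\<integral>\<^sup>+t. f t \<partial>std_normal) = ennreal (exp (a\<^sup>2 / 2)) * (\<integral>\<^sup>+t. indicator {0..} (t + a) \<partial>std_normal)"
    unfolding f_def by (rule nn_integral_std_normal_shift) simp
  also have "(\<integral>\<^sup>+t. indicator {0..} (t + a) \<partial>std_normal) = emeasure std_normal {- a..}"
  proof -
    have "(\<integral>\<^sup>+t. indicator {0..} (t + a) \<partial>std_normal) = (\<integral>\<^sup>+t. indicator {- a..} t \<partial>std_normal)"
      by (intro nn_integral_cong) (auto simp: indicator_def)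
    then show ?thesis by simp
  qed
  also have "emeasure std_normal {- a..} \<le> ennreal ((1 + a) / 2)"
  proof -
    have "measure std_normal {- a..} \<le> measure std_normal ({- a..0} \<union> {0..})"
      by (intro std_normal.finite_measure_mono) auto
    also have "\<dots> \<le> measure std_normal {- a..0} + measure std_normal {0..}"
      by (intro measure_Un_le) auto
    also have "\<dots> \<le> (1 + a) / 2"
      using std_normal_interval_le[of "- a" 0] a by (simp add: std_normal_half_line add_divide_distrib)
    finally show ?thesis by (simp add: std_normal.emeasure_eq_measure ennreal_leI)
  qed
  finally have "(\<integral>\<^sup>+t. ennreal (exp (a * \<bar>t\<bar>)) \<partial>std_normal)
      \<le> ennreal (exp (a\<^sup>2 / 2)) * ennreal ((1 + a) / 2) + ennreal (exp (a\<^sup>2 / 2)) * ennreal ((1 + a) / 2)"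
    by (simp add: add_mono mult_left_mono)
  also have "\<dots> = ennreal (exp (a\<^sup>2 / 2) * (1 + a))"
    using a by (simp add: ennreal_mult'[symmetric] ennreal_plus[symmetric] del: ennreal_plus)
  also have "\<dots> \<le> ennreal (exp (a\<^sup>2 / 2) * exp a)"
    by (intro ennreal_leI mult_left_mono) auto
  finally show ?thesis by (simp add: exp_add)
qed

lemma borel_measurable_row_comb:
  "l \<in> {1..N} \<Longrightarrow> (\<lambda>G. \<Sum>i<n. k i * G i l) \<in> borel_measurable (gauss_mat n N)"
  by (intro borel_measurable_sum borel_measurable_times borel_measurable_const measurable_gauss_mat_row_entry) auto

text \<open>Markov's inequality for the exponential of the sum, whose mean factorizes over the
  columns. Lower tails are covered by column functions with a negative factor.\<close>

lemma gauss_mat_chernoff: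
  fixes \<psi> :: "nat \<Rightarrow> real \<Rightarrow> real" and k :: "nat \<Rightarrow> real"
  assumes \<psi>: "\<And>l. l \<in> {1..N} \<Longrightarrow> \<psi> l \<in> borel_measurable borel"
    and c: "\<And>l. l \<in> {1..N} \<Longrightarrow>
      (\<integral>\<^sup>+t. ennreal (exp (\<psi> l (L2_set k {..<n} * t))) \<partial>std_normal) \<le> ennreal (exp (c l))"
  shows "{G \<in> space (gauss_mat n N). \<theta> \<le> (\<Sum>l=1..N. \<psi> l (\<Sum>i<n. k i * G i l))} \<in> sets (gauss_mat n N)"
    and "measure (gauss_mat n N) {G \<in> space (gauss_mat n N). \<theta> \<le> (\<Sum>l=1..N. \<psi> l (\<Sum>i<n. k i * G i l))}
      \<le> exp ((\<Sum>l=1..N. c l) - \<theta>)"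
proof -
  let ?P = "gauss_mat n N"
  let ?F = "\<lambda>G. \<Sum>l=1..N. \<psi> l (\<Sum>i<n. k i * G i l)"
  let ?A = "{G \<in> space ?P. \<theta> \<le> ?F G}"
  have F: "?F \<in> borel_measurable ?P"
    by (intro borel_measurable_sum measurable_compose[OF borel_measurable_row_comb \<psi>])
  then show A: "?A \<in> sets ?P"
    by (intro borel_measurable_le borel_measurable_const)
  have "emeasure ?P ?A = (\<integral>\<^sup>+G. indicator ?A G \<partial>?P)"
    using A by simp
  also have "\<dots> \<le> (\<integral>\<^sup>+G. ennreal (exp (- \<theta>)) * (\<Prod>l=1..N. ennreal (exp (\<psi> l (\<Sum>i<n. k i * G i l)))) \<partial>?P)"
  proof (rule nn_integral_mono)
    fix G
    have "ennreal (exp (- \<theta>)) * (\<Prod>l=1..N. ennreal (exp (\<psi> l (\<Sum>i<n. k i * G i l)))) = ennreal (exp (?F G - \<theta>))"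
      by (simp add: prod_ennreal ennreal_mult'[symmetric] exp_diff exp_sum exp_minus field_simps)
    moreover have "indicator ?A G \<le> ennreal (exp (?F G - \<theta>))"
      using ennreal_leI[of 1 "exp (?F G - \<theta>)"] by (auto simp: indicator_def)
    ultimately show "indicator ?A G \<le> ennreal (exp (- \<theta>)) * (\<Prod>l=1..N. ennreal (exp (\<psi> l (\<Sum>i<n. k i * G i l))))"
      by simp
  qed
  also have "\<dots> = ennreal (exp (- \<theta>)) * (\<integral>\<^sup>+G. (\<Prod>l=1..N. ennreal (exp (\<psi> l (\<Sum>i<n. k i * G i l)))) \<partial>?P)"
    by (intro nn_integral_cmult borel_measurable_prod_ennreal measurable_compose[OF _ measurable_ennreal]
      measurable_compose[OF _ borel_measurable_exp] measurable_compose[OF borel_measurable_row_comb \<psi>])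
  also have "(\<integral>\<^sup>+G. (\<Prod>l=1..N. ennreal (exp (\<psi> l (\<Sum>i<n. k i * G i l)))) \<partial>?P)
      = (\<Prod>l=1..N. \<integral>\<^sup>+t. ennreal (exp (\<psi> l (L2_set k {..<n} * t))) \<partial>std_normal)"
    unfolding L2_set_def
    by (rule nn_integral_gauss_mat_prod_row_comb)
      (auto intro!: measurable_compose[OF _ measurable_ennreal] measurable_compose[OF \<psi> borel_measurable_exp])
  also have "\<dots> \<le> (\<Prod>l=1..N. ennreal (exp (c l)))"
    by (intro prod_mono_ennreal c)
  also have "\<dots> = ennreal (exp (\<Sum>l=1..N. c l))"
    by (simp add: prod_ennreal exp_sum)
  finally have "emeasure ?P ?A \<le> ennreal (exp (- \<theta>)) * ennreal (exp (\<Sum>l=1..N. c l))"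
    by (simp add: mult_left_mono)
  also have "\<dots> = ennreal (exp ((\<Sum>l=1..N. c l) - \<theta>))"
    by (simp add: ennreal_mult'[symmetric] exp_diff exp_minus field_simps)
  finally show "measure ?P ?A \<le> exp ((\<Sum>l=1..N. c l) - \<theta>)"
    by (simp add: gauss_mat.emeasure_eq_measure)
qed

lemma measure_finite_UN_le:
  assumes "prob_space M" "finite I" "\<And>i. i \<in> I \<Longrightarrow> A i \<in> sets M" "\<And>i. i \<in> I \<Longrightarrow> measure M (A i) \<le> e"
    and "real (card I) \<le> K" "0 \<le> e"
  shows "measure M (\<Union>i\<in>I. A i) \<le> K * e"
proof -
  interpret prob_space M by fact
  have "measure M (\<Union>i\<in>I. A i) \<le> (\<Sum>i\<in>I. measure M (A i))"
    using assms by (intro finite_measure_subadditive_finite) auto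
  also have "\<dots> \<le> (\<Sum>i\<in>I. e)" using assms by (intro sum_mono)
  also have "\<dots> \<le> K * e" using assms by (simp add: mult_right_mono)
  finally show ?thesis .
qed

lemma L2_set_lattice_net_ge: "k \<in> lattice_net n \<Longrightarrow> 9 / 2 * sqrt n \<le> L2_set (\<lambda>i. real_of_int (k i)) {..<n}"
  by (simp add: lattice_net_def)

lemma L2_set_sign_vectors: "e \<in> sign_vectors n \<Longrightarrow> L2_set e {..<n} = sqrt n"
proof -
  assume e: "e \<in> sign_vectors n"
  have "(e i)\<^sup>2 = 1" if "i < n" for i
  proof -
    have "e i \<in> {- 1, 1}"
      using that by (intro PiE_mem[OF e[unfolded sign_vectors_def]]) simp
    then show ?thesis by auto
  qed
  then have "(\<Sum>i<n. (e i)\<^sup>2) = (\<Sum>i<n. 1)" by (intro sum.cong) auto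
  then show ?thesis by (simp add: L2_set_def)
qed

lemma two_power_le_exp: "real (card (sign_vectors n)) \<le> exp (real n)"
proof -
  have "(2 :: real) ^ n \<le> exp 1 ^ n"
    using exp_ge_add_one_self[of 1] by (intro power_mono) auto
  then show ?thesis by (simp add: card_sign_vectors exp_of_nat_mult[symmetric])
qed

lemma row_comb_add: "(\<Sum>i<n. (u i + v i) * G i l) = (\<Sum>i<n. u i * G i l) + (\<Sum>i<n. v i * G i l)"
  and row_comb_scale: "(\<Sum>i<n. c * u i * G i l) = c * (\<Sum>i<n. u i * G i l)"
  for G :: "nat \<Rightarrow> nat \<Rightarrow> real" and n :: nat
  by (simp_all add: sum.distrib[symmetric] sum_distrib_left algebra_simps)

text \<open>Here \<xi> is the normalized point and \<open>b\<close> the box rescaled by the same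
  factor. The hypotheses on the sum of \<open>b\<close> and of its squares express that the mean of
  the right-hand side, about 6.4 sqrt n |u|, dominates fluctuations of order |u|.\<close>

lemma gauss_box_event:
  fixes \<xi> b :: "nat \<Rightarrow> real"
  assumes \<xi>: "(\<Sum>l=1..N. (\<xi> l)\<^sup>2) = 1" and b: "(\<Sum>l=1..N. (b l)\<^sup>2) \<le> 1" "(\<Sum>l=1..N. b l) = 8 * sqrt n"
    "\<And>l. 0 \<le> b l" and disj: "\<And>l. b l = 0 \<or> \<xi> l = 0" and n: "1 \<le> n"
  obtains S where "S \<in> sets (gauss_mat n N)" "measure (gauss_mat n N) S \<le> 2 * exp (- 2 * real n)"
    "\<And>G u. G \<in> space (gauss_mat n N) \<Longrightarrow> G \<notin> S \<Longrightarrow>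
      (\<Sum>l=1..N. \<xi> l * (\<Sum>i<n. u i * G i l)) \<le> (\<Sum>l=1..N. b l * \<bar>\<Sum>i<n. u i * G i l\<bar>)"
proof -
  let ?P = "gauss_mat n N"
  define F where "F G u = (\<Sum>l=1..N. b l * \<bar>\<Sum>i<n. u i * G i l\<bar> - \<xi> l * (\<Sum>i<n. u i * G i l))"
    for G :: "nat \<Rightarrow> nat \<Rightarrow> real" and u
  \<comment> \<open>For r = \<rho> sqrt n the exponent of the bound for \<open>A k\<close>, divided
    by n, is at most \<rho>^2 - 0.77 * 8 \<rho> + 6 \<rho> / 4.5, where 4.5 bounds the norm of the
    lattice point over sqrt n from below. The choice 13/5 is close to the minimizer and gives less
    than -28/5.\<close>
  define r where "r = 13 / 5 * sqrt n"
  have r: "0 < r" "r\<^sup>2 = 169 / 25 * n" "r * sqrt n = 13 / 5 * n"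
    using n by (simp_all add: r_def power_mult_distrib power_divide)
  define \<kappa> where "\<kappa> k = L2_set (\<lambda>i. real_of_int (k i)) {..<n}" for k
  define \<psi> where "\<psi> s l t = s * (b l * \<bar>t\<bar> - \<xi> l * t)" for s t :: real and l
  have meas: "\<psi> s l \<in> borel_measurable borel" for s l
    unfolding \<psi>_def by measurable
  have \<psi>_sum: "(\<Sum>l=1..N. \<psi> s l (\<Sum>i<n. u i * G i l)) = s * F G u" for s G u
    by (simp add: \<psi>_def F_def sum_distrib_left)
  \<comment> \<open>The bad event F <= 6 n, multiplied by the exponential parameter. The division by
    \<kappa> cancels the norm of the lattice point in the moments; it survives in the threshold
    only.\<close>
  define A where "A k = {G \<in> space ?P. - (r / \<kappa> k) * (6 * n)
      \<le> (\<Sum>l=1..N. \<psi> (- (r / \<kappa> k)) l (\<Sum>i<n. real_of_int (k i) * G i l))}" for k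
  \<comment> \<open>The bad event F >= 12 n with exponential parameter 2. Sign vectors have norm
    sqrt n, so the squares contribute at most 4 n and the sum of \<open>b\<close> contributes 16 n
    to the exponent, leaving 20 n - 24 n.\<close>
  define B where "B e = {G \<in> space ?P. 24 * n \<le> (\<Sum>l=1..N. \<psi> 2 l (\<Sum>i<n. e i * G i l))}" for e
  have A: "A k \<in> sets ?P" "measure ?P (A k) \<le> exp (- 28 / 5 * n)" if k: "k \<in> lattice_net n" for k
  proof -
    have \<kappa>: "9 / 2 * sqrt n \<le> \<kappa> k" using L2_set_lattice_net_ge[OF k] by (simp add: \<kappa>_def)
    moreover have "0 < 9 / 2 * sqrt n" using n by simp
    ultimately have \<kappa>0: "0 < \<kappa> k" by linarith
    define c where "c l = r\<^sup>2 / 2 * ((\<xi> l)\<^sup>2 + (b l)\<^sup>2) - 77 / 100 * (r * b l)" for l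
    \<comment> \<open>By \<open>disj\<close> a column carries either the linear or the absolute
      term, never both, so one of the two one-dimensional moment bounds applies.\<close>
    have c: "(\<integral>\<^sup>+t. ennreal (exp (\<psi> (- (r / \<kappa> k)) l (\<kappa> k * t))) \<partial>std_normal) \<le> ennreal (exp (c l))" for l
    proof (cases "b l = 0")
      case True
      then have "\<psi> (- (r / \<kappa> k)) l (\<kappa> k * t) = (r * \<xi> l) * t" for t
        using \<kappa>0 by (simp add: \<psi>_def)
      then show ?thesis
        using True nn_integral_std_normal_exp[of "r * \<xi> l"] by (simp add: c_def power_mult_distrib)
    next
      case False
      then have "\<xi> l = 0" using disj[of l] by simp
      then have "\<psi> (- (r / \<kappa> k)) l (\<kappa> k * t) = - (r * b l) * \<bar>t\<bar>" for t
        using \<kappa>0 by (simp add: \<psi>_def abs_mult)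
      then show ?thesis
        using \<open>\<xi> l = 0\<close> nn_integral_std_normal_exp_minus_abs[of "r * b l"] r(1) b(3)[of l]
        by (simp add: c_def power_mult_distrib)
    qed
    have chernoff: "A k \<in> sets ?P"
      "measure ?P (A k) \<le> exp ((\<Sum>l=1..N. c l) - - (r / \<kappa> k) * (6 * n))"
      unfolding A_def
      by (rule gauss_mat_chernoff(1)[where c = c, OF meas], unfold \<kappa>_def[symmetric], rule c)
        (rule gauss_mat_chernoff(2)[where c = c, OF meas], unfold \<kappa>_def[symmetric], rule c)
    then show "A k \<in> sets ?P" by simp
    have "(\<Sum>l=1..N. c l) = r\<^sup>2 / 2 * ((\<Sum>l=1..N. (\<xi> l)\<^sup>2) + (\<Sum>l=1..N. (b l)\<^sup>2)) - 77 / 100 * (r * (\<Sum>l=1..N. b l))"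
      by (simp add: c_def sum_subtractf sum_distrib_left sum.distrib algebra_simps)
    also have "\<dots> \<le> r\<^sup>2 / 2 * (1 + 1) - 77 / 100 * (r * (8 * sqrt n))"
      unfolding \<xi> b(2) using b(1) r(1) by (intro diff_mono mult_left_mono add_mono) auto
    also have "\<dots> = - 9256 / 1000 * n"
      using r by (simp add: algebra_simps)
    finally have sum_c: "(\<Sum>l=1..N. c l) \<le> - 9256 / 1000 * n" .
    have "r / \<kappa> k \<le> r / (9 / 2 * sqrt n)"
      using \<kappa> \<kappa>0 r n by (intro divide_left_mono) auto
    also have "\<dots> = 26 / 45" using n by (simp add: r_def)
    finally have "r / \<kappa> k * (6 * n) \<le> 26 / 45 * (6 * n)"
      by (intro mult_right_mono) auto
    then have "(\<Sum>l=1..N. c l) - - (r / \<kappa> k) * (6 * n) \<le> - 28 / 5 * n"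
      using sum_c by simp
    then show "measure ?P (A k) \<le> exp (- 28 / 5 * n)"
      by (intro order_trans[OF chernoff(2)]) simp
  qed
  have B: "B e \<in> sets ?P" "measure ?P (B e) \<le> exp (- 4 * n)" if e: "e \<in> sign_vectors n" for e
  proof -
    note \<kappa> = L2_set_sign_vectors[OF e]
    define c where "c l = 2 * real n * ((\<xi> l)\<^sup>2 + (b l)\<^sup>2) + 2 * sqrt n * b l" for l
    have c: "(\<integral>\<^sup>+t. ennreal (exp (\<psi> 2 l (sqrt n * t))) \<partial>std_normal) \<le> ennreal (exp (c l))" for l
    proof (cases "b l = 0")
      case True
      then have "\<psi> 2 l (sqrt n * t) = (- 2 * sqrt n * \<xi> l) * t" for t
        by (simp add: \<psi>_def)
      then show ?thesis
        using True nn_integral_std_normal_exp[of "- 2 * sqrt n * \<xi> l"] by (simp add: c_def power_mult_distrib)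
    next
      case False
      then have "\<xi> l = 0" using disj[of l] by simp
      then have "\<psi> 2 l (sqrt n * t) = (2 * sqrt n * b l) * \<bar>t\<bar>" for t
        by (simp add: \<psi>_def abs_mult)
      then show ?thesis
        using \<open>\<xi> l = 0\<close> nn_integral_std_normal_exp_abs[of "2 * sqrt n * b l"] b(3)[of l]
        by (simp add: c_def power_mult_distrib mult.assoc)
    qed
    have chernoff: "B e \<in> sets ?P" "measure ?P (B e) \<le> exp ((\<Sum>l=1..N. c l) - 24 * n)"
      unfolding B_def
      by (rule gauss_mat_chernoff(1)[where c = c, OF meas], unfold \<kappa>, rule c)
        (rule gauss_mat_chernoff(2)[where c = c, OF meas], unfold \<kappa>, rule c)
    then show "B e \<in> sets ?P" by simp
    have "(\<Sum>l=1..N. c l) = 2 * real n * ((\<Sum>l=1..N. (\<xi> l)\<^sup>2) + (\<Sum>l=1..N. (b l)\<^sup>2)) + 2 * sqrt n * (\<Sum>l=1..N. b l)"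
      by (simp add: c_def sum_distrib_left sum.distrib algebra_simps)
    also have "\<dots> \<le> 2 * real n * (1 + 1) + 2 * sqrt n * (8 * sqrt n)"
      unfolding \<xi> b(2) using b(1) by (intro add_right_mono mult_left_mono) auto
    also have "\<dots> = 20 * n" by (simp add: algebra_simps)
    finally have "(\<Sum>l=1..N. c l) - 24 * n \<le> - 4 * n" by simp
    then show "measure ?P (B e) \<le> exp (- 4 * n)"
      by (intro order_trans[OF chernoff(2)]) simp
  qed
  define S where "S = (\<Union>k\<in>lattice_net n. A k) \<union> (\<Union>e\<in>sign_vectors n. B e)"
  show ?thesis
  proof (rule that[of S])
    have SA: "(\<Union>k\<in>lattice_net n. A k) \<in> sets ?P" and SB: "(\<Union>e\<in>sign_vectors n. B e) \<in> sets ?P"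
      using A(1) B(1) finite_lattice_net finite_sign_vectors by (auto intro!: sets.finite_UN)
    then show "S \<in> sets ?P" unfolding S_def by (rule sets.Un)
    have "measure ?P S \<le> measure ?P (\<Union>k\<in>lattice_net n. A k) + measure ?P (\<Union>e\<in>sign_vectors n. B e)"
      unfolding S_def by (rule measure_Un_le[OF SA SB])
    also have "\<dots> \<le> exp (18 / 5 * n) * exp (- 28 / 5 * n) + exp n * exp (- 4 * n)"
      using A B by (intro add_mono measure_finite_UN_le prob_space_gauss_mat finite_lattice_net
        finite_sign_vectors card_lattice_net two_power_le_exp) auto
    also have "\<dots> \<le> exp (- 2 * n) + exp (- 2 * n)"
      unfolding exp_add[symmetric] by (intro add_mono) auto
    finally show "measure ?P S \<le> 2 * exp (- 2 * real n)" by simp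
    fix G u assume G: "G \<in> space ?P" "G \<notin> S"
    have "0 \<le> F G u"
    proof (rule sublinear_nonneg[where F = "F G" and n = n and A = "6 * real n"])
      show "F G (\<lambda>i. u i + v i) \<le> F G u + F G v" for u v
      proof -
        define x where "x l = (\<Sum>i<n. u i * G i l)" for l
        define y where "y l = (\<Sum>i<n. v i * G i l)" for l
        have "b l * \<bar>x l + y l\<bar> \<le> b l * (\<bar>x l\<bar> + \<bar>y l\<bar>)" for l
          by (intro mult_left_mono abs_triangle_ineq b)
        then have "(\<Sum>l=1..N. b l * \<bar>x l + y l\<bar> - \<xi> l * (x l + y l))
            \<le> (\<Sum>l=1..N. (b l * \<bar>x l\<bar> - \<xi> l * x l) + (b l * \<bar>y l\<bar> - \<xi> l * y l))"
          by (intro sum_mono) (simp add: algebra_simps)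
        then show ?thesis
          unfolding F_def row_comb_add by (simp add: x_def y_def sum.distrib)
      qed
      show "F G (\<lambda>i. c * u i) = c * F G u" if "0 \<le> c" for c u
      proof -
        define x where "x l = (\<Sum>i<n. u i * G i l)" for l
        have "F G (\<lambda>i. c * u i) = (\<Sum>l=1..N. b l * \<bar>c * x l\<bar> - \<xi> l * (c * x l))"
          by (simp only: F_def row_comb_scale x_def)
        also have "\<dots> = c * (\<Sum>l=1..N. b l * \<bar>x l\<bar> - \<xi> l * x l)"
          using that by (simp add: abs_mult sum_distrib_left algebra_simps)
        finally show ?thesis by (simp only: F_def x_def)
      qed
      show "F G u = F G v" if "\<And>i. i < n \<Longrightarrow> u i = v i" for u v
      proof -
        have "(\<Sum>i<n. u i * G i l) = (\<Sum>i<n. v i * G i l)" for l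
          using that by (intro sum.cong) auto
        then show ?thesis by (simp add: F_def)
      qed
      show "6 * real n \<le> F G (\<lambda>i. real_of_int (k i))" if k: "k \<in> lattice_net n" for k
      proof -
        have "0 < 9 / 2 * sqrt n" using n by simp
        then have "0 < \<kappa> k"
          using L2_set_lattice_net_ge[OF k] unfolding \<kappa>_def[symmetric] by linarith
        then have pos: "0 < r / \<kappa> k" using r by simp
        have "G \<notin> A k" using G k by (auto simp: S_def)
        then have "- (r / \<kappa> k) * F G (\<lambda>i. real_of_int (k i)) < - (r / \<kappa> k) * (6 * n)"
          using G by (simp only: A_def \<psi>_sum mem_Collect_eq) simp
        then have "r / \<kappa> k * (6 * n) < r / \<kappa> k * F G (\<lambda>i. real_of_int (k i))" by simp
        then show ?thesis using pos by (simp only: mult_less_cancel_left_pos less_imp_le)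
      qed
      show "F G e \<le> 2 * (6 * real n)" if "e \<in> sign_vectors n" for e
      proof -
        have "G \<notin> B e" using G that by (auto simp: S_def)
        then have "2 * F G e < 24 * n"
          using G by (simp only: B_def \<psi>_sum mem_Collect_eq) simp
        then show ?thesis by simp
      qed
    qed
    then show "(\<Sum>l=1..N. \<xi> l * (\<Sum>i<n. u i * G i l)) \<le> (\<Sum>l=1..N. b l * \<bar>\<Sum>i<n. u i * G i l\<bar>)"
      by (simp add: F_def sum_subtractf)
  qed
qed

text \<open>All other columns receive the zero function, whose exponential has mean 1.\<close>

lemma gauss_mat_column_tail:
  assumes l: "l \<in> {1..N}" and \<psi>: "\<psi> \<in> borel_measurable borel"
    and c: "(\<integral>\<^sup>+t. ennreal (exp (\<psi> (L2_set k {..<n} * t))) \<partial>std_normal) \<le> ennreal (exp c)"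
  shows "{G \<in> space (gauss_mat n N). \<theta> \<le> \<psi> (\<Sum>i<n. k i * G i l)} \<in> sets (gauss_mat n N)"
    and "measure (gauss_mat n N) {G \<in> space (gauss_mat n N). \<theta> \<le> \<psi> (\<Sum>i<n. k i * G i l)} \<le> exp (c - \<theta>)"
proof -
  define \<psi>' where "\<psi>' j t = (if j = l then \<psi> t else 0)" for j t
  define c' where "c' j = (if j = l then c else 0)" for j
  have meas: "\<psi>' j \<in> borel_measurable borel" for j
    unfolding \<psi>'_def using \<psi> by (cases "j = l") auto
  have c': "(\<integral>\<^sup>+t. ennreal (exp (\<psi>' j (L2_set k {..<n} * t))) \<partial>std_normal) \<le> ennreal (exp (c' j))" for j
    using c std_normal.emeasure_space_1 by (cases "j = l") (auto simp: \<psi>'_def c'_def)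
  have sums: "(\<Sum>j=1..N. \<psi>' j (\<Sum>i<n. k i * G i j)) = \<psi> (\<Sum>i<n. k i * G i l)" "(\<Sum>j=1..N. c' j) = c" for G
    using l by (simp_all add: \<psi>'_def c'_def)
  show "{G \<in> space (gauss_mat n N). \<theta> \<le> \<psi> (\<Sum>i<n. k i * G i l)} \<in> sets (gauss_mat n N)"
    using gauss_mat_chernoff(1)[where c = c' and \<psi> = \<psi>' and k = k and \<theta> = \<theta> and n = n and N = N, OF meas c']
    unfolding sums .
  show "measure (gauss_mat n N) {G \<in> space (gauss_mat n N). \<theta> \<le> \<psi> (\<Sum>i<n. k i * G i l)} \<le> exp (c - \<theta>)"
    using gauss_mat_chernoff(2)[where c = c' and \<psi> = \<psi>' and k = k and \<theta> = \<theta> and n = n and N = N, OF meas c']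
    unfolding sums .
qed

text \<open>The interval [a, a + 1] is disjoint from the event and has a known minimal mass z; 1 - z
  <= exp (-z) prepares for taking powers.\<close>

lemma std_normal_abs_less_le:
  assumes "0 \<le> a"
  shows "measure std_normal {t. \<bar>t\<bar> < a} \<le> exp (- exp (- (a + 1)\<^sup>2 / 2) / 3)"
proof -
  have meas: "{t. \<bar>t\<bar> < a} \<in> sets std_normal" by simp
  have "measure std_normal {t. \<bar>t\<bar> < a} + measure std_normal {a..a + 1} = measure std_normal ({t. \<bar>t\<bar> < a} \<union> {a..a + 1})"
    using meas by (intro std_normal.finite_measure_Union[symmetric]) auto
  also have "\<dots> \<le> 1" by (rule std_normal.prob_le_1)
  finally have "measure std_normal {t. \<bar>t\<bar> < a} \<le> 1 + - exp (- (a + 1)\<^sup>2 / 2) / 3"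
    using std_normal_interval_ge[OF assms] by simp
  also have "\<dots> \<le> exp (- exp (- (a + 1)\<^sup>2 / 2) / 3)" by (rule exp_ge_add_one_self)
  finally show ?thesis .
qed

text \<open>The columns are independent, so the probability is at most the one for a single column
  to the power \<open>card J\<close>.\<close>

lemma gauss_mat_all_columns_small:
  assumes J: "J \<subseteq> {1..N}" and a: "0 \<le> a" and \<kappa>: "0 < L2_set k {..<n}"
  shows "{G \<in> space (gauss_mat n N). \<forall>j\<in>J. \<bar>\<Sum>i<n. k i * G i j\<bar> < a * L2_set k {..<n}} \<in> sets (gauss_mat n N)"
    and "measure (gauss_mat n N) {G \<in> space (gauss_mat n N). \<forall>j\<in>J. \<bar>\<Sum>i<n. k i * G i j\<bar> < a * L2_set k {..<n}}
      \<le> exp (- (card J * exp (- (a + 1)\<^sup>2 / 2) / 3))"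
proof -
  let ?P = "gauss_mat n N" and ?\<kappa> = "L2_set k {..<n}"
  let ?A = "{G \<in> space ?P. \<forall>j\<in>J. \<bar>\<Sum>i<n. k i * G i j\<bar> < a * ?\<kappa>}"
  have fin: "finite J" using J finite_subset by blast
  have "{G \<in> space ?P. \<bar>\<Sum>i<n. k i * G i j\<bar> < a * ?\<kappa>} \<in> sets ?P" if "j \<in> J" for j
    using J that by (intro borel_measurable_less borel_measurable_abs borel_measurable_row_comb borel_measurable_const) auto
  then have "(\<Inter>j\<in>J. {G \<in> space ?P. \<bar>\<Sum>i<n. k i * G i j\<bar> < a * ?\<kappa>}) \<inter> space ?P \<in> sets ?P"
    using fin by (cases "J = {}") (auto intro!: sets.finite_INT)
  also have "(\<Inter>j\<in>J. {G \<in> space ?P. \<bar>\<Sum>i<n. k i * G i j\<bar> < a * ?\<kappa>}) \<inter> space ?P = ?A" by auto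
  finally show A: "?A \<in> sets ?P" .
  define f :: "nat \<Rightarrow> real \<Rightarrow> ennreal"
    where "f l = (if l \<in> J then indicator {t. \<bar>t\<bar> < a * ?\<kappa>} else (\<lambda>_. 1))" for l
  have f: "f l \<in> borel_measurable borel" for l
    unfolding f_def by (cases "l \<in> J") (auto intro!: borel_measurable_indicator)
  have "emeasure ?P ?A = (\<integral>\<^sup>+G. indicator ?A G \<partial>?P)"
    using A by simp
  also have "\<dots> \<le> (\<integral>\<^sup>+G. (\<Prod>l=1..N. f l (\<Sum>i<n. k i * G i l)) \<partial>?P)"
    by (intro nn_integral_mono) (auto simp: f_def indicator_def intro!: prod.neutral[THEN eq_refl[OF sym]])
  also have "\<dots> = (\<Prod>l=1..N. \<integral>\<^sup>+t. f l (?\<kappa> * t) \<partial>std_normal)"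
    unfolding L2_set_def by (rule nn_integral_gauss_mat_prod_row_comb) (auto intro: f)
  also have "\<dots> = (\<Prod>l\<in>{1..N}. if l \<in> J then emeasure std_normal {t. \<bar>t\<bar> < a} else 1)"
  proof (rule prod.cong[OF refl])
    fix l
    have "(\<integral>\<^sup>+t. indicator {t. \<bar>t\<bar> < a * ?\<kappa>} (?\<kappa> * t) \<partial>std_normal) = (\<integral>\<^sup>+t. indicator {t. \<bar>t\<bar> < a} t \<partial>std_normal)"
      using \<kappa> by (intro nn_integral_cong) (auto simp: indicator_def abs_mult mult.commute)
    also have "\<dots> = emeasure std_normal {t. \<bar>t\<bar> < a}" by simp
    finally show "(\<integral>\<^sup>+t. f l (?\<kappa> * t) \<partial>std_normal) = (if l \<in> J then emeasure std_normal {t. \<bar>t\<bar> < a} else 1)"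
      using std_normal.emeasure_space_1 by (simp add: f_def)
  qed
  also have "\<dots> = emeasure std_normal {t. \<bar>t\<bar> < a} ^ card J"
    using J by (simp add: prod.If_cases Int_absorb1)
  also have "\<dots> = ennreal (measure std_normal {t. \<bar>t\<bar> < a} ^ card J)"
    by (simp add: std_normal.emeasure_eq_measure ennreal_power)
  also have "\<dots> \<le> ennreal (exp (- exp (- (a + 1)\<^sup>2 / 2) / 3) ^ card J)"
    using std_normal_abs_less_le[OF a] by (intro ennreal_leI power_mono) auto
  also have "exp (- exp (- (a + 1)\<^sup>2 / 2) / 3) ^ card J = exp (- (card J * exp (- (a + 1)\<^sup>2 / 2) / 3))"
    by (simp add: exp_of_nat_mult[symmetric])
  finally show "measure ?P ?A \<le> exp (- (card J * exp (- (a + 1)\<^sup>2 / 2) / 3))"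
    by (simp add: gauss_mat.emeasure_eq_measure)
qed

lemma gauss_max_event:
  fixes n N p :: nat and J :: "nat set"
  defines "L \<equiv> sqrt (ln (2 * real (card J)))"
  assumes J: "J \<subseteq> {1..N}" "J \<noteq> {}" and p: "p \<in> {1..N}" and n: "1 \<le> n" and L: "15 * sqrt n \<le> L"
  obtains S where "S \<in> sets (gauss_mat n N)" "measure (gauss_mat n N) S \<le> 2 * exp (- 2 * real n)"
    "\<And>G u. G \<in> space (gauss_mat n N) \<Longrightarrow> G \<notin> S \<Longrightarrow>
      \<exists>j\<in>J. (\<Sum>i<n. u i * G i p) \<le> 30 * sqrt n / L * \<bar>\<Sum>i<n. u i * G i j\<bar>"
proof -
  let ?P = "gauss_mat n N"
  have fin: "finite J" using J finite_subset by blast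
  have m: "1 \<le> real (card J)" using J fin by (simp add: Suc_leI card_gt_0_iff One_nat_def)
  have sn: "1 \<le> sqrt n" using n by simp
  have L15: "15 \<le> L" using L sn by linarith
  have L2: "L\<^sup>2 = ln (2 * real (card J))" using m by (simp add: L_def)
  then have expL: "exp (L\<^sup>2) = 2 * real (card J)" using m by simp
  have L2n: "225 * n \<le> L\<^sup>2"
  proof -
    have "(15 * sqrt n)\<^sup>2 \<le> L\<^sup>2" using L by (intro power_mono) auto
    then show ?thesis by (simp add: power_mult_distrib)
  qed
  have L2L: "15 * L \<le> L\<^sup>2" using L15 by (simp add: power2_eq_square)
  \<comment> \<open>At a lattice point of norm \<kappa> the maximum is at least L \<kappa> / 2 and
    the entry in column \<open>p\<close> is below 5 sqrt n \<kappa>, so F >= (15 - 5) sqrt n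
    \<kappa> >= 45 n. At a sign vector the maximum is at most 2 L sqrt n, so F <= 60 n + 5 n. Thus A
    = 40 n meets both demands of \<open>sublinear_nonneg\<close>.\<close>
  define \<beta> where "\<beta> = 30 * sqrt n / L"
  have \<beta>: "0 \<le> \<beta>" "\<beta> * (L / 2) = 15 * sqrt n" "\<beta> * (2 * L * sqrt n) = 60 * n"
    using L15 by (simp_all add: \<beta>_def)
  define M where "M G u = (MAX j\<in>J. \<bar>\<Sum>i<n. u i * G i j\<bar>)" for G :: "nat \<Rightarrow> nat \<Rightarrow> real" and u
  have M_ge: "\<bar>\<Sum>i<n. u i * G i j\<bar> \<le> M G u" if "j \<in> J" for G u j
    unfolding M_def using fin that by (intro Max_ge) auto
  have M_le: "M G u \<le> x" if "\<And>j. j \<in> J \<Longrightarrow> \<bar>\<Sum>i<n. u i * G i j\<bar> \<le> x" for G u x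
    unfolding M_def using fin J(2) that by (subst Max_le_iff) auto
  have M_attained: "\<exists>j\<in>J. M G u = \<bar>\<Sum>i<n. u i * G i j\<bar>" for G u
  proof -
    have "M G u \<in> (\<lambda>j. \<bar>\<Sum>i<n. u i * G i j\<bar>) ` J"
      unfolding M_def using fin J(2) by (intro Max_in) auto
    then show ?thesis by auto
  qed
  define F where "F G u = \<beta> * M G u - (\<Sum>i<n. u i * G i p)" for G :: "nat \<Rightarrow> nat \<Rightarrow> real" and u
  define v where "v k i = real_of_int (k i)" for k :: "nat \<Rightarrow> int" and i :: nat
  define \<kappa> where "\<kappa> k = L2_set (v k) {..<n}" for k
  have \<kappa>1: "9 / 2 * sqrt n \<le> \<kappa> k" if "k \<in> lattice_net n" for k
    using L2_set_lattice_net_ge[OF that] by (simp add: \<kappa>_def v_def[abs_def])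
  have \<kappa>2: "0 < \<kappa> k" if "k \<in> lattice_net n" for k
    using \<kappa>1[OF that] sn by linarith
  note \<kappa> = \<kappa>1 \<kappa>2
  define A1 where "A1 k = {G \<in> space ?P. \<forall>j\<in>J. \<bar>\<Sum>i<n. v k i * G i j\<bar> < L / 2 * \<kappa> k}" for k
  define A2 where "A2 k = {G \<in> space ?P. 25 * n \<le> 5 * sqrt n / \<kappa> k * (\<Sum>i<n. v k i * G i p)}" for k
  define B1 where "B1 e = {G \<in> space ?P. 25 * n \<le> - 5 * (\<Sum>i<n. e i * G i p)}"
    for e :: "nat \<Rightarrow> real"
  define B2 where "B2 z = {G \<in> space ?P. 4 * L\<^sup>2 \<le> 2 * L / sqrt n * \<bar>\<Sum>i<n. fst z i * G i (snd z)\<bar>}"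
    for z :: "(nat \<Rightarrow> real) \<times> nat"
  have A1: "A1 k \<in> sets ?P" "measure ?P (A1 k) \<le> exp (- 7 * n)" if k: "k \<in> lattice_net n" for k
  proof -
    have \<kappa>': "0 < L2_set (v k) {..<n}" using \<kappa>(2)[OF k] by (simp add: \<kappa>_def)
    have a: "0 \<le> L / 2" using L15 by simp
    show "A1 k \<in> sets ?P"
      unfolding A1_def \<kappa>_def by (rule gauss_mat_all_columns_small(1)[OF J(1) a \<kappa>'])
    \<comment> \<open>The number of columns is exp (L^2) / 2, while the tail at L / 2 + 1 costs at
      most a factor exp (L^2 / 4 + 1). The surplus is far above the 7 n required.\<close>
    have "7 * real n * 6 \<le> 3 / 4 * L\<^sup>2"
      using L2n by simp
    also have "\<dots> \<le> exp (3 / 4 * L\<^sup>2 - 1)"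
      using exp_ge_add_one_self[of "3 / 4 * L\<^sup>2 - 1"] by simp
    also have "\<dots> \<le> exp (L\<^sup>2 - (L / 2 + 1)\<^sup>2 / 2)"
    proof -
      have "(L / 2 + 1)\<^sup>2 / 2 \<le> L\<^sup>2 / 4 + 1"
        using zero_le_power2[of "L / 2 - 1"] by (simp add: power2_eq_square field_simps)
      then show ?thesis by simp
    qed
    also have "\<dots> = 2 * real (card J) * exp (- (L / 2 + 1)\<^sup>2 / 2)"
      unfolding expL[symmetric] exp_add[symmetric] by simp
    finally have "7 * real n \<le> card J * exp (- (L / 2 + 1)\<^sup>2 / 2) / 3" by simp
    then show "measure ?P (A1 k) \<le> exp (- 7 * n)"
      unfolding A1_def \<kappa>_def
      by (intro order_trans[OF gauss_mat_all_columns_small(2)[OF J(1) a \<kappa>']]) simp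
  qed
  have A2: "A2 k \<in> sets ?P" "measure ?P (A2 k) \<le> exp (- 7 * n)" if k: "k \<in> lattice_net n" for k
  proof -
    have "5 * sqrt n / \<kappa> k * (\<kappa> k * t) = (5 * sqrt n) * t" for t
      using \<kappa>(2)[OF k] by simp
    then have c: "(\<integral>\<^sup>+t. ennreal (exp (5 * sqrt n / \<kappa> k * (\<kappa> k * t))) \<partial>std_normal) \<le> ennreal (exp (25 / 2 * n))"
      using nn_integral_std_normal_exp[of "5 * sqrt n"] by (simp add: power_mult_distrib)
    have meas: "(\<lambda>t. 5 * sqrt n / \<kappa> k * t) \<in> borel_measurable borel" by simp
    show "A2 k \<in> sets ?P"
      unfolding A2_def
      by (rule gauss_mat_column_tail(1)[OF p meas, of "v k" n "25 / 2 * n"]) (use c in \<open>simp only: \<kappa>_def\<close>)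
    have "measure ?P (A2 k) \<le> exp (25 / 2 * n - 25 * n)"
      unfolding A2_def
      by (rule gauss_mat_column_tail(2)[OF p meas, of "v k" n "25 / 2 * n"]) (use c in \<open>simp only: \<kappa>_def\<close>)
    also have "\<dots> \<le> exp (- 7 * n)" by simp
    finally show "measure ?P (A2 k) \<le> exp (- 7 * n)" .
  qed
  have B1: "B1 e \<in> sets ?P" "measure ?P (B1 e) \<le> exp (- 7 * n)" if e: "e \<in> sign_vectors n" for e
  proof -
    have "- 5 * (sqrt n * t) = (- 5 * sqrt n) * t" for t by simp
    then have c: "(\<integral>\<^sup>+t. ennreal (exp (- 5 * (L2_set e {..<n} * t))) \<partial>std_normal) \<le> ennreal (exp (25 / 2 * n))"
      using nn_integral_std_normal_exp[of "- 5 * sqrt n"] unfolding L2_set_sign_vectors[OF e]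
      by (simp add: power_mult_distrib mult.assoc)
    have meas: "(\<lambda>t. - 5 * t) \<in> borel_measurable (borel :: real measure)" by simp
    show "B1 e \<in> sets ?P"
      unfolding B1_def by (rule gauss_mat_column_tail(1)[OF p meas c])
    have "measure ?P (B1 e) \<le> exp (25 / 2 * n - 25 * n)"
      unfolding B1_def by (rule gauss_mat_column_tail(2)[OF p meas c])
    also have "\<dots> \<le> exp (- 7 * n)" by simp
    finally show "measure ?P (B1 e) \<le> exp (- 7 * n)" .
  qed
  have B2: "B2 z \<in> sets ?P" "measure ?P (B2 z) \<le> exp (2 * L - 2 * L\<^sup>2)" if z: "z \<in> sign_vectors n \<times> J" for z
  proof -
    have e: "fst z \<in> sign_vectors n" and j: "snd z \<in> {1..N}" using z J by auto
    have "2 * L / sqrt n * \<bar>sqrt n * t\<bar> = (2 * L) * \<bar>t\<bar>" for t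
      using sn by (simp add: abs_mult)
    then have c: "(\<integral>\<^sup>+t. ennreal (exp (2 * L / sqrt n * \<bar>L2_set (fst z) {..<n} * t\<bar>)) \<partial>std_normal) \<le> ennreal (exp (2 * L\<^sup>2 + 2 * L))"
      using nn_integral_std_normal_exp_abs[of "2 * L"] L15 unfolding L2_set_sign_vectors[OF e]
      by (simp add: power_mult_distrib)
    have meas: "(\<lambda>t. 2 * L / sqrt n * \<bar>t\<bar>) \<in> borel_measurable borel" by simp
    show "B2 z \<in> sets ?P"
      unfolding B2_def by (rule gauss_mat_column_tail(1)[OF j meas c])
    have "measure ?P (B2 z) \<le> exp (2 * L\<^sup>2 + 2 * L - 4 * L\<^sup>2)"
      unfolding B2_def by (rule gauss_mat_column_tail(2)[OF j meas c])
    also have "\<dots> = exp (2 * L - 2 * L\<^sup>2)" by simp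
    finally show "measure ?P (B2 z) \<le> exp (2 * L - 2 * L\<^sup>2)" .
  qed
  define SA1 where "SA1 = (\<Union>k\<in>lattice_net n. A1 k)"
  define SA2 where "SA2 = (\<Union>k\<in>lattice_net n. A2 k)"
  define SB1 where "SB1 = (\<Union>e\<in>sign_vectors n. B1 e)"
  define SB2 where "SB2 = (\<Union>z\<in>sign_vectors n \<times> J. B2 z)"
  define S where "S = (SA1 \<union> SA2) \<union> (SB1 \<union> SB2)"
  have sets: "SA1 \<in> sets ?P" "SA2 \<in> sets ?P" "SB1 \<in> sets ?P" "SB2 \<in> sets ?P"
    unfolding SA1_def SA2_def SB1_def SB2_def
    using A1(1) A2(1) B1(1) B2(1) finite_lattice_net finite_sign_vectors fin
    by (auto intro!: sets.finite_UN)
  have half: "exp (- 3 * real n) \<le> exp (- 2 * n) / 2"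
  proof -
    have "exp (- real n) \<le> 1 / 2"
    proof -
      have "2 \<le> exp (real n)" using exp_ge_add_one_self[of "real n"] n by linarith
      then show ?thesis by (simp add: exp_minus field_simps)
    qed
    then have "exp (- 2 * real n) * exp (- real n) \<le> exp (- 2 * real n) * (1 / 2)" by (intro mult_left_mono) auto
    then show ?thesis by (simp flip: exp_add)
  qed
  have small: "measure ?P SA1 \<le> exp (- 2 * n) / 2" "measure ?P SA2 \<le> exp (- 2 * n) / 2"
    "measure ?P SB1 \<le> exp (- 2 * n) / 2" "measure ?P SB2 \<le> exp (- 2 * n) / 2"
  proof -
    have "measure ?P SA1 \<le> exp (18 / 5 * n) * exp (- 7 * n)"
      unfolding SA1_def using A1
      by (intro measure_finite_UN_le prob_space_gauss_mat finite_lattice_net card_lattice_net) auto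
    also have "\<dots> \<le> exp (- 3 * real n)" unfolding exp_add[symmetric] by simp
    finally show "measure ?P SA1 \<le> exp (- 2 * n) / 2" using half by simp
    have "measure ?P SA2 \<le> exp (18 / 5 * n) * exp (- 7 * n)"
      unfolding SA2_def using A2
      by (intro measure_finite_UN_le prob_space_gauss_mat finite_lattice_net card_lattice_net) auto
    also have "\<dots> \<le> exp (- 3 * real n)" unfolding exp_add[symmetric] by simp
    finally show "measure ?P SA2 \<le> exp (- 2 * n) / 2" using half by simp
    have "measure ?P SB1 \<le> exp n * exp (- 7 * n)"
      unfolding SB1_def using B1
      by (intro measure_finite_UN_le prob_space_gauss_mat finite_sign_vectors two_power_le_exp) auto
    also have "\<dots> \<le> exp (- 3 * real n)" unfolding exp_add[symmetric] by simp
    finally show "measure ?P SB1 \<le> exp (- 2 * n) / 2" using half by simp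
    \<comment> \<open>This union runs over the columns too. The factor exp (L^2) is absorbed by exp
      (2 L - 2 L^2), because L^2 is at least both 225 n and 15 L.\<close>
    have "real (card (sign_vectors n \<times> J)) \<le> exp n * exp (L\<^sup>2)"
      unfolding card_cartesian_product of_nat_mult expL using m two_power_le_exp[of n]
      by (intro mult_mono) auto
    then have "measure ?P SB2 \<le> (exp n * exp (L\<^sup>2)) * exp (2 * L - 2 * L\<^sup>2)"
      unfolding SB2_def using B2
      by (intro measure_finite_UN_le prob_space_gauss_mat finite_cartesian_product finite_sign_vectors fin) auto
    also have "\<dots> \<le> exp (- 3 * real n)"
      unfolding exp_add[symmetric] using L2n L2L by simp
    finally show "measure ?P SB2 \<le> exp (- 2 * n) / 2" using half by simp
  qed
  show ?thesis
  proof (rule that[of S])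
    show "S \<in> sets ?P" unfolding S_def using sets by (intro sets.Un)
    have "measure ?P S \<le> (measure ?P SA1 + measure ?P SA2) + (measure ?P SB1 + measure ?P SB2)"
      unfolding S_def using sets
      by (intro order_trans[OF measure_Un_le] add_mono measure_Un_le sets.Un) auto
    then show "measure ?P S \<le> 2 * exp (- 2 * real n)"
      using small by simp
    fix G u assume G: "G \<in> space ?P" "G \<notin> S"
    have "0 \<le> F G u"
    proof (rule sublinear_nonneg[where F = "F G" and n = n and A = "40 * real n"])
      fix u v
      have "M G (\<lambda>i. u i + v i) \<le> M G u + M G v"
      proof (rule M_le)
        fix j assume "j \<in> J"
        then show "\<bar>\<Sum>i<n. (u i + v i) * G i j\<bar> \<le> M G u + M G v"
          using M_ge[of j u G] M_ge[of j v G] unfolding row_comb_add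
          by (intro order_trans[OF abs_triangle_ineq]) linarith
      qed
      from mult_left_mono[OF this \<beta>(1)] show "F G (\<lambda>i. u i + v i) \<le> F G u + F G v"
        unfolding F_def row_comb_add by (simp add: algebra_simps)
    next
      fix c :: real and u assume c: "0 \<le> c"
      have "M G (\<lambda>i. c * u i) = c * M G u"
      proof (rule antisym)
        show "M G (\<lambda>i. c * u i) \<le> c * M G u"
        proof (rule M_le)
          fix j assume "j \<in> J"
          then show "\<bar>\<Sum>i<n. c * u i * G i j\<bar> \<le> c * M G u"
            unfolding row_comb_scale abs_mult using c M_ge[of j u G] by (simp add: mult_left_mono)
        qed
        obtain j where j: "j \<in> J" "M G u = \<bar>\<Sum>i<n. u i * G i j\<bar>" using M_attained by blast
        then have "c * M G u = \<bar>\<Sum>i<n. c * u i * G i j\<bar>"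
          unfolding row_comb_scale abs_mult using c by simp
        also have "\<dots> \<le> M G (\<lambda>i. c * u i)" using j(1) by (rule M_ge)
        finally show "c * M G u \<le> M G (\<lambda>i. c * u i)" .
      qed
      then show "F G (\<lambda>i. c * u i) = c * F G u"
        unfolding F_def row_comb_scale by (simp add: algebra_simps)
    next
      fix u v :: "nat \<Rightarrow> real" assume "\<And>i. i < n \<Longrightarrow> u i = v i"
      then have "(\<Sum>i<n. u i * G i l) = (\<Sum>i<n. v i * G i l)" for l
        by (intro sum.cong) auto
      then show "F G u = F G v" by (simp add: F_def M_def)
    next
      fix k assume k: "k \<in> lattice_net n"
      have "G \<notin> A1 k" "G \<notin> A2 k" using G k by (auto simp: S_def SA1_def SA2_def)
      then obtain j where j: "j \<in> J" "L / 2 * \<kappa> k \<le> \<bar>\<Sum>i<n. v k i * G i j\<bar>"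
        and A2': "5 * sqrt n / \<kappa> k * (\<Sum>i<n. v k i * G i p) < 25 * n"
        using G by (auto simp: A1_def A2_def not_less not_le)
      have "5 * sqrt n * (\<Sum>i<n. v k i * G i p) < 5 * sqrt n * (5 * sqrt n * \<kappa> k)"
        using A2' \<kappa>(2)[OF k] by (simp add: field_simps)
      then have p_le: "(\<Sum>i<n. v k i * G i p) < 5 * sqrt n * \<kappa> k"
        by (rule mult_left_less_imp_less) simp
      have "L / 2 * \<kappa> k \<le> M G (v k)"
        using j M_ge[OF j(1), of "v k" G] by simp
      from mult_left_mono[OF this \<beta>(1)] have "15 * sqrt n * \<kappa> k \<le> \<beta> * M G (v k)"
        using \<beta>(2) by (simp only: mult.assoc[symmetric])
      then have "10 * sqrt n * \<kappa> k \<le> F G (v k)"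
        using p_le by (simp add: F_def)
      moreover have "10 * sqrt n * (9 / 2 * sqrt n) \<le> 10 * sqrt n * \<kappa> k"
        using \<kappa>(1)[OF k] by (intro mult_left_mono) auto
      moreover have "10 * sqrt n * (9 / 2 * sqrt n) = 45 * n" by simp
      ultimately have "45 * n \<le> F G (v k)" by linarith
      then show "40 * real n \<le> F G (\<lambda>i. real_of_int (k i))"
        by (simp add: v_def[abs_def])
    next
      fix e assume e: "e \<in> sign_vectors n"
      have "M G e \<le> 2 * L * sqrt n"
      proof (rule M_le)
        fix j assume j: "j \<in> J"
        have "G \<notin> B2 (e, j)" using G e j by (auto simp: S_def SB2_def)
        then have "2 * L / sqrt n * \<bar>\<Sum>i<n. e i * G i j\<bar> < 4 * L\<^sup>2"
          using G by (simp add: B2_def not_le)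
        then have "2 * L * \<bar>\<Sum>i<n. e i * G i j\<bar> < 2 * L * (2 * L * sqrt n)"
          using sn by (simp add: field_simps power2_eq_square)
        then show "\<bar>\<Sum>i<n. e i * G i j\<bar> \<le> 2 * L * sqrt n"
          using L15 by (simp add: mult_less_cancel_left_pos)
      qed
      from mult_left_mono[OF this \<beta>(1)] have "\<beta> * M G e \<le> 60 * n" using \<beta>(3) by simp
      moreover have "- (\<Sum>i<n. e i * G i p) \<le> 5 * n"
      proof -
        have "G \<notin> B1 e" using G e by (auto simp: S_def SB1_def)
        then show ?thesis using G by (simp add: B1_def not_le)
      qed
      ultimately show "F G e \<le> 2 * (40 * real n)" by (simp add: F_def)
    qed
    moreover obtain j where "j \<in> J" "M G u = \<bar>\<Sum>i<n. u i * G i j\<bar>" using M_attained by blast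
    ultimately show "\<exists>j\<in>J. (\<Sum>i<n. u i * G i p) \<le> 30 * sqrt n / L * \<bar>\<Sum>i<n. u i * G i j\<bar>"
      by (intro bexI[of _ j]) (auto simp: F_def \<beta>_def)
  qed
qed

section \<open>Convex bodies meeting the kernel\<close>

text \<open>The complementary event, radius below \<rho>, is an open set of subspaces, so
  \<open>haar_le_gauss\<close> bounds its Haar measure by the measure of the exceptional set of
  matrices.\<close>

lemma haar_radius_event:
  assumes haar: "is_haar_grassmannian N (N - n) \<mu>" and n: "n < N" and p: "1 \<le> p"
    and \<sigma>: "\<forall>i\<in>{1..N}. 0 \<le> \<sigma> i"
    and S: "S \<in> sets (gauss_mat n N)" "measure (gauss_mat n N) S \<le> e"
    and radius: "\<And>G. G \<in> space (gauss_mat n N) \<Longrightarrow> G \<notin> S \<Longrightarrow> full_rank N n G \<Longrightarrow>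
      \<rho> \<le> random_radius N \<sigma> p (gauss_ker N n G)"
  shows "1 - e \<le> measure \<mu> {E \<in> space \<mu>. \<rho> \<le> random_radius N \<sigma> p E}"
proof -
  have \<mu>: "prob_space \<mu>" "space \<mu> = grassmannian N (N - n)" "sets \<mu> = sets (grass_borel N (N - n))"
    using haar by (auto simp: is_haar_grassmannian_def)
  interpret prob_space \<mu> by fact
  define B where "B = {E \<in> grassmannian N (N - n). random_radius N \<sigma> p E < \<rho>}"
  have B: "openin (grass.mtopology N (N - n)) B"
    unfolding B_def using p n \<sigma> by (intro openin_random_radius_less) auto
  then have B_sets: "B \<in> sets \<mu>"
    unfolding \<mu> by (auto simp: grass_borel_def sets_measure_of_conv grass.openin_mtopology)
  have "emeasure \<mu> B \<le> emeasure (gauss_mat n N) S"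
  proof (rule haar_le_gauss[OF haar _ B S(1)])
    fix G assume G: "G \<in> space (gauss_mat n N)" "full_rank N n G" "gauss_ker N n G \<in> B"
    then show "G \<in> S" using radius[OF G(1) _ G(2)] by (auto simp: B_def)
  qed (use n in simp)
  then have "measure \<mu> B \<le> measure (gauss_mat n N) S"
    by (simp add: emeasure_eq_measure gauss_mat.emeasure_eq_measure)
  moreover have "measure \<mu> (space \<mu> - B) = 1 - measure \<mu> B"
    using B_sets by (rule prob_compl)
  moreover have "space \<mu> - B = {E \<in> space \<mu>. \<rho> \<le> random_radius N \<sigma> p E}"
    by (auto simp: B_def \<mu>)
  ultimately show ?thesis using S(2) by simp
qed

lemma sum_comb_eucl_inner:
  "(\<Sum>j<n. u j * eucl_inner N (G j) y) = (\<Sum>i=1..N. (\<Sum>j<n. u j * G j i) * y i)" for n :: nat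
  unfolding eucl_inner_def sum_distrib_left sum_distrib_right
  by (subst sum.swap) (simp add: mult.assoc)

lemma mem_gauss_ker:
  assumes "full_rank N n G" "y \<in> eucl N" "\<And>i. i < n \<Longrightarrow> eucl_inner N (G i) y = 0"
  shows "y \<in> gauss_ker N n G"
  unfolding frame_ker_gram_schmidt[OF assms(1)] using assms by (simp add: frame_ker_def)

lemma box_kernel_radius:
  assumes G: "full_rank N n G" and p: "1 \<le> p" and \<sigma>: "\<forall>i\<in>{1..N}. 0 \<le> \<sigma> i" and n: "n < N"
    and crit: "\<And>u. (\<Sum>l=1..N. x l * (\<Sum>i<n. u i * G i l)) \<le> \<tau> * (\<Sum>l=1..N. a l * \<bar>\<Sum>i<n. u i * G i l\<bar>)"
    and x: "x \<in> eucl N" and a: "\<And>i. 0 \<le> a i" "a \<in> eucl N" and disj: "\<And>i. a i = 0 \<or> x i = 0" and \<tau>: "0 \<le> \<tau>"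
    and mem: "\<And>y. y \<in> eucl N \<Longrightarrow> (\<And>i. \<bar>y i - x i\<bar> \<le> \<tau> * a i) \<Longrightarrow> fun_scale (1 / (1 + \<tau>)) y \<in> ellipsoid N \<sigma> p"
  shows "eucl_norm N x / (1 + \<tau>) \<le> random_radius N \<sigma> p (gauss_ker N n G)"
proof -
  define M where "M = {y :: nat \<Rightarrow> real. \<forall>i. x i - \<tau> * a i \<le> y i \<and> y i \<le> x i + \<tau> * a i}"
  have M_iff: "y \<in> M \<longleftrightarrow> (\<forall>i. \<bar>y i - x i\<bar> \<le> \<tau> * a i)" for y
    unfolding M_def mem_Collect_eq abs_le_iff by (intro iff_allI) linarith
  have M_eucl: "y \<in> eucl N" if "y \<in> M" for y
  proof -
    have "y i = 0" if "i \<notin> {1..N}" for i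
      using \<open>y \<in> M\<close>[unfolded M_iff, rule_format, of i] that x a(2) by (auto simp: eucl_def)
    then show ?thesis by (simp add: eucl_def)
  qed
  have compact: "compact M" unfolding M_def by (rule compact_box)
  have "x \<in> M" using a \<tau> by (simp add: M_iff)
  then have ne: "M \<noteq> {}" by blast
  have convex: "(\<lambda>i. (1 - t) * y i + t * z i) \<in> M" if "y \<in> M" "z \<in> M" "0 \<le> t" "t \<le> 1" for y z t
    unfolding M_iff
  proof
    fix i
    have "\<bar>(1 - t) * y i + t * z i - x i\<bar> = \<bar>(1 - t) * (y i - x i) + t * (z i - x i)\<bar>"
      by (simp add: algebra_simps)
    also have "\<dots> \<le> (1 - t) * \<bar>y i - x i\<bar> + t * \<bar>z i - x i\<bar>"
      using that by (intro order_trans[OF abs_triangle_ineq]) (simp add: abs_mult)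
    also have "\<dots> \<le> (1 - t) * (\<tau> * a i) + t * (\<tau> * a i)"
      using that by (intro add_mono mult_left_mono) (auto simp: M_iff)
    finally show "\<bar>(1 - t) * y i + t * z i - x i\<bar> \<le> \<tau> * a i" by (simp add: algebra_simps)
  qed
  have sep: "\<exists>y\<in>M. (\<Sum>i<n. u i * eucl_inner N (G i) y) \<le> 0" for u
  proof
    define t where "t l = (\<Sum>i<n. u i * G i l)" for l
    \<comment> \<open>The point of the box at which the linear functional \<open>t\<close> is
      smallest.\<close>
    define y where "y l = x l - \<tau> * a l * sgn (t l)" for l
    have "\<tau> * a l * \<bar>sgn (t l)\<bar> \<le> \<tau> * a l * 1" for l
      using a \<tau> by (intro mult_left_mono) (auto simp: sgn_if)
    then show "y \<in> M"
      using a \<tau> by (simp add: M_iff y_def abs_mult)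
    have "(\<Sum>i<n. u i * eucl_inner N (G i) y) = (\<Sum>l=1..N. t l * y l)"
      unfolding sum_comb_eucl_inner t_def ..
    also have "\<dots> = (\<Sum>l=1..N. x l * t l) - \<tau> * (\<Sum>l=1..N. a l * \<bar>t l\<bar>)"
    proof -
      have "t l * y l = x l * t l - \<tau> * (a l * \<bar>t l\<bar>)" for l
        by (simp add: y_def algebra_simps abs_sgn)
      then show ?thesis by (simp add: sum_subtractf sum_distrib_left)
    qed
    also have "\<dots> \<le> 0" using crit[of u] by (simp add: t_def)
    finally show "(\<Sum>i<n. u i * eucl_inner N (G i) y) \<le> 0" .
  qed
  obtain y where y: "y \<in> M" "\<And>i. i < n \<Longrightarrow> eucl_inner N (G i) y = 0"
    using compact_convex_meets_kernel[OF compact ne convex sep] by blast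
  define z where "z = fun_scale (1 / (1 + \<tau>)) y"
  have "z \<in> gauss_ker N n G"
    unfolding z_def using y M_eucl[OF y(1)]
    by (intro mem_gauss_ker G eucl_scale) (auto simp: eucl_inner_scale_right)
  moreover have "z \<in> ellipsoid N \<sigma> p"
    unfolding z_def using y(1) by (intro mem M_eucl) (auto simp: M_iff)
  ultimately have "eucl_norm N z \<le> random_radius N \<sigma> p (gauss_ker N n G)"
    using p \<sigma> by (rule random_radius_upper)
  moreover have "eucl_norm N z = eucl_norm N y / (1 + \<tau>)"
    using \<tau> by (simp add: z_def eucl_norm_scale)
  moreover have "eucl_norm N x \<le> eucl_norm N y"
    unfolding L2_set_def
  proof (intro real_sqrt_le_mono sum_mono)
    fix i
    \<comment> \<open>The box has width zero wherever \<open>x\<close> is nonzero, so the norm of a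
      point of the box is at least the norm of \<open>x\<close>.\<close>
    have "y i = x i \<or> x i = 0"
      using disj[of i] y(1)[unfolded M_iff, rule_format, of i] by auto
    then show "(x i)\<^sup>2 \<le> (y i)\<^sup>2" by auto
  qed
  then have "eucl_norm N x / (1 + \<tau>) \<le> eucl_norm N y / (1 + \<tau>)"
    using \<tau> by (intro divide_right_mono) auto
  ultimately show ?thesis by simp
qed

lemma haar_box_radius:
  assumes haar: "is_haar_grassmannian N (N - n) \<mu>" and n: "1 \<le> n" "n < N" and p: "1 \<le> p"
    and \<sigma>: "\<forall>i\<in>{1..N}. 0 \<le> \<sigma> i"
    and x: "x \<in> eucl N" "0 < eucl_norm N x" and a: "\<And>i. 0 \<le> a i" "a \<in> eucl N" and disj: "\<And>i. a i = 0 \<or> x i = 0"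
    and T: "0 < (\<Sum>i=1..N. a i)" "8 * sqrt n * eucl_norm N a \<le> (\<Sum>i=1..N. a i)"
    and mem: "\<And>y \<tau>. 0 \<le> \<tau> \<Longrightarrow> y \<in> eucl N \<Longrightarrow> (\<And>i. \<bar>y i - x i\<bar> \<le> \<tau> * a i) \<Longrightarrow>
      fun_scale (1 / (1 + \<tau>)) y \<in> ellipsoid N \<sigma> p"
  shows "1 - 2 * exp (- 2 * real n) \<le> measure \<mu> {E \<in> space \<mu>.
    inverse (1 / eucl_norm N x + 8 * sqrt n / (\<Sum>i=1..N. a i)) \<le> random_radius N \<sigma> p E}"
proof -
  define r where "r = eucl_norm N x"
  define T where "T = (\<Sum>i=1..N. a i)"
  \<comment> \<open>With this \<tau> the quotient r / (1 + \<tau>) is the asserted bound, and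
    dividing \<open>x\<close> and \<tau> \<open>a\<close> by \<open>r\<close> gives the normalized
    \<xi> and \<open>b\<close>.\<close>
  define \<tau> where "\<tau> = 8 * sqrt n * r / T"
  define \<xi> where "\<xi> l = x l / r" for l
  define b where "b l = 8 * sqrt n * a l / T" for l
  have r: "0 < r" and T: "0 < T" "8 * sqrt n * eucl_norm N a \<le> T" using x T by (simp_all add: r_def T_def)
  then have \<tau>: "0 \<le> \<tau>" by (simp add: \<tau>_def)
  have "(\<Sum>l=1..N. (\<xi> l)\<^sup>2) = (\<Sum>l=1..N. (x l)\<^sup>2) / r\<^sup>2"
    by (simp add: \<xi>_def power_divide sum_divide_distrib)
  also have "\<dots> = 1"
    using r by (simp add: r_def L2_set_def sum_nonneg)
  finally have \<xi>: "(\<Sum>l=1..N. (\<xi> l)\<^sup>2) = 1" .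
  have "(\<Sum>l=1..N. (b l)\<^sup>2) = (8 * sqrt n)\<^sup>2 * (\<Sum>l=1..N. (a l)\<^sup>2) / T\<^sup>2"
    by (simp add: b_def power_divide power_mult_distrib sum_divide_distrib sum_distrib_left)
  also have "(\<Sum>l=1..N. (a l)\<^sup>2) = (eucl_norm N a)\<^sup>2"
    by (simp add: L2_set_def sum_nonneg)
  also have "(8 * sqrt n)\<^sup>2 * (eucl_norm N a)\<^sup>2 / T\<^sup>2 = (8 * sqrt n * eucl_norm N a / T)\<^sup>2"
    by (simp add: power_divide power_mult_distrib)
  also have "\<dots> \<le> 1"
    using T eucl_norm_nonneg[of a N] by (intro power_le_one) auto
  finally have b2: "(\<Sum>l=1..N. (b l)\<^sup>2) \<le> 1" .
  have b1: "(\<Sum>l=1..N. b l) = 8 * sqrt n"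
    using T by (simp add: b_def sum_divide_distrib[symmetric] sum_distrib_left[symmetric] flip: T_def)
  have b0: "0 \<le> b l" for l using a T by (simp add: b_def)
  have disj': "b l = 0 \<or> \<xi> l = 0" for l using disj[of l] by (auto simp: b_def \<xi>_def)
  obtain S where S: "S \<in> sets (gauss_mat n N)" "measure (gauss_mat n N) S \<le> 2 * exp (- 2 * real n)"
    "\<And>G u. G \<in> space (gauss_mat n N) \<Longrightarrow> G \<notin> S \<Longrightarrow>
      (\<Sum>l=1..N. \<xi> l * (\<Sum>i<n. u i * G i l)) \<le> (\<Sum>l=1..N. b l * \<bar>\<Sum>i<n. u i * G i l\<bar>)"
    by (rule gauss_box_event[OF \<xi> b2 b1 b0 disj' n(1)]) blast
  have \<rho>: "inverse (1 / r + 8 * sqrt n / T) = r / (1 + \<tau>)"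
    using r T by (simp add: \<tau>_def field_simps add_pos_nonneg)
  show ?thesis
    unfolding r_def[symmetric] T_def[symmetric] \<rho>
  proof (rule haar_radius_event[OF haar n(2) p \<sigma> S(1,2)])
    fix G assume G: "G \<in> space (gauss_mat n N)" "G \<notin> S" "full_rank N n G"
    show "r / (1 + \<tau>) \<le> random_radius N \<sigma> p (gauss_ker N n G)"
      unfolding r_def
    proof (rule box_kernel_radius[OF G(3) p \<sigma> n(2) _ x(1) a disj \<tau> mem[OF \<tau>]])
      fix u
      have "r * (\<Sum>l=1..N. \<xi> l * (\<Sum>i<n. u i * G i l)) \<le> r * (\<Sum>l=1..N. b l * \<bar>\<Sum>i<n. u i * G i l\<bar>)"
        using S(3)[OF G(1,2), of u] r by (intro mult_left_mono) auto
      also have "r * (\<Sum>l=1..N. \<xi> l * (\<Sum>i<n. u i * G i l)) = (\<Sum>l=1..N. x l * (\<Sum>i<n. u i * G i l))"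
        unfolding sum_distrib_left[of r] using r by (intro sum.cong) (auto simp: \<xi>_def)
      also have "r * (\<Sum>l=1..N. b l * \<bar>\<Sum>i<n. u i * G i l\<bar>) = \<tau> * (\<Sum>l=1..N. a l * \<bar>\<Sum>i<n. u i * G i l\<bar>)"
        unfolding sum_distrib_left[of r] sum_distrib_left[of \<tau>] by (intro sum.cong) (auto simp: b_def \<tau>_def)
      finally show "(\<Sum>l=1..N. x l * (\<Sum>i<n. u i * G i l)) \<le> \<tau> * (\<Sum>l=1..N. a l * \<bar>\<Sum>i<n. u i * G i l\<bar>)" .
    qed
  qed
qed

text \<open>After rescaling, the coordinates are bounded by a combination of \<alpha> and \<beta>
  with weights 1 / (1 + \<tau>) and \<tau> / (1 + \<tau>) of sum 1. As the supports are disjoint,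
  q-th powers split, and a weight w in [0, 1] satisfies w^q <= w.\<close>

lemma ellipsoid_scaled_memI:
  fixes \<alpha> \<beta> :: "nat \<Rightarrow> real"
  assumes y: "y \<in> eucl N" "\<And>i. i \<in> {1..N} \<Longrightarrow> \<bar>y i\<bar> \<le> \<sigma> i * (\<alpha> i + \<tau> * \<beta> i)"
    and \<alpha>: "\<And>i. 0 \<le> \<alpha> i" and \<beta>: "\<And>i. 0 \<le> \<beta> i" and disj: "\<And>i. \<alpha> i = 0 \<or> \<beta> i = 0"
    and q: "1 \<le> q" and sums: "(\<Sum>i=1..N. \<alpha> i powr q) \<le> 1" "(\<Sum>i=1..N. \<beta> i powr q) \<le> 1"
    and \<tau>: "0 \<le> \<tau>" and \<sigma>: "\<forall>i\<in>{1..N}. 0 \<le> \<sigma> i"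
  shows "fun_scale (1 / (1 + \<tau>)) y \<in> ellipsoid N \<sigma> (ereal q)"
proof -
  define s where "s = 1 / (1 + \<tau>)"
  define w where "w = \<tau> / (1 + \<tau>)"
  have sw: "0 < s" "s \<le> 1" "0 \<le> w" "w \<le> 1" "s + w = 1" "\<tau> * s = w"
    using \<tau> by (auto simp: s_def w_def field_simps)
  have powr_le: "t powr q \<le> t" if "0 \<le> t" "t \<le> 1" for t
    using powr_mono'[OF q that] that by (cases "t = 0") auto
  have entry: "(\<bar>fun_scale s y i\<bar> / \<sigma> i) powr q \<le> s * \<alpha> i powr q + w * \<beta> i powr q" if i: "i \<in> {1..N}" for i
  proof -
    have "\<bar>y i\<bar> / \<sigma> i \<le> \<alpha> i + \<tau> * \<beta> i"
    proof (cases "\<sigma> i = 0")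
      case True
      then show ?thesis using \<alpha>[of i] \<beta>[of i] \<tau> by simp
    next
      case False
      then have "0 < \<sigma> i" using \<sigma> i by (auto simp: less_le)
      then show ?thesis using y(2)[OF i] by (simp add: pos_divide_le_eq mult.commute)
    qed
    then have "s * (\<bar>y i\<bar> / \<sigma> i) \<le> s * (\<alpha> i + \<tau> * \<beta> i)" using sw by (intro mult_left_mono) auto
    then have "\<bar>fun_scale s y i\<bar> / \<sigma> i \<le> s * \<alpha> i + w * \<beta> i"
      using sw(1) by (simp add: fun_scale_def abs_mult algebra_simps flip: sw(6))
    moreover have "0 \<le> \<bar>fun_scale s y i\<bar> / \<sigma> i" using \<sigma> i by simp
    ultimately have "(\<bar>fun_scale s y i\<bar> / \<sigma> i) powr q \<le> (s * \<alpha> i + w * \<beta> i) powr q"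
      using q by (intro powr_mono2) auto
    also have "\<dots> \<le> s powr q * \<alpha> i powr q + w powr q * \<beta> i powr q"
      using disj[of i] sw \<alpha>[of i] \<beta>[of i] by (auto simp: powr_mult)
    also have "\<dots> \<le> s * \<alpha> i powr q + w * \<beta> i powr q"
      using sw by (intro add_mono mult_right_mono powr_le) auto
    finally show ?thesis .
  qed
  have "(\<Sum>i=1..N. (\<bar>fun_scale s y i\<bar> / \<sigma> i) powr q) \<le> (\<Sum>i=1..N. s * \<alpha> i powr q + w * \<beta> i powr q)"
    using entry by (intro sum_mono)
  also have "\<dots> = s * (\<Sum>i=1..N. \<alpha> i powr q) + w * (\<Sum>i=1..N. \<beta> i powr q)"
    by (simp add: sum.distrib sum_distrib_left)
  also have "\<dots> \<le> s * 1 + w * 1"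
    using sums sw by (intro add_mono mult_left_mono) auto
  finally have "(\<Sum>i=1..N. (\<bar>fun_scale s y i\<bar> / \<sigma> i) powr q) \<le> 1" using sw by simp
  moreover have "\<forall>i\<in>{1..N}. \<sigma> i = 0 \<longrightarrow> fun_scale s y i = 0"
    using y(2) by (force simp: fun_scale_def)
  ultimately show ?thesis
    using y(1) unfolding s_def[symmetric] by (simp add: ellipsoid_def eucl_scale)
qed

lemma ellipsoid_infinity_scaled_memI:
  fixes \<alpha> \<beta> :: "nat \<Rightarrow> real"
  assumes y: "y \<in> eucl N" "\<And>i. i \<in> {1..N} \<Longrightarrow> \<bar>y i\<bar> \<le> \<sigma> i * (\<alpha> i + \<tau> * \<beta> i)"
    and \<alpha>: "\<And>i. \<alpha> i \<le> 1" and \<beta>: "\<And>i. \<beta> i \<le> 1"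
    and \<tau>: "0 \<le> \<tau>" and \<sigma>: "\<forall>i\<in>{1..N}. 0 \<le> \<sigma> i" and N: "1 \<le> N"
  shows "fun_scale (1 / (1 + \<tau>)) y \<in> ellipsoid N \<sigma> \<infinity>"
proof -
  define s where "s = 1 / (1 + \<tau>)"
  have s: "0 < s" "s * (1 + \<tau>) = 1" using \<tau> by (auto simp: s_def)
  have "\<bar>fun_scale s y i\<bar> / \<sigma> i \<le> 1" if i: "i \<in> {1..N}" for i
  proof (cases "\<sigma> i = 0")
    case False
    then have pos: "0 < \<sigma> i" using \<sigma> i by (auto simp: less_le)
    have "\<alpha> i + \<tau> * \<beta> i \<le> 1 + \<tau>" using \<alpha>[of i] mult_left_mono[OF \<beta>[of i] \<tau>] by simp
    then have "\<bar>y i\<bar> \<le> \<sigma> i * (1 + \<tau>)"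
      using y(2)[OF i] pos by (meson less_imp_le mult_left_mono order_trans)
    then have "s * \<bar>y i\<bar> \<le> s * (\<sigma> i * (1 + \<tau>))" using s by (intro mult_left_mono) auto
    also have "\<dots> = \<sigma> i" using s(2) by (simp add: mult.left_commute)
    finally show ?thesis using pos s(1) by (simp add: fun_scale_def abs_mult)
  qed simp
  then have "(MAX i\<in>{1..N}. \<bar>fun_scale s y i\<bar> / \<sigma> i) \<le> 1"
    using N by (subst Max_le_iff) auto
  moreover have "\<forall>i\<in>{1..N}. \<sigma> i = 0 \<longrightarrow> fun_scale s y i = 0"
    using y(2) by (force simp: fun_scale_def)
  ultimately show ?thesis
    using y(1) unfolding s_def[symmetric] by (simp add: ellipsoid_def eucl_scale)
qed

section \<open>The case \<open>1 < p\<close>\<close>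

text \<open>The half-widths \<open>\<sigma> j * conj_weight N \<sigma> p k j\<close> of the box: the functional norming \<open>\<sigma>\<close> in the
  (weighted) \<open>\<ell>\<^sub>p\<close>-norm.\<close>

definition conj_weight :: "nat \<Rightarrow> (nat \<Rightarrow> real) \<Rightarrow> ereal \<Rightarrow> nat \<Rightarrow> nat \<Rightarrow> real"
  where "conj_weight N \<sigma> p k j = (if j \<notin> {k+1..N} then 0 else if p = \<infinity> then 1
    else (\<sigma> j / conj_tail N \<sigma> p k) powr (conj_exp p - 1))"

lemma sum_tail_eq:
  "1 \<le> k \<Longrightarrow> (\<And>j. j \<notin> {k+1..N} \<Longrightarrow> f j = 0) \<Longrightarrow> (\<Sum>j=1..N. f j) = (\<Sum>j=k+1..N. f j)"
  for f :: "nat \<Rightarrow> real" and k N :: nat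
  by (rule sum.mono_neutral_right) auto

lemma sum_head_eq:
  "k \<le> N \<Longrightarrow> (\<And>j. j \<notin> {1..k} \<Longrightarrow> f j = 0) \<Longrightarrow> (\<Sum>j=1..N. f j) = (\<Sum>j=1..k. f j)"
  for f :: "nat \<Rightarrow> real" and k N :: nat
  by (rule sum.mono_neutral_right) auto

context
  fixes N k :: nat and \<sigma> :: "nat \<Rightarrow> real" and p :: ereal
  assumes k: "1 \<le> k" "k < N" and \<sigma>: "\<forall>i\<in>{1..N}. 0 \<le> \<sigma> i" and p: "1 < p"
    and tail: "0 < conj_tail N \<sigma> p k"
begin

lemma tail_nonneg: "j \<in> {k+1..N} \<Longrightarrow> 0 \<le> \<sigma> j"
  using \<sigma> k by auto

lemma conj_weight_nonneg: "0 \<le> conj_weight N \<sigma> p k j"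
  by (simp add: conj_weight_def)

lemma conj_exp_real: "p = ereal q \<Longrightarrow> conj_exp p = q / (q - 1) \<and> 1 < q \<and> (conj_exp p - 1) * q = conj_exp p \<and> 1 < conj_exp p"
  using p by (auto simp: conj_exp_def one_ereal_def field_simps)

lemma conj_tail_powr:
  assumes "p = ereal q"
  shows "(\<Sum>j=k+1..N. \<sigma> j powr conj_exp p) = conj_tail N \<sigma> p k powr conj_exp p"
proof -
  have "0 \<le> (\<Sum>j=k+1..N. \<sigma> j powr conj_exp p)" by (intro sum_nonneg) auto
  then show ?thesis
    using conj_exp_real[OF assms] unfolding conj_tail_def by (simp add: powr_powr)
qed

text \<open>For finite p the summands are \<open>\<sigma> j powr p' / T powr (p' - 1)\<close>, where
  p' is the conjugate exponent and T the tail norm, and the numerators sum to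
  \<open>T powr p'\<close>: the equality case of Hoelder's inequality.\<close>

lemma sum_conj_weight: "(\<Sum>j=k+1..N. \<sigma> j * conj_weight N \<sigma> p k j) = conj_tail N \<sigma> p k"
proof (cases "p = \<infinity>")
  case True
  have "(\<Sum>j=k+1..N. \<sigma> j * conj_weight N \<sigma> p k j) = (\<Sum>j=k+1..N. \<sigma> j powr 1)"
    using True tail_nonneg by (intro sum.cong) (auto simp: conj_weight_def)
  moreover have "0 \<le> (\<Sum>j=k+1..N. \<sigma> j)"
    by (intro sum_nonneg tail_nonneg)
  ultimately show ?thesis
    using True by (simp add: conj_tail_def conj_exp_def)
next
  case False
  then obtain q where q: "p = ereal q" using p by (cases p) auto
  note e = conj_exp_real[OF q]
  let ?T = "conj_tail N \<sigma> p k" and ?e = "conj_exp p"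
  have "\<sigma> j * conj_weight N \<sigma> p k j = \<sigma> j powr ?e / ?T powr (?e - 1)" if "j \<in> {k+1..N}" for j
  proof -
    have "\<sigma> j * \<sigma> j powr (?e - 1) = \<sigma> j powr ?e"
      using tail_nonneg[OF that] by (cases "\<sigma> j = 0") (auto simp: powr_mult_base)
    then show ?thesis
      using that tail_nonneg[OF that] tail False by (simp add: conj_weight_def powr_divide)
  qed
  then have "(\<Sum>j=k+1..N. \<sigma> j * conj_weight N \<sigma> p k j) = (\<Sum>j=k+1..N. \<sigma> j powr ?e) / ?T powr (?e - 1)"
    by (simp add: sum_divide_distrib)
  also have "\<dots> = ?T"
    unfolding conj_tail_powr[OF q] powr_diff[symmetric] using tail by simp
  finally show ?thesis .
qed

lemma sum_conj_weight_powr: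
  assumes q: "p = ereal q"
  shows "(\<Sum>j=k+1..N. conj_weight N \<sigma> p k j powr q) = 1"
proof -
  note e = conj_exp_real[OF q]
  let ?T = "conj_tail N \<sigma> p k" and ?e = "conj_exp p"
  have "conj_weight N \<sigma> p k j powr q = \<sigma> j powr ?e / ?T powr ?e" if "j \<in> {k+1..N}" for j
  proof -
    have "conj_weight N \<sigma> p k j powr q = (\<sigma> j / ?T) powr ((?e - 1) * q)"
      using that q by (simp add: conj_weight_def powr_powr)
    also have "(?e - 1) * q = ?e" using e by blast
    also have "(\<sigma> j / ?T) powr ?e = \<sigma> j powr ?e / ?T powr ?e"
      using tail_nonneg[OF that] tail by (simp add: powr_divide)
    finally show ?thesis .
  qed
  then have "(\<Sum>j=k+1..N. conj_weight N \<sigma> p k j powr q) = (\<Sum>j=k+1..N. \<sigma> j powr ?e) / ?T powr ?e"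
    by (simp add: sum_divide_distrib)
  then show ?thesis
    unfolding conj_tail_powr[OF q] using tail by simp
qed

lemma conj_weight_le_1: "conj_weight N \<sigma> p k j \<le> 1"
proof (cases "j \<in> {k+1..N} \<and> p \<noteq> \<infinity>")
  case True
  then obtain q where q: "p = ereal q" using p by (cases p) auto
  have "conj_weight N \<sigma> p k j powr q \<le> (\<Sum>j=k+1..N. conj_weight N \<sigma> p k j powr q)"
    using True by (intro member_le_sum) auto
  then have le: "conj_weight N \<sigma> p k j powr q \<le> 1" by (simp add: sum_conj_weight_powr[OF q])
  show ?thesis
  proof (rule ccontr)
    assume "\<not> conj_weight N \<sigma> p k j \<le> 1"
    then have "1 < conj_weight N \<sigma> p k j powr q"
      using conj_exp_real[OF q] by (intro gr_one_powr) auto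
    with le show False by simp
  qed
qed (auto simp: conj_weight_def)

text \<open>The weights are at most 1 and q <= 2, so squares are at most q-th powers, which sum to
  1. This explains the term \<open>\<sigma> (k + 1)\<close> in the definition of
  \<open>I_set\<close>.\<close>

lemma sum_conj_weight_squares_le_2:
  assumes "p \<le> 2" and mono: "\<And>j. j \<in> {k+1..N} \<Longrightarrow> \<sigma> j \<le> \<sigma> (k + 1)"
  shows "(\<Sum>j=k+1..N. (\<sigma> j * conj_weight N \<sigma> p k j)\<^sup>2) \<le> (\<sigma> (k + 1))\<^sup>2"
proof -
  obtain q where q: "p = ereal q" using p \<open>p \<le> 2\<close> by (cases p) auto
  have "q \<le> 2" using \<open>p \<le> 2\<close> q by (simp add: numeral_eq_ereal)
  have "(\<sigma> j * conj_weight N \<sigma> p k j)\<^sup>2 \<le> (\<sigma> (k + 1))\<^sup>2 * conj_weight N \<sigma> p k j powr q" if "j \<in> {k+1..N}" for j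
  proof -
    have "(conj_weight N \<sigma> p k j)\<^sup>2 = conj_weight N \<sigma> p k j powr 2"
      using conj_weight_nonneg by (simp add: powr_numeral)
    also have "\<dots> \<le> conj_weight N \<sigma> p k j powr q"
      using \<open>q \<le> 2\<close> conj_weight_nonneg conj_weight_le_1 by (rule powr_mono')
    finally show ?thesis
      unfolding power_mult_distrib using mono[OF that] tail_nonneg[OF that]
      by (intro mult_mono power_mono) auto
  qed
  then have "(\<Sum>j=k+1..N. (\<sigma> j * conj_weight N \<sigma> p k j)\<^sup>2) \<le> (\<Sum>j=k+1..N. (\<sigma> (k + 1))\<^sup>2 * conj_weight N \<sigma> p k j powr q)"
    by (rule sum_mono)
  also have "\<dots> = (\<sigma> (k + 1))\<^sup>2"
    by (simp add: sum_conj_weight_powr[OF q] flip: sum_distrib_left)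
  finally show ?thesis .
qed

lemma tail_pos_entry: "\<exists>j\<in>{k+1..N}. 0 < \<sigma> j"
proof (rule ccontr)
  assume "\<not> ?thesis"
  then have "\<sigma> j = 0" if "j \<in> {k+1..N}" for j using tail_nonneg[OF that] that by force
  then have "(\<Sum>j=k+1..N. \<sigma> j * conj_weight N \<sigma> p k j) = 0" by simp
  then show False using tail by (simp add: sum_conj_weight)
qed

text \<open>Hoelder's inequality with the exponents \<open>p/2\<close> and \<open>p/(p-2)\<close>, summed up from Young's inequality.\<close>

lemma sum_conj_weight_squares_gt_2:
  assumes "2 < p"
  shows "(\<Sum>j=k+1..N. (\<sigma> j * conj_weight N \<sigma> p k j)\<^sup>2)
    \<le> ((\<Sum>j=k+1..N. \<sigma> j powr mixed_exp p) powr (1 / mixed_exp p))\<^sup>2"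
proof (cases "p = \<infinity>")
  case True
  have "(\<Sum>j=k+1..N. (\<sigma> j * conj_weight N \<sigma> p k j)\<^sup>2) = (\<Sum>j=k+1..N. \<sigma> j powr 2)"
    using True tail_nonneg by (intro sum.cong) (auto simp: conj_weight_def powr_numeral)
  also have "\<dots> = ((\<Sum>j=k+1..N. \<sigma> j powr 2) powr (1 / 2))\<^sup>2"
    by (simp add: powr_half_sqrt sum_nonneg)
  finally show ?thesis using True by (simp add: mixed_exp_def)
next
  case False
  then obtain q where q: "p = ereal q" using p by (cases p) auto
  have q2: "2 < q" using \<open>2 < p\<close> q by (simp add: numeral_eq_ereal)
  define m where "m = mixed_exp p"
  have m: "m = 2 * q / (q - 2)" "0 < m" using q q2 by (simp_all add: m_def mixed_exp_def)
  \<comment> \<open>The normalization by D makes both families in Young's inequality, the q-th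
    powers of the weights and \<open>\<sigma> j powr m / D\<close>, sum to 1; the reciprocal
    exponents 2/q and (q - 2)/q add up to 1.\<close>
  define D where "D = (\<Sum>j=k+1..N. \<sigma> j powr m)"
  obtain j0 where j0: "j0 \<in> {k+1..N}" "0 < \<sigma> j0" using tail_pos_entry by blast
  have "0 < \<sigma> j0 powr m" using j0 by simp
  also have "\<dots> \<le> D" unfolding D_def using j0 by (intro member_le_sum) auto
  finally have D: "0 < D" .
  have young: "(\<sigma> j * conj_weight N \<sigma> p k j)\<^sup>2 / D powr (2 / m)
      \<le> conj_weight N \<sigma> p k j powr q / (q / 2) + (\<sigma> j powr m / D) / (q / (q - 2))" if j: "j \<in> {k+1..N}" for j
  proof -
    let ?w = "conj_weight N \<sigma> p k j"
    have "?w\<^sup>2 * (\<sigma> j powr 2 / D powr (2 / m)) \<le> (?w\<^sup>2) powr (q / 2) / (q / 2)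
        + (\<sigma> j powr 2 / D powr (2 / m)) powr (q / (q - 2)) / (q / (q - 2))"
      using q2 by (intro Youngs_inequality) (auto simp: field_simps)
    also have "(?w\<^sup>2) powr (q / 2) = ?w powr q"
      using conj_weight_nonneg[of j] by (simp add: powr_powr flip: powr_numeral)
    also have "(\<sigma> j powr 2 / D powr (2 / m)) powr (q / (q - 2)) = \<sigma> j powr m / D"
    proof -
      have e: "2 * (q / (q - 2)) = m" "2 / m * (q / (q - 2)) = 1" using q2 by (simp_all add: m)
      have "(\<sigma> j powr 2 / D powr (2 / m)) powr (q / (q - 2))
          = (\<sigma> j powr 2) powr (q / (q - 2)) / (D powr (2 / m)) powr (q / (q - 2))"
        by (rule powr_divide)
      then show ?thesis using D unfolding powr_powr e by simp
    qed
    finally show ?thesis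
      using tail_nonneg[OF j] by (simp add: power_mult_distrib mult.commute powr_numeral)
  qed
  have "(\<Sum>j=k+1..N. (\<sigma> j * conj_weight N \<sigma> p k j)\<^sup>2) / D powr (2 / m)
      \<le> (\<Sum>j=k+1..N. conj_weight N \<sigma> p k j powr q / (q / 2) + (\<sigma> j powr m / D) / (q / (q - 2)))"
    unfolding sum_divide_distrib using young by (rule sum_mono)
  also have "\<dots> = (\<Sum>j=k+1..N. conj_weight N \<sigma> p k j powr q) / (q / 2) + D / D / (q / (q - 2))"
    unfolding D_def by (simp only: sum.distrib sum_divide_distrib)
  also have "\<dots> = 1"
    unfolding sum_conj_weight_powr[OF q] using q2 D by (simp add: field_simps)
  finally have "(\<Sum>j=k+1..N. (\<sigma> j * conj_weight N \<sigma> p k j)\<^sup>2) \<le> D powr (2 / m)"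
    using D by (simp add: pos_divide_le_eq)
  also have "D powr (2 / m) = (D powr (1 / m))\<^sup>2"
    using D by (simp add: powr_powr flip: powr_numeral)
  finally show ?thesis by (simp add: D_def m_def)
qed

text \<open>The inequality defining \<open>I_set\<close> enters here: it becomes the ratio between
  the sum and the Euclidean norm of the half-widths that \<open>haar_box_radius\<close> demands. The
  two cases of the definition are the two bounds for that norm.\<close>

lemma eucl_norm_conj_weight_le:
  assumes I: "k \<in> I_set N n \<sigma> p" and mono: "\<And>j. j \<in> {k+1..N} \<Longrightarrow> \<sigma> j \<le> \<sigma> (k + 1)"
    and a: "\<And>j. a j = (if j \<in> {k+1..N} then \<sigma> j * conj_weight N \<sigma> p k j else 0)"
  shows "8 * sqrt n * eucl_norm N a \<le> conj_tail N \<sigma> p k"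
proof -
  have norm: "(eucl_norm N a)\<^sup>2 = (\<Sum>j=k+1..N. (\<sigma> j * conj_weight N \<sigma> p k j)\<^sup>2)"
  proof -
    have "(eucl_norm N a)\<^sup>2 = (\<Sum>j=1..N. (a j)\<^sup>2)" by (simp add: L2_set_def sum_nonneg)
    also have "\<dots> = (\<Sum>j=k+1..N. (a j)\<^sup>2)" using k by (intro sum_tail_eq) (auto simp: a)
    also have "\<dots> = (\<Sum>j=k+1..N. (\<sigma> j * conj_weight N \<sigma> p k j)\<^sup>2)" by (intro sum.cong) (auto simp: a)
    finally show ?thesis .
  qed
  show ?thesis
  proof (cases "p \<le> 2")
    case True
    then have "8 * sqrt n * \<sigma> (k + 1) \<le> conj_tail N \<sigma> p k" using I by (simp add: I_set_def)
    moreover have "eucl_norm N a \<le> \<sigma> (k + 1)"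
      using sum_conj_weight_squares_le_2[OF True mono] tail_nonneg[of "k + 1"] k norm
      by (intro power2_le_imp_le[of "eucl_norm N a"]) auto
    then have "8 * sqrt n * eucl_norm N a \<le> 8 * sqrt n * \<sigma> (k + 1)" by (intro mult_left_mono) auto
    ultimately show ?thesis by linarith
  next
    case False
    then have p2: "2 < p" by simp
    have "real_of_ereal (1 / 2 - 1 / p) = 1 / mixed_exp p"
      unfolding mixed_exp[OF p2, symmetric] by (simp add: one_ereal_def mixed_exp_def)
    then have "8 * sqrt n * (\<Sum>j=k+1..N. \<sigma> j powr mixed_exp p) powr (1 / mixed_exp p) \<le> conj_tail N \<sigma> p k"
      using I False by (simp add: I_set_def)
    moreover have "eucl_norm N a \<le> (\<Sum>j=k+1..N. \<sigma> j powr mixed_exp p) powr (1 / mixed_exp p)"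
      using sum_conj_weight_squares_gt_2[OF p2] norm
      by (intro power2_le_imp_le[of "eucl_norm N a"]) auto
    then have "8 * sqrt n * eucl_norm N a \<le> 8 * sqrt n * (\<Sum>j=k+1..N. \<sigma> j powr mixed_exp p) powr (1 / mixed_exp p)"
      by (intro mult_left_mono) auto
    ultimately show ?thesis by linarith
  qed
qed

text \<open>The vector with entries \<open>\<sigma> i * \<alpha> i\<close> is a point of maximal
  norm of the ellipsoid in the first \<open>k\<close> coordinates: an endpoint of the longest axis
  for p <= 2, a corner for p = \<infinity>, and the equality case of Hoelder's inequality in
  between.\<close>

lemma head_weights:
  assumes r: "0 < r_radius \<sigma> p k"
  obtains \<alpha> where "\<And>i. 0 \<le> \<alpha> i" "\<And>i. i \<notin> {1..k} \<Longrightarrow> \<alpha> i = 0" "\<And>i. \<alpha> i \<le> 1"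
    "\<And>q. p = ereal q \<Longrightarrow> (\<Sum>i=1..k. \<alpha> i powr q) \<le> 1"
    "sqrt (\<Sum>i=1..k. (\<sigma> i * \<alpha> i)\<^sup>2) = r_radius \<sigma> p k"
proof (cases "p \<le> 2")
  case True
  then have r: "0 < \<sigma> 1" "r_radius \<sigma> p k = \<sigma> 1" using r by (simp_all add: r_radius_def)
  have if_eq: "(if i = 1 then 1 else 0) powr q = (if i = 1 then 1 else 0 :: real)" for i :: nat and q by simp
  show ?thesis
  proof (rule that[of "\<lambda>i. if i = 1 then 1 else 0"])
    show "sqrt (\<Sum>i=1..k. (\<sigma> i * (if i = 1 then 1 else 0))\<^sup>2) = r_radius \<sigma> p k"
      using k r by (simp add: if_distrib[of "\<lambda>x. (\<sigma> _ * x)\<^sup>2"] cong: if_cong)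
    show "(\<Sum>i=1..k. (if i = 1 then 1 else 0) powr q) \<le> (1 :: real)" for q
      unfolding if_eq using k by simp
  qed (use k in auto)
next
  case False
  show ?thesis
  proof (cases "p = \<infinity>")
    case True
    have "sqrt (\<Sum>i=1..k. (\<sigma> i)\<^sup>2) = r_radius \<sigma> p k"
      using True by (simp add: r_radius_def powr_half_sqrt sum_nonneg)
    moreover have "(\<Sum>i=1..k. (\<sigma> i * (if i \<in> {1..k} then 1 else 0))\<^sup>2) = (\<Sum>i=1..k. (\<sigma> i)\<^sup>2)"
      by (intro sum.cong) auto
    ultimately show ?thesis
      using True by (intro that[of "\<lambda>i. if i \<in> {1..k} then 1 else 0"]) auto
  next
    case False
    then obtain q where q: "p = ereal q" using p by (cases p) auto
    have q2: "2 < q" using \<open>\<not> p \<le> 2\<close> q by (simp add: numeral_eq_ereal)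
    define m where "m = mixed_exp p"
    have m: "m = 2 * q / (q - 2)" "0 < m" using q q2 by (simp_all add: m_def mixed_exp_def)
    define S where "S = (\<Sum>i=1..k. \<sigma> i powr m)"
    have r_eq: "r_radius \<sigma> p k = S powr (1 / 2 - 1 / q)"
      using \<open>\<not> p \<le> 2\<close> q by (simp add: r_radius_def S_def m_def)
    have "S \<noteq> 0" using r r_eq by auto
    moreover have "0 \<le> S" unfolding S_def by (intro sum_nonneg) auto
    ultimately have S: "0 < S" by simp
    \<comment> \<open>Lagrange's condition for maximizing the sum of \<sigma>^2 \<alpha>^2 under a
      fixed sum of \<alpha>^q makes \<alpha>^(q-2) proportional to \<sigma>^2, that is \<alpha>^q
      proportional to \<sigma>^m.\<close>
    define \<alpha> where "\<alpha> i = (if i \<in> {1..k} then (\<sigma> i powr m / S) powr (1 / q) else 0)" for i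
    have \<sigma>0: "0 \<le> \<sigma> i" if "i \<in> {1..k}" for i using \<sigma> k that by auto
    have powr_q: "\<alpha> i powr q = \<sigma> i powr m / S" if "i \<in> {1..k}" for i
      using that q2 S by (simp add: \<alpha>_def powr_powr)
    have le_S: "\<sigma> i powr m \<le> S" if "i \<in> {1..k}" for i
      unfolding S_def using that by (intro member_le_sum) auto
    have sq: "(\<sigma> i * \<alpha> i)\<^sup>2 = \<sigma> i powr m / S powr (2 / q)" if i: "i \<in> {1..k}" for i
    proof -
      have e: "2 + m * (2 / q) = m" using q2 by (simp add: m field_simps)
      have "(\<sigma> i * \<alpha> i)\<^sup>2 = \<sigma> i powr 2 * (\<sigma> i powr m / S) powr (2 / q)"
        using i \<sigma>0[OF i] by (simp add: \<alpha>_def power_mult_distrib powr_powr flip: powr_numeral)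
      also have "\<dots> = \<sigma> i powr (2 + m * (2 / q)) / S powr (2 / q)"
        using S by (simp add: powr_divide powr_powr powr_add)
      finally show ?thesis unfolding e .
    qed
    show ?thesis
    proof (rule that[of \<alpha>])
      show "\<alpha> i \<le> 1" for i
        using le_S[of i] S q2 by (auto simp: \<alpha>_def intro!: powr_le1)
      have "(\<Sum>i=1..k. \<alpha> i powr q) = (\<Sum>i=1..k. \<sigma> i powr m / S)" using powr_q by (intro sum.cong) auto
      also have "\<dots> = 1" using S by (simp add: S_def flip: sum_divide_distrib)
      finally show "(\<Sum>i=1..k. \<alpha> i powr q') \<le> 1" if "p = ereal q'" for q'
        using that q by simp
      have "(\<Sum>i=1..k. (\<sigma> i * \<alpha> i)\<^sup>2) = (\<Sum>i=1..k. \<sigma> i powr m / S powr (2 / q))" using sq by (intro sum.cong) auto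
      also have "\<dots> = S powr 1 / S powr (2 / q)" using S by (simp add: S_def flip: sum_divide_distrib)
      also have "\<dots> = S powr (1 - 2 / q)" by (simp add: powr_diff)
      also have "sqrt \<dots> = S powr (1 / 2 - 1 / q)"
        using S by (simp add: powr_half_sqrt[symmetric] powr_powr field_simps)
      finally show "sqrt (\<Sum>i=1..k. (\<sigma> i * \<alpha> i)\<^sup>2) = r_radius \<sigma> p k" by (simp add: r_eq)
    qed (auto simp: \<alpha>_def)
  qed
qed

end

lemma haar_radius_lower_bound:
  assumes haar: "is_haar_grassmannian N (N - n) \<mu>" and n: "1 \<le> n" "n < N" and mono: "antimono_on {1..N} \<sigma>"
    and \<sigma>: "\<forall>i\<in>{1..N}. 0 \<le> \<sigma> i" and p: "1 < p" and I: "k \<in> I_set N n \<sigma> p"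
    and r: "0 < r_radius \<sigma> p k" and T: "0 < conj_tail N \<sigma> p k"
  shows "1 - 2 * exp (- 2 * real n) \<le> measure \<mu> {E \<in> space \<mu>.
    inverse (1 / r_radius \<sigma> p k + 8 * sqrt n / conj_tail N \<sigma> p k) \<le> random_radius N \<sigma> p E}"
proof -
  have k: "1 \<le> k" "k < N" using I by (auto simp: I_set_def)
  note facts = k \<sigma> p T
  obtain \<alpha> where \<alpha>: "\<And>i. 0 \<le> \<alpha> i" "\<And>i. i \<notin> {1..k} \<Longrightarrow> \<alpha> i = 0" "\<And>i. \<alpha> i \<le> 1"
    "\<And>q. p = ereal q \<Longrightarrow> (\<Sum>i=1..k. \<alpha> i powr q) \<le> 1"
    "sqrt (\<Sum>i=1..k. (\<sigma> i * \<alpha> i)\<^sup>2) = r_radius \<sigma> p k"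
    by (rule head_weights[OF facts r]) blast
  define \<beta> where "\<beta> = conj_weight N \<sigma> p k"
  have \<beta>: "0 \<le> \<beta> i" "\<beta> i \<le> 1" for i
    unfolding \<beta>_def by (rule conj_weight_nonneg[OF facts] conj_weight_le_1[OF facts])+
  have \<beta>0: "\<beta> i = 0" if "i \<notin> {k+1..N}" for i using that by (simp add: \<beta>_def conj_weight_def)
  define x where "x i = (if i \<in> {1..N} then \<sigma> i * \<alpha> i else 0)" for i
  define a where "a i = (if i \<in> {k+1..N} then \<sigma> i * \<beta> i else 0)" for i
  have x_norm: "eucl_norm N x = r_radius \<sigma> p k"
  proof -
    have "(\<Sum>i=1..N. (x i)\<^sup>2) = (\<Sum>i=1..k. (x i)\<^sup>2)"
      using k \<alpha>(2) by (intro sum_head_eq) (auto simp: x_def)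
    also have "\<dots> = (\<Sum>i=1..k. (\<sigma> i * \<alpha> i)\<^sup>2)" using k by (intro sum.cong) (auto simp: x_def)
    finally show ?thesis using \<alpha>(5) by (simp add: L2_set_def)
  qed
  have a_sum: "(\<Sum>i=1..N. a i) = conj_tail N \<sigma> p k"
  proof -
    have "(\<Sum>i=1..N. a i) = (\<Sum>i=k+1..N. a i)" using k by (intro sum_tail_eq) (auto simp: a_def)
    also have "\<dots> = (\<Sum>i=k+1..N. \<sigma> i * conj_weight N \<sigma> p k i)" by (intro sum.cong) (auto simp: a_def \<beta>_def)
    also have "\<dots> = conj_tail N \<sigma> p k" by (rule sum_conj_weight[OF facts])
    finally show ?thesis .
  qed
  have a_norm: "8 * sqrt n * eucl_norm N a \<le> conj_tail N \<sigma> p k"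
  proof (rule eucl_norm_conj_weight_le[OF facts I])
    fix j assume "j \<in> {k+1..N}"
    then show "\<sigma> j \<le> \<sigma> (k + 1)" using mono k by (auto simp: monotone_on_def)
  qed (simp add: a_def \<beta>_def)
  have disj: "\<alpha> i = 0 \<or> \<beta> i = 0" for i using \<alpha>(2)[of i] \<beta>0[of i] by (cases "i \<in> {1..k}") auto
  show ?thesis
    unfolding x_norm[symmetric] a_sum[symmetric]
  proof (rule haar_box_radius[OF haar n _ \<sigma>])
    show "1 \<le> p" using p by simp
    show "x \<in> eucl N" "a \<in> eucl N" using k by (auto simp: eucl_def x_def a_def)
    show "0 < eucl_norm N x" using r by (simp add: x_norm)
    show "0 \<le> a i" for i using \<sigma> k \<beta> by (auto simp: a_def)
    show "a i = 0 \<or> x i = 0" for i using disj[of i] by (auto simp: a_def x_def)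
    show "0 < (\<Sum>i=1..N. a i)" using T by (simp add: a_sum)
    show "8 * sqrt n * eucl_norm N a \<le> (\<Sum>i=1..N. a i)" using a_norm by (simp add: a_sum)
    fix y \<tau> assume \<tau>: "0 \<le> \<tau>" and y: "y \<in> eucl N" "\<And>i. \<bar>y i - x i\<bar> \<le> \<tau> * a i"
    have y_le: "\<bar>y i\<bar> \<le> \<sigma> i * (\<alpha> i + \<tau> * \<beta> i)" if i: "i \<in> {1..N}" for i
    proof -
      have "\<bar>y i\<bar> \<le> \<bar>x i\<bar> + \<tau> * a i" using y(2)[of i] by linarith
      also have "\<bar>x i\<bar> = \<sigma> i * \<alpha> i" using i \<sigma> \<alpha>(1)[of i] by (simp add: x_def)
      also have "a i = \<sigma> i * \<beta> i" using \<beta>0[of i] by (simp add: a_def)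
      finally show ?thesis by (simp add: algebra_simps)
    qed
    show "fun_scale (1 / (1 + \<tau>)) y \<in> ellipsoid N \<sigma> p"
    proof (cases "p = \<infinity>")
      case True
      then show ?thesis
        using ellipsoid_infinity_scaled_memI[OF y(1) y_le \<alpha>(3) \<beta>(2) \<tau> \<sigma>] k by simp
    next
      case False
      then obtain q where q: "p = ereal q" using p by (cases p) auto
      have q1: "1 < q" using conj_exp_real[OF facts q] by simp
      have "(\<Sum>i=1..N. \<alpha> i powr q) = (\<Sum>i=1..k. \<alpha> i powr q)"
        using k \<alpha>(2) q1 by (intro sum_head_eq) auto
      then have sum\<alpha>: "(\<Sum>i=1..N. \<alpha> i powr q) \<le> 1" using \<alpha>(4)[OF q] by simp
      have "(\<Sum>i=1..N. \<beta> i powr q) = (\<Sum>i=k+1..N. \<beta> i powr q)"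
        using k \<beta>0 q1 by (intro sum_tail_eq) auto
      then have sum\<beta>: "(\<Sum>i=1..N. \<beta> i powr q) \<le> 1"
        using sum_conj_weight_powr[OF facts q] by (simp add: \<beta>_def)
      show ?thesis
        unfolding q using q1 by (intro ellipsoid_scaled_memI[OF y(1) y_le \<alpha>(1) \<beta>(1) disj _ sum\<alpha> sum\<beta> \<tau> \<sigma>]) auto
    qed
  qed
qed

section \<open>The case \<open>p = 1\<close>\<close>

text \<open>The compact convex set that is shown to meet the kernel is the product of a point in the
  first coordinate and an \<open>\<ell>\<^sub>1\<close>-ball in the coordinates \<open>J\<close>; its polar norm is a maximum.\<close>

lemma l1_kernel_radius:
  assumes G: "full_rank N n G" and \<sigma>: "\<forall>i\<in>{1..N}. 0 \<le> \<sigma> i" and N: "1 \<le> N"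
    and J: "J \<subseteq> {1..N}" "1 \<notin> J" "\<And>j. j \<in> J \<Longrightarrow> s \<le> \<sigma> j" and s: "0 < s" "0 < \<sigma> 1" and \<tau>: "0 \<le> \<tau>"
    and crit: "\<And>u. \<exists>j\<in>J. \<sigma> 1 * (\<Sum>i<n. u i * G i 1) \<le> \<tau> * s * \<bar>\<Sum>i<n. u i * G i j\<bar>"
  shows "\<sigma> 1 / (1 + \<tau>) \<le> random_radius N \<sigma> 1 (gauss_ker N n G)"
proof -
  have fin: "finite J" using J(1) finite_subset by blast
  \<comment> \<open>The box bounds fix coordinate 1, remove the coordinates outside of
    \<open>J\<close> and give compactness; the sum constraint in \<open>M\<close> then cuts out the
    l1-ball.\<close>
  define lo where "lo l = (if l = 1 then \<sigma> 1 else if l \<in> J then - (\<tau> * s) else 0)" for l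
  define hi where "hi l = (if l = 1 then \<sigma> 1 else if l \<in> J then \<tau> * s else 0)" for l
  define M where "M = {y. \<forall>l. lo l \<le> y l \<and> y l \<le> hi l} \<inter> {y. (\<Sum>j\<in>J. \<bar>y j\<bar>) \<le> \<tau> * s}"
  have b: "lo l \<le> y l \<and> y l \<le> hi l" "(\<Sum>j\<in>J. \<bar>y j\<bar>) \<le> \<tau> * s" if "y \<in> M" for y l
    using that unfolding M_def by blast+
  have M_1: "y 1 = \<sigma> 1" if "y \<in> M" for y using b(1)[OF that, of 1] by (simp add: lo_def hi_def)
  have M_0: "y l = 0" if "y \<in> M" "l \<noteq> 1" "l \<notin> J" for y l
    using b(1)[OF that(1), of l] that by (simp add: lo_def hi_def)
  note M_sum = b(2)
  have M_I: "y \<in> M" if "y 1 = \<sigma> 1" "\<And>l. l \<noteq> 1 \<Longrightarrow> l \<notin> J \<Longrightarrow> y l = 0" "(\<Sum>j\<in>J. \<bar>y j\<bar>) \<le> \<tau> * s" for y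
  proof -
    have "\<bar>y l\<bar> \<le> \<tau> * s" if "l \<in> J" for l
      using member_le_sum[OF that, of "\<lambda>j. \<bar>y j\<bar>"] fin \<open>(\<Sum>j\<in>J. \<bar>y j\<bar>) \<le> \<tau> * s\<close> by force
    then have "lo l \<le> y l \<and> y l \<le> hi l" for l
      using that(1,2) J(2) by (force simp: lo_def hi_def abs_le_iff)
    then show ?thesis using that(3) by (simp add: M_def)
  qed
  have M_eucl: "y \<in> eucl N" if "y \<in> M" for y
    unfolding eucl_def
  proof (intro CollectI allI impI)
    fix l assume l: "l \<notin> {1..N}"
    then have "l \<noteq> 1" "l \<notin> J" using J(1) N by auto
    then show "y l = 0" by (rule M_0[OF that])
  qed
  have "closed {y :: nat \<Rightarrow> real. (\<Sum>j\<in>J. \<bar>y j\<bar>) \<le> \<tau> * s}"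
    by (intro closed_Collect_le continuous_intros continuous_on_product_coordinates)
  then have compact: "compact M" unfolding M_def by (intro compact_Int_closed compact_box)
  \<comment> \<open>Points over the axes of the l1-ball. A linear functional attains its minimum on
    the ball at a vertex, so these suffice for the separation condition.\<close>
  define e where "e j c l = (if l = 1 then \<sigma> 1 else if l = j then c else 0)" for j c and l :: nat
  have e_M: "e j c \<in> M" if "j \<in> J" "\<bar>c\<bar> \<le> \<tau> * s" for j c
  proof (rule M_I)
    have "(\<Sum>l\<in>J. \<bar>e j c l\<bar>) = (\<Sum>l\<in>J. if l = j then \<bar>c\<bar> else 0)"
      using J(2) by (intro sum.cong) (auto simp: e_def)
    then show "(\<Sum>l\<in>J. \<bar>e j c l\<bar>) \<le> \<tau> * s" using that fin by simp
  qed (use that in \<open>auto simp: e_def\<close>)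
  have ne: "M \<noteq> {}" using crit[of "\<lambda>_. 0"] e_M[of _ 0] \<tau> s by auto
  have convex: "(\<lambda>i. (1 - t) * y i + t * z i) \<in> M" if yz: "y \<in> M" "z \<in> M" "0 \<le> t" "t \<le> 1" for y z t
  proof (rule M_I)
    have "(\<Sum>j\<in>J. \<bar>(1 - t) * y j + t * z j\<bar>) \<le> (\<Sum>j\<in>J. (1 - t) * \<bar>y j\<bar> + t * \<bar>z j\<bar>)"
      using yz by (intro sum_mono order_trans[OF abs_triangle_ineq]) (simp add: abs_mult)
    also have "\<dots> = (1 - t) * (\<Sum>j\<in>J. \<bar>y j\<bar>) + t * (\<Sum>j\<in>J. \<bar>z j\<bar>)"
      by (simp add: sum.distrib sum_distrib_left)
    also have "\<dots> \<le> (1 - t) * (\<tau> * s) + t * (\<tau> * s)"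
      using yz by (intro add_mono mult_left_mono M_sum) auto
    finally show "(\<Sum>j\<in>J. \<bar>(1 - t) * y j + t * z j\<bar>) \<le> \<tau> * s" by (simp add: algebra_simps)
    show "(1 - t) * y 1 + t * z 1 = \<sigma> 1"
      using yz by (simp add: M_1 algebra_simps)
  qed (simp add: M_0[OF yz(1)] M_0[OF yz(2)])
  have sep: "\<exists>y\<in>M. (\<Sum>i<n. u i * eucl_inner N (G i) y) \<le> 0" for u
  proof -
    define t where "t l = (\<Sum>i<n. u i * G i l)" for l
    obtain j where j: "j \<in> J" "\<sigma> 1 * t 1 \<le> \<tau> * s * \<bar>t j\<bar>"
      using crit[of u] by (auto simp: t_def)
    define y where "y = e j (- (\<tau> * s * sgn (t j)))"
    have j1: "j \<noteq> 1" using j J(2) by blast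
    have "(\<Sum>i<n. u i * eucl_inner N (G i) y) = (\<Sum>l=1..N. t l * y l)"
      unfolding sum_comb_eucl_inner t_def ..
    also have "\<dots> = (\<Sum>l\<in>{1, j}. t l * y l)"
      using j J(1) N by (intro sum.mono_neutral_right) (auto simp: y_def e_def)
    also have "\<dots> = \<sigma> 1 * t 1 - \<tau> * s * \<bar>t j\<bar>"
      using j1 by (simp add: y_def e_def abs_sgn[of "t j"] mult.commute mult.left_commute)
    also have "\<dots> \<le> 0" using j(2) by simp
    finally have "(\<Sum>i<n. u i * eucl_inner N (G i) y) \<le> 0" .
    moreover have "y \<in> M"
      unfolding y_def using \<tau> s by (intro e_M j) (auto simp: abs_mult sgn_if)
    ultimately show ?thesis by blast
  qed
  obtain y where y: "y \<in> M" "\<And>i. i < n \<Longrightarrow> eucl_inner N (G i) y = 0"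
    using compact_convex_meets_kernel[OF compact ne convex sep] by blast
  define z where "z = fun_scale (1 / (1 + \<tau>)) y"
  have "z \<in> gauss_ker N n G"
    unfolding z_def using y M_eucl[OF y(1)]
    by (intro mem_gauss_ker G eucl_scale) (auto simp: eucl_inner_scale_right)
  moreover have "z \<in> ellipsoid N \<sigma> 1"
  proof -
    have "(\<Sum>l=1..N. \<bar>z l\<bar> / \<sigma> l) = (\<Sum>l=1..N. \<bar>y l\<bar> / \<sigma> l) / (1 + \<tau>)"
      using \<tau> by (simp add: z_def fun_scale_def abs_mult sum_divide_distrib mult.commute)
    also have "(\<Sum>l=1..N. \<bar>y l\<bar> / \<sigma> l) = (\<Sum>l\<in>insert 1 J. \<bar>y l\<bar> / \<sigma> l)"
      using J(1) N M_0[OF y(1)] by (intro sum.mono_neutral_right) auto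
    also have "\<dots> = 1 + (\<Sum>l\<in>J. \<bar>y l\<bar> / \<sigma> l)"
      using fin J(2) s M_1[OF y(1)] by simp
    also have "(\<Sum>l\<in>J. \<bar>y l\<bar> / \<sigma> l) \<le> (\<Sum>l\<in>J. \<bar>y l\<bar> / s)"
      using J(3) s by (intro sum_mono divide_left_mono) (auto intro: mult_pos_pos less_le_trans)
    also have "\<dots> \<le> \<tau>"
      using M_sum[OF y(1)] s by (simp add: pos_divide_le_eq flip: sum_divide_distrib)
    finally have "(\<Sum>l=1..N. \<bar>z l\<bar> / \<sigma> l) \<le> 1" using \<tau> by (simp add: divide_right_mono)
    moreover have "(\<Sum>l=1..N. (\<bar>z l\<bar> / \<sigma> l) powr real_of_ereal 1) = (\<Sum>l=1..N. \<bar>z l\<bar> / \<sigma> l)"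
      using \<sigma> by (intro sum.cong) auto
    moreover have "z l = 0" if "l \<in> {1..N}" "\<sigma> l = 0" for l
    proof -
      have "l \<noteq> 1" "l \<notin> J" using that J(3) s by force+
      then show ?thesis using M_0[OF y(1)] by (simp add: z_def fun_scale_def)
    qed
    moreover have "z \<in> eucl N" unfolding z_def using M_eucl[OF y(1)] by (rule eucl_scale)
    ultimately show ?thesis by (simp add: ellipsoid_def)
  qed
  ultimately have "eucl_norm N z \<le> random_radius N \<sigma> 1 (gauss_ker N n G)"
    using \<sigma> by (intro random_radius_upper) auto
  moreover have "z 1 \<le> eucl_norm N z" using N by (intro member_le_L2_set) auto
  moreover have "z 1 = \<sigma> 1 / (1 + \<tau>)" by (simp add: z_def fun_scale_def M_1[OF y(1)])
  ultimately show ?thesis by simp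
qed

text \<open>Take an index \<open>i\<close> attaining the maximum \<open>eta\<close>, so that it
  equals \<sigma> i times L. Since \<sigma> i is at most \<open>\<sigma> (k + 1)\<close>, the
  condition with C = 15 gives L >= 15 sqrt n, the hypothesis of
  \<open>gauss_max_event\<close>.\<close>

lemma haar_radius_lower_bound_1:
  assumes haar: "is_haar_grassmannian N (N - n) \<mu>" and n: "1 \<le> n" "n < N" and mono: "antimono_on {1..N} \<sigma>"
    and \<sigma>: "\<forall>i\<in>{1..N}. 0 \<le> \<sigma> i" and I: "k \<in> eta_set 15 N n \<sigma>" and \<eta>: "0 < eta N \<sigma> k"
  shows "1 - 2 * exp (- 2 * real n) \<le> measure \<mu> {E \<in> space \<mu>.
    inverse (1 / \<sigma> 1 + sqrt n / (1 / 30 * eta N \<sigma> k)) \<le> random_radius N \<sigma> 1 E}"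
proof -
  have k: "1 \<le> k" "k < N" and \<eta>_ge: "15 * sqrt n * \<sigma> (k + 1) \<le> eta N \<sigma> k" using I by (auto simp: eta_set_def)
  have "eta N \<sigma> k \<in> (\<lambda>i. \<sigma> i * sqrt (ln (2 * real (i - k)))) ` {k+1..N}"
    unfolding eta_def using k by (intro Max_in) auto
  then obtain i where i: "i \<in> {k+1..N}" "eta N \<sigma> k = \<sigma> i * sqrt (ln (2 * real (i - k)))" by auto
  \<comment> \<open>The block ends at \<open>i\<close>: by monotonicity \<sigma> is at least
    \<sigma> i on it, and its cardinality i - k is the number inside the logarithm of
    \<open>eta\<close>.\<close>
  define J where "J = {k+1..i}"
  define L where "L = sqrt (ln (2 * real (card J)))"
  have \<eta>_eq: "eta N \<sigma> k = \<sigma> i * L" using i by (simp add: L_def J_def)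
  have le: "\<sigma> b \<le> \<sigma> a" if "1 \<le> a" "a \<le> b" "b \<le> N" for a b
    using mono that by (auto simp: monotone_on_def)
  have "\<sigma> i \<noteq> 0" using \<eta> \<eta>_eq by auto
  then have pos: "0 < \<sigma> i" using \<sigma> i k by (auto simp: less_le)
  have pos1: "0 < \<sigma> 1" using le[of 1 i] i pos by auto
  have L0: "0 < L" using \<eta> \<eta>_eq pos by (simp add: zero_less_mult_iff)
  have "15 * sqrt n * \<sigma> i \<le> 15 * sqrt n * \<sigma> (k + 1)" using le[of "k + 1" i] i by (intro mult_left_mono) auto
  then have "\<sigma> i * (15 * sqrt n) \<le> \<sigma> i * L" using \<eta>_ge \<eta>_eq by (simp only: mult.commute[of _ "\<sigma> i"])
  then have L: "15 * sqrt n \<le> L" using pos by (rule mult_left_le_imp_le)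
  have J: "J \<subseteq> {1..N}" "J \<noteq> {}" "1 \<notin> J" using i k by (auto simp: J_def)
  obtain S where S: "S \<in> sets (gauss_mat n N)" "measure (gauss_mat n N) S \<le> 2 * exp (- 2 * real n)"
    "\<And>G u. G \<in> space (gauss_mat n N) \<Longrightarrow> G \<notin> S \<Longrightarrow>
      \<exists>j\<in>J. (\<Sum>i<n. u i * G i 1) \<le> 30 * sqrt n / L * \<bar>\<Sum>i<n. u i * G i j\<bar>"
    by (rule gauss_max_event[OF J(1,2) _ n(1), of 1]) (use k L in \<open>auto simp: L_def\<close>)
  \<comment> \<open>Equal to 30 sqrt n \<sigma> 1 divided by \<open>eta\<close>; the factor 30 of
    \<open>gauss_max_event\<close> becomes the constant 1/30.\<close>
  define \<tau> where "\<tau> = \<sigma> 1 * (30 * sqrt n / L) / \<sigma> i"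
  have \<tau>: "0 \<le> \<tau>" using pos pos1 L0 by (simp add: \<tau>_def)
  have "inverse (1 / \<sigma> 1 + sqrt n / (1 / 30 * eta N \<sigma> k)) = \<sigma> 1 / (1 + \<tau>)"
    using pos pos1 L0 by (simp add: \<tau>_def \<eta>_eq field_simps)
  then show ?thesis
  proof (elim ssubst, intro haar_radius_event[OF haar n(2) _ \<sigma> S(1,2)])
    fix G assume G: "G \<in> space (gauss_mat n N)" "G \<notin> S" "full_rank N n G"
    show "\<sigma> 1 / (1 + \<tau>) \<le> random_radius N \<sigma> 1 (gauss_ker N n G)"
    proof (rule l1_kernel_radius[OF G(3) \<sigma> _ J(1,3) _ pos pos1 \<tau>])
      fix u
      obtain j where j: "j \<in> J" "(\<Sum>i<n. u i * G i 1) \<le> 30 * sqrt n / L * \<bar>\<Sum>i<n. u i * G i j\<bar>"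
        using S(3)[OF G(1,2)] by blast
      have "\<sigma> 1 * (\<Sum>i<n. u i * G i 1) \<le> \<sigma> 1 * (30 * sqrt n / L * \<bar>\<Sum>i<n. u i * G i j\<bar>)"
        using j(2) pos1 by (intro mult_left_mono) auto
      also have "\<dots> = \<tau> * \<sigma> i * \<bar>\<Sum>i<n. u i * G i j\<bar>" using pos by (simp add: \<tau>_def)
      finally show "\<exists>j\<in>J. \<sigma> 1 * (\<Sum>i<n. u i * G i 1) \<le> \<tau> * \<sigma> i * \<bar>\<Sum>i<n. u i * G i j\<bar>"
        using j(1) by blast
    qed (use k i le J_def in auto)
  qed simp
qed


section \<open>Degenerate cases and the maximum over the index\<close>

lemma ereal_inverse_sum:
  assumes "0 \<le> r" "0 \<le> t" "0 < a"
  shows "inverse (1 / ereal r + ereal a * inverse (ereal t))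
    = (if 0 < r \<and> 0 < t then ereal (inverse (1 / r + a / t)) else 0)"
proof (cases "0 < r \<and> 0 < t")
  case True
  then have "0 < 1 / r + a / t" using assms by (intro add_pos_pos) auto
  with True show ?thesis by (simp add: one_ereal_def divide_inverse)
next
  case False
  then have "r = 0 \<or> t = 0" using assms by auto
  then show ?thesis
    using assms by (auto simp: one_ereal_def divide_ereal_def)
qed

text \<open>For the minimum m of the two numbers, both reciprocals are at most 1 / m, so their sum
  is at most 2 / m.\<close>

lemma half_min_le_inverse_sum:
  fixes r t :: real
  assumes "0 < r" "0 < t" "0 < a"
  shows "1 / 2 * min r (t / a) \<le> inverse (1 / r + a / t)"
proof -
  define m where "m = min r (t / a)"
  have m: "0 < m" "m \<le> r" "m \<le> t / a" using assms by (auto simp: m_def)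
  have "1 / r \<le> 1 / m" using m by (intro divide_left_mono) auto
  moreover have "a / t = 1 / (t / a)" by simp
  moreover have "0 < t / a" using assms by simp
  then have "1 / (t / a) \<le> 1 / m" using m by (intro divide_left_mono mult_pos_pos) auto
  ultimately have "1 / r + a / t \<le> 2 / m" by simp
  moreover have "0 < 1 / r + a / t" using assms by (intro add_pos_pos) auto
  ultimately have "inverse (2 / m) \<le> inverse (1 / r + a / t)" by (intro le_imp_inverse_le) auto
  then show ?thesis by (simp add: m_def)
qed

text \<open>Both the maximum of the bounds and the second inequality are deterministic, so a bound for a
  single maximizing index suffices.\<close>

lemma measure_max_bound:
  fixes r t :: "nat \<Rightarrow> real" and R :: "'a \<Rightarrow> real" and b :: "nat \<Rightarrow> ereal" and e :: real
  assumes \<mu>: "prob_space \<mu>" and I: "finite I" "I \<noteq> {}" and a: "0 < a" and e: "0 \<le> e"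
    and nonneg: "\<And>k. k \<in> I \<Longrightarrow> 0 \<le> r k" "\<And>k. k \<in> I \<Longrightarrow> 0 \<le> t k" "\<And>E. E \<in> space \<mu> \<Longrightarrow> 0 \<le> R E"
    and b: "\<And>k. b k = inverse (1 / ereal (r k) + ereal a * inverse (ereal (t k)))"
    and bound: "\<And>k. k \<in> I \<Longrightarrow> 0 < r k \<Longrightarrow> 0 < t k \<Longrightarrow>
      1 - e \<le> measure \<mu> {E \<in> space \<mu>. inverse (1 / r k + a / t k) \<le> R E}"
  shows "1 - e \<le> measure \<mu> {E \<in> space \<mu>. (MAX k\<in>I. b k) \<le> ereal (R E) \<and>
    ereal (1 / 2 * (MAX k\<in>I. min (r k) (t k / a))) \<le> (MAX k\<in>I. b k)}"
proof -
  have "ereal (1 / 2 * min (r k) (t k / a)) \<le> b k" if k: "k \<in> I" for k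
  proof (cases "0 < r k \<and> 0 < t k")
    case True
    then show ?thesis
      using half_min_le_inverse_sum[of "r k" "t k" a] a
      unfolding b ereal_inverse_sum[OF nonneg(1,2)[OF k] a] by simp
  next
    case False
    then have "min (r k) (t k / a) = 0" using nonneg(1,2)[OF k] a by (auto simp: min_def zero_le_divide_iff)
    then show ?thesis
      unfolding b ereal_inverse_sum[OF nonneg(1,2)[OF k] a] using False by auto
  qed
  moreover have "(MAX k\<in>I. min (r k) (t k / a)) \<in> (\<lambda>k. min (r k) (t k / a)) ` I" using I by (intro Max_in) auto
  then obtain l where "l \<in> I" "(MAX k\<in>I. min (r k) (t k / a)) = min (r l) (t l / a)" by auto
  moreover have "b k \<le> (MAX k\<in>I. b k)" if "k \<in> I" for k using I that by (intro Max_ge) auto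
  ultimately have det: "ereal (1 / 2 * (MAX k\<in>I. min (r k) (t k / a))) \<le> (MAX k\<in>I. b k)"
    by (metis order_trans)
  have "(MAX k\<in>I. b k) \<in> b ` I" using I by (intro Max_in) auto
  then obtain m where m: "m \<in> I" "(MAX k\<in>I. b k) = b m" by auto
  note b_m = b[of m, unfolded ereal_inverse_sum[OF nonneg(1,2)[OF m(1)] a]]
  have "1 - e \<le> measure \<mu> {E \<in> space \<mu>. b m \<le> ereal (R E)}"
  proof (cases "0 < r m \<and> 0 < t m")
    case True
    then show ?thesis using bound[OF m(1)] by (simp add: b_m)
  next
    case False
    \<comment> \<open>If \<open>r m\<close> or \<open>t m\<close> vanishes, the bound is 0 and holds
      for every subspace, the radius being nonnegative.\<close>
    then have "{E \<in> space \<mu>. b m \<le> ereal (R E)} = space \<mu>"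
      using nonneg(3) by (auto simp: b_m)
    then show ?thesis using prob_space.prob_space[OF \<mu>] e by simp
  qed
  then show ?thesis using det unfolding m(2) by simp
qed

theorem corollary3p5:
  shows "(\<forall>(N::nat) (n::nat) (\<sigma>::nat \<Rightarrow> real) (p::ereal) \<mu>.
      1 \<le> n \<longrightarrow> n < N \<longrightarrow>
      antimono_on {1..N} \<sigma> \<longrightarrow> (\<forall>i\<in>{1..N}. 0 \<le> \<sigma> i) \<longrightarrow>
      is_haar_grassmannian N (N - n) \<mu> \<longrightarrow>
      1 < p \<longrightarrow> I_set N n \<sigma> p \<noteq> {} \<longrightarrow>
      measure \<mu> {E \<in> space \<mu>.
          ereal (random_radius N \<sigma> p E) \<ge> (MAX k\<in>I_set N n \<sigma> p. lower_bound N n \<sigma> p k) \<and>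
          (MAX k\<in>I_set N n \<sigma> p. lower_bound N n \<sigma> p k) \<ge>
            ereal (1 / 2 * (MAX k\<in>I_set N n \<sigma> p.
              min (r_radius \<sigma> p k) (1 / (8 * sqrt n) * conj_tail N \<sigma> p k)))}
        \<ge> 1 - 2 * exp (- 2 * real n))
    \<and> (\<exists>c>0. \<exists>C>0. \<forall>(N::nat) (n::nat) (\<sigma>::nat \<Rightarrow> real) \<mu>.
      1 \<le> n \<longrightarrow> n < N \<longrightarrow>
      antimono_on {1..N} \<sigma> \<longrightarrow> (\<forall>i\<in>{1..N}. 0 \<le> \<sigma> i) \<longrightarrow>
      is_haar_grassmannian N (N - n) \<mu> \<longrightarrow>
      eta_set C N n \<sigma> \<noteq> {} \<longrightarrow>
      measure \<mu> {E \<in> space \<mu>.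
          ereal (random_radius N \<sigma> 1 E) \<ge> (MAX k\<in>eta_set C N n \<sigma>. lower_bound_1 c N n \<sigma> k) \<and>
          (MAX k\<in>eta_set C N n \<sigma>. lower_bound_1 c N n \<sigma> k) \<ge>
            ereal (1 / 2 * (MAX k\<in>eta_set C N n \<sigma>.
              min (\<sigma> 1) (c * eta N \<sigma> k / sqrt n)))}
        \<ge> 1 - 2 * exp (- 2 * real n))"
proof (intro conjI allI impI)
  fix N n :: nat and \<sigma> :: "nat \<Rightarrow> real" and p :: ereal and \<mu>
  assume n: "1 \<le> n" "n < N" and mono: "antimono_on {1..N} \<sigma>" and \<sigma>: "\<forall>i\<in>{1..N}. 0 \<le> \<sigma> i"
    and haar: "is_haar_grassmannian N (N - n) \<mu>" and p: "1 < p" and I: "I_set N n \<sigma> p \<noteq> {}"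
  have "prob_space \<mu>" "space \<mu> = grassmannian N (N - n)" using haar by (simp_all add: is_haar_grassmannian_def)
  moreover have "finite (I_set N n \<sigma> p)"
    by (rule finite_subset[of _ "{..<N}"]) (auto simp: I_set_def)
  moreover have "0 \<le> r_radius \<sigma> p k" for k
    using \<sigma> n by (simp add: r_radius_def)
  moreover have "0 \<le> conj_tail N \<sigma> p k" for k by (simp add: conj_tail_def)
  ultimately have "1 - 2 * exp (- 2 * real n) \<le> measure \<mu> {E \<in> space \<mu>.
      (MAX k\<in>I_set N n \<sigma> p. lower_bound N n \<sigma> p k) \<le> ereal (random_radius N \<sigma> p E) \<and>
      ereal (1 / 2 * (MAX k\<in>I_set N n \<sigma> p. min (r_radius \<sigma> p k) (conj_tail N \<sigma> p k / (8 * sqrt n))))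
        \<le> (MAX k\<in>I_set N n \<sigma> p. lower_bound N n \<sigma> p k)}"
    using n p \<sigma> I
    by (intro measure_max_bound haar_radius_lower_bound[OF haar n mono \<sigma> p])
      (auto simp: lower_bound_def intro: random_radius_nonneg)
  then show "measure \<mu> {E \<in> space \<mu>.
          ereal (random_radius N \<sigma> p E) \<ge> (MAX k\<in>I_set N n \<sigma> p. lower_bound N n \<sigma> p k) \<and>
          (MAX k\<in>I_set N n \<sigma> p. lower_bound N n \<sigma> p k) \<ge>
            ereal (1 / 2 * (MAX k\<in>I_set N n \<sigma> p.
              min (r_radius \<sigma> p k) (1 / (8 * sqrt n) * conj_tail N \<sigma> p k)))}
        \<ge> 1 - 2 * exp (- 2 * real n)"
    by (simp only: mult.commute[of "1 / (8 * sqrt n)"] times_divide_eq_right mult_1_right)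
next
  show "\<exists>c>0. \<exists>C>0. \<forall>(N::nat) (n::nat) (\<sigma>::nat \<Rightarrow> real) \<mu>.
      1 \<le> n \<longrightarrow> n < N \<longrightarrow>
      antimono_on {1..N} \<sigma> \<longrightarrow> (\<forall>i\<in>{1..N}. 0 \<le> \<sigma> i) \<longrightarrow>
      is_haar_grassmannian N (N - n) \<mu> \<longrightarrow>
      eta_set C N n \<sigma> \<noteq> {} \<longrightarrow>
      measure \<mu> {E \<in> space \<mu>.
          ereal (random_radius N \<sigma> 1 E) \<ge> (MAX k\<in>eta_set C N n \<sigma>. lower_bound_1 c N n \<sigma> k) \<and>
          (MAX k\<in>eta_set C N n \<sigma>. lower_bound_1 c N n \<sigma> k) \<ge>
            ereal (1 / 2 * (MAX k\<in>eta_set C N n \<sigma>.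
              min (\<sigma> 1) (c * eta N \<sigma> k / sqrt n)))}
        \<ge> 1 - 2 * exp (- 2 * real n)"
  \<comment> \<open>The constants are c = 1/30 and C = 15, dictated by
    \<open>haar_radius_lower_bound_1\<close>.\<close>
  proof (intro exI conjI allI impI)
    fix N n :: nat and \<sigma> :: "nat \<Rightarrow> real" and \<mu>
    assume n: "1 \<le> n" "n < N" and mono: "antimono_on {1..N} \<sigma>" and \<sigma>: "\<forall>i\<in>{1..N}. 0 \<le> \<sigma> i"
      and haar: "is_haar_grassmannian N (N - n) \<mu>" and I: "eta_set 15 N n \<sigma> \<noteq> {}"
    have "prob_space \<mu>" "space \<mu> = grassmannian N (N - n)" using haar by (simp_all add: is_haar_grassmannian_def)
    moreover have "finite (eta_set 15 N n \<sigma>)"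
      by (rule finite_subset[of _ "{..<N}"]) (auto simp: eta_set_def)
    moreover have "0 \<le> \<sigma> 1" using \<sigma> n by simp
    moreover have "0 \<le> 1 / 30 * eta N \<sigma> k" if k: "k \<in> eta_set 15 N n \<sigma>" for k
    proof -
      have "0 \<le> 15 * sqrt n * \<sigma> (k + 1)" using k \<sigma> by (auto simp: eta_set_def)
      then show ?thesis using k by (auto simp: eta_set_def)
    qed
    ultimately show "1 - 2 * exp (- 2 * real n) \<le> measure \<mu> {E \<in> space \<mu>.
        (MAX k\<in>eta_set 15 N n \<sigma>. lower_bound_1 (1 / 30) N n \<sigma> k) \<le> ereal (random_radius N \<sigma> 1 E) \<and>
        ereal (1 / 2 * (MAX k\<in>eta_set 15 N n \<sigma>. min (\<sigma> 1) (1 / 30 * eta N \<sigma> k / sqrt n)))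
          \<le> (MAX k\<in>eta_set 15 N n \<sigma>. lower_bound_1 (1 / 30) N n \<sigma> k)}"
      using n \<sigma> I
      by (intro measure_max_bound haar_radius_lower_bound_1[OF haar n mono \<sigma>])
        (auto simp: lower_bound_1_def divide_ereal_def intro: random_radius_nonneg)
  qed simp_all
qed

end
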